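(* Let $A \in \mathbb{R}^{n \times d}$, let $k$ be a constant target rank, and let $\gamma > 0$ be an arbitrary (small) constant. Then there exists a deterministic algorithm, in both the streaming and the distributed summary models, which outputs a matrix $B$ of rank $k$ satisfying $$\|A - B\|_1 \le \mathrm{poly}(k) \min_{A' :\ \mathrm{rank}(A') = k} \|A - A'\|_1,$$ with update time $\mathrm{poly}(n,d)$, space bounded by $n^{\gamma}\mathrm{poly}(d)$, and query time $\mathrm{poly}(n,d)$.
   Context: $\|M\|_1 = \sum_{i,j}|M_{ij}|$ denotes the entrywise $\ell_1$ norm. Streaming model: rows of $A$ arrive one by one and only a sublinear number of rows may be stored at any time. Distributed summary model: $A$ is partitioned into blocks of at most $n^\gamma$ rows held at leaves of a computation tree; each node computes a summary of its input, parents merge and reduce summaries of their children, until a single bounded-size summary remains at the root, from which the answer is computed. Update time is the time to compute a local summary; query time is the time to compute the answer from the final summary.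
   Formalization: "Rank k" is read as rank at most k; B = UV, where V comes from the final summary but each row of U is computed from V and that row of A, read again (n^γ poly(d) space cannot determine B); computation trees have fan-in at most ⌈n^γ⌉ and height at most ⌈1/γ⌉. *)

theory Defs
  imports Complex_Main "HOL-Computational_Algebra.Polynomial" "Jordan_Normal_Form.DL_Rank"
begin

section \<open>Entrywise $\ell_1$ low-rank approximation\<close>

definition l1_norm :: "real mat \<Rightarrow> real" where
  "l1_norm M = (\<Sum>i<dim_row M. \<Sum>j<dim_col M. \<bar>M $$ (i, j)\<bar>)"

text \<open>
  ``Rank k'' is read as ``rank at most k''. The matrices of rank exactly k are not closed: if A has
  rank below k, and k is at most both dimensions, the optimal error over them is 0 and is not
  attained. Over the matrices of rank at most k the infimum is a minimum.
\<close>

definition l1_opt :: "nat \<Rightarrow> real mat \<Rightarrow> real" where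
  "l1_opt k A = (INF A'\<in>{A' \<in> carrier_mat (dim_row A) (dim_col A).
                           vec_space.rank (dim_row A) A' \<le> k}. l1_norm (A - A'))"

definition l1_lowrank_approx :: "nat \<Rightarrow> real \<Rightarrow> real mat \<Rightarrow> real mat \<Rightarrow> bool" where
  "l1_lowrank_approx k C A B \<longleftrightarrow>
     B \<in> carrier_mat (dim_row A) (dim_col A) \<and>
     vec_space.rank (dim_row A) B \<le> k \<and>
     l1_norm (A - B) \<le> C * l1_opt k A"


section \<open>A deterministic real RAM\<close>

text \<open>
  Index registers hold naturals, memory cells hold reals. There is no rounding and no conversion
  from reals to naturals, so arbitrary reals cannot be packed several to a cell. Programs contain no
  real constants. The input is a read-only list of arrays of reals and the output is write-only.
\<close>

datatype nexp =
    Num nat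
  | Reg nat
  | NPlus nexp nexp
  | NMinus nexp nexp
  | NTimes nexp nexp
  | InCount
  | InLength nexp

datatype bexp =
    NLess nexp nexp
  | CellLess nexp nexp  \<comment> \<open>compares the contents of the two addressed cells\<close>
  | BNot bexp
  | BAnd bexp bexp

datatype arith_op = Add | Sub | Mul | Div

datatype prog =
    Skip
  | SetReg nat nexp
  | LoadNat nexp nexp
  | LoadInput nexp nexp nexp  \<comment> \<open>destination cell, array, position in that array\<close>
  | Arith arith_op nexp nexp nexp  \<comment> \<open>destination cell, two operand cells\<close>
  | Emit nexp
  | Seq prog prog
  | If bexp prog prog
  | While bexp prog

record config =
  regs :: "nat \<Rightarrow> nat"
  cells :: "nat \<Rightarrow> real"
  emitted :: "real list"

fun neval :: "real list list \<Rightarrow> nexp \<Rightarrow> config \<Rightarrow> nat" where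
  "neval inp (Num m) s = m"
| "neval inp (Reg r) s = regs s r"
| "neval inp (NPlus a b) s = neval inp a s + neval inp b s"
| "neval inp (NMinus a b) s = neval inp a s - neval inp b s"
| "neval inp (NTimes a b) s = neval inp a s * neval inp b s"
| "neval inp InCount s = length inp"
| "neval inp (InLength a) s =
     (if neval inp a s < length inp then length (inp ! neval inp a s) else 0)"

fun beval :: "real list list \<Rightarrow> bexp \<Rightarrow> config \<Rightarrow> bool" where
  "beval inp (NLess a b) s \<longleftrightarrow> neval inp a s < neval inp b s"
| "beval inp (CellLess a b) s \<longleftrightarrow> cells s (neval inp a s) < cells s (neval inp b s)"
| "beval inp (BNot b) s \<longleftrightarrow> \<not> beval inp b s"
| "beval inp (BAnd b c) s \<longleftrightarrow> beval inp b s \<and> beval inp c s"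

fun arith :: "arith_op \<Rightarrow> real \<Rightarrow> real \<Rightarrow> real" where
  "arith Add x y = x + y"
| "arith Sub x y = x - y"
| "arith Mul x y = x * y"
| "arith Div x y = x / y"

text \<open>
  In \<open>exec S W inp c s t s'\<close>, only the cells with address below \<open>S\<close> can be written (all
  others keep their initial value 0), index registers hold values up to \<open>W\<close>, and \<open>t\<close> is the
  number of steps. A program that exceeds a limit, reads beyond its input or divides by 0 is stuck.
  Expressions have constant size for a fixed program, so they are charged as part of one step.
\<close>

inductive exec ::
  "nat \<Rightarrow> nat \<Rightarrow> real list list \<Rightarrow> prog \<Rightarrow> config \<Rightarrow> nat \<Rightarrow> config \<Rightarrow> bool"
  for S W :: nat and inp :: "real list list"
where
  Skip: "exec S W inp Skip s 1 s"
| SetReg: "neval inp e s \<le> W \<Longrightarrow>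
    exec S W inp (SetReg r e) s 1 (s\<lparr>regs := (regs s)(r := neval inp e s)\<rparr>)"
| LoadNat: "neval inp a s < S \<Longrightarrow>
    exec S W inp (LoadNat a e) s 1
      (s\<lparr>cells := (cells s)(neval inp a s := real (neval inp e s))\<rparr>)"
| LoadInput: "neval inp a s < S \<Longrightarrow> neval inp i s < length inp \<Longrightarrow>
    neval inp j s < length (inp ! neval inp i s) \<Longrightarrow>
    exec S W inp (LoadInput a i j) s 1
      (s\<lparr>cells := (cells s)(neval inp a s := inp ! neval inp i s ! neval inp j s)\<rparr>)"
| Arith: "neval inp a s < S \<Longrightarrow> (f = Div \<Longrightarrow> cells s (neval inp y s) \<noteq> 0) \<Longrightarrow>
    exec S W inp (Arith f a x y) s 1
      (s\<lparr>cells := (cells s)(neval inp a s :=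
           arith f (cells s (neval inp x s)) (cells s (neval inp y s)))\<rparr>)"
| Emit: "exec S W inp (Emit a) s 1 (s\<lparr>emitted := emitted s @ [cells s (neval inp a s)]\<rparr>)"
| Seq: "exec S W inp c1 s t1 s1 \<Longrightarrow> exec S W inp c2 s1 t2 s2 \<Longrightarrow>
    exec S W inp (Seq c1 c2) s (t1 + t2) s2"
| IfTrue: "beval inp b s \<Longrightarrow> exec S W inp c1 s t s1 \<Longrightarrow>
    exec S W inp (If b c1 c2) s (Suc t) s1"
| IfFalse: "\<not> beval inp b s \<Longrightarrow> exec S W inp c2 s t s1 \<Longrightarrow>
    exec S W inp (If b c1 c2) s (Suc t) s1"
| WhileFalse: "\<not> beval inp b s \<Longrightarrow> exec S W inp (While b c) s 1 s"
| WhileTrue: "beval inp b s \<Longrightarrow> exec S W inp c s t1 s1 \<Longrightarrow>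
    exec S W inp (While b c) s1 t2 s2 \<Longrightarrow>
    exec S W inp (While b c) s (Suc (t1 + t2)) s2"

inductive_cases SkipE: "exec S W inp Skip s t s'"
inductive_cases SetRegE: "exec S W inp (SetReg r e) s t s'"
inductive_cases LoadNatE: "exec S W inp (LoadNat a e) s t s'"
inductive_cases LoadInputE: "exec S W inp (LoadInput a i j) s t s'"
inductive_cases ArithE: "exec S W inp (Arith f a x y) s t s'"
inductive_cases EmitE: "exec S W inp (Emit a) s t s'"
inductive_cases SeqE: "exec S W inp (Seq c1 c2) s t s'"
inductive_cases IfE: "exec S W inp (If b c1 c2) s t s'"
inductive_cases WhileE: "exec S W inp (While b c) s t s'"

lemma exec_deterministic:
  assumes "exec S W inp c s t s'" and "exec S W inp c s u s''"
  shows "t = u \<and> s' = s''"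
  using assms
proof (induction arbitrary: u s'' rule: exec.induct)
  case Skip
  from Skip.prems show ?case by (rule SkipE) simp
next
  case SetReg
  from SetReg.prems show ?case by (rule SetRegE) simp
next
  case LoadNat
  from LoadNat.prems show ?case by (rule LoadNatE) simp
next
  case LoadInput
  from LoadInput.prems show ?case by (rule LoadInputE) simp
next
  case Arith
  from Arith.prems show ?case by (rule ArithE) simp
next
  case Emit
  from Emit.prems show ?case by (rule EmitE) simp
next
  case Seq
  from Seq.prems show ?case by (rule SeqE) (use Seq.IH in blast)
next
  case IfTrue
  from IfTrue.prems show ?case by (rule IfE) (use IfTrue.hyps IfTrue.IH in blast)+
next
  case IfFalse
  from IfFalse.prems show ?case by (rule IfE) (use IfFalse.hyps IfFalse.IH in blast)+
next
  case WhileFalse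
  from WhileFalse.prems show ?case by (rule WhileE) (use WhileFalse.hyps in simp_all)
next
  case WhileTrue
  from WhileTrue.prems show ?case by (rule WhileE) (use WhileTrue.hyps WhileTrue.IH in blast)+
qed

definition start :: "nat \<Rightarrow> nat \<Rightarrow> config" where
  "start n d = \<lparr>regs = (\<lambda>_. 0)(0 := n, 1 := d), cells = (\<lambda>_. 0), emitted = []\<rparr>"

text \<open>
  One computation on an \<open>n\<close> by \<open>d\<close> problem, in space \<open>S\<close> (for the input, for the memory and for
  the output) and time \<open>T\<close>. Index registers are limited to \<open>T\<close> as well: for \<open>T\<close> polynomial in
  \<open>n\<close> and \<open>d\<close> they have \<open>O(log (n * d))\<close> bits, as usual for a word RAM.
\<close>

definition computes ::
  "nat \<Rightarrow> nat \<Rightarrow> prog \<Rightarrow> nat \<Rightarrow> nat \<Rightarrow> real list list \<Rightarrow> real list \<Rightarrow> bool" where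
  "computes S T c n d inp out \<longleftrightarrow>
     n \<le> T \<and> d \<le> T \<and> sum_list (map length inp) \<le> S \<and> length out \<le> S \<and>
     (\<exists>t s. t \<le> T \<and> exec S T inp c (start n d) t s \<and> emitted s = out)"

text \<open>For \<open>n, d \<ge> 1\<close>, every polynomial in \<open>n\<close> and \<open>d\<close> is below \<open>poly_bound c n d\<close> for some
  \<open>c\<close>, and every \<open>n\<close> powr \<open>\<gamma>\<close> times a polynomial in \<open>d\<close> is below \<open>c * n powr \<gamma> * d ^ c\<close>.\<close>

definition poly_bound :: "nat \<Rightarrow> nat \<Rightarrow> nat \<Rightarrow> nat" where
  "poly_bound c n d = c * (n * d) ^ c"

definition space_bound :: "real \<Rightarrow> nat \<Rightarrow> nat \<Rightarrow> nat \<Rightarrow> nat" where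
  "space_bound \<gamma> c n d = nat \<lfloor>real c * real n powr \<gamma> * real d ^ c\<rfloor>"


section \<open>Summaries and answers\<close>

abbreviation mat_row :: "real mat \<Rightarrow> nat \<Rightarrow> real list" where
  "mat_row A i \<equiv> list_of_vec (row A i)"

text \<open>
  \<open>streamed S T ini upd A i s\<close>: after the first \<open>i\<close> rows of \<open>A\<close> the whole state retained by the
  algorithm is \<open>s\<close>.
\<close>

inductive streamed ::
  "nat \<Rightarrow> nat \<Rightarrow> prog \<Rightarrow> prog \<Rightarrow> real mat \<Rightarrow> nat \<Rightarrow> real list \<Rightarrow> bool"
  for S T :: nat and ini upd :: prog and A :: "real mat"
where
  "computes S T ini (dim_row A) (dim_col A) [] s \<Longrightarrow> streamed S T ini upd A 0 s"
| "streamed S T ini upd A i s \<Longrightarrow> i < dim_row A \<Longrightarrow>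
   computes S T upd (dim_row A) (dim_col A) [s, mat_row A i] s' \<Longrightarrow>
   streamed S T ini upd A (Suc i) s'"

datatype comp_tree = Leaf "nat list" | Node "comp_tree list"

fun blocks :: "comp_tree \<Rightarrow> nat list list" where
  "blocks (Leaf I) = [I]"
| "blocks (Node ts) = concat (map blocks ts)"

fun fan_in_le :: "nat \<Rightarrow> comp_tree \<Rightarrow> bool" where
  "fan_in_le f (Leaf I) \<longleftrightarrow> True"
| "fan_in_le f (Node ts) \<longleftrightarrow> ts \<noteq> [] \<and> length ts \<le> f \<and> (\<forall>t\<in>set ts. fan_in_le f t)"

fun height :: "comp_tree \<Rightarrow> nat" where
  "height (Leaf I) = 0"
| "height (Node ts) = Suc (foldr max (map height ts) 0)"

text \<open>
  Blocks of at most \<open>n powr \<gamma>\<close> rows are merged \<open>n powr \<gamma>\<close> at a time, which takes \<open>1 / \<gamma>\<close> levels.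
  With both quantities rounded up such trees exist for every \<open>n \<ge> 1\<close>. Without a bound on the
  fan-in the summaries to be merged need not fit into the space available at a node.
\<close>

definition valid_tree :: "real \<Rightarrow> nat \<Rightarrow> comp_tree \<Rightarrow> bool" where
  "valid_tree \<gamma> n t \<longleftrightarrow>
     distinct (concat (blocks t)) \<and> set (concat (blocks t)) = {..<n} \<and>
     (\<forall>I\<in>set (blocks t). I \<noteq> [] \<and> real (length I) \<le> real n powr \<gamma>) \<and>
     fan_in_le (nat \<lceil>real n powr \<gamma>\<rceil>) t \<and> height t \<le> nat \<lceil>1 / \<gamma>\<rceil>"

inductive summarized ::
  "nat \<Rightarrow> nat \<Rightarrow> prog \<Rightarrow> prog \<Rightarrow> real mat \<Rightarrow> comp_tree \<Rightarrow> real list \<Rightarrow> bool"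
  for S T :: nat and leaf mrg :: prog and A :: "real mat"
where
  "computes S T leaf (dim_row A) (dim_col A) (map (mat_row A) I) s \<Longrightarrow>
   summarized S T leaf mrg A (Leaf I) s"
| "list_all2 (summarized S T leaf mrg A) ts ss \<Longrightarrow>
   computes S T mrg (dim_row A) (dim_col A) ss s \<Longrightarrow>
   summarized S T leaf mrg A (Node ts) s"

text \<open>
  The answer is the rank-k matrix \<open>B = U * V\<close>. It has \<open>n\<close> rows, far more than the final summary
  \<open>s\<close> can determine: if \<open>A\<close> has rank \<open>k\<close> then \<open>B\<close> must be \<open>A\<close>. Hence the final summary alone
  yields the factor \<open>V\<close> (\<open>k\<close> by \<open>d\<close>, stored row by row), and row \<open>i\<close> of \<open>U\<close> is computed from
  \<open>V\<close> and row \<open>i\<close> of \<open>A\<close>, each row independently of all others.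
\<close>

definition answers ::
  "nat \<Rightarrow> nat \<Rightarrow> prog \<Rightarrow> prog \<Rightarrow> nat \<Rightarrow> real mat \<Rightarrow> real list \<Rightarrow> real mat \<Rightarrow> bool" where
  "answers S T qry fit k A s B \<longleftrightarrow>
     (\<exists>v us.
        computes S T qry (dim_row A) (dim_col A) [s] v \<and> length v = k * dim_col A \<and>
        length us = dim_row A \<and>
        (\<forall>i<dim_row A.
           computes S T fit (dim_row A) (dim_col A) [v, mat_row A i] (us ! i) \<and>
           length (us ! i) = k) \<and>
        B = mat_of_rows_list k us * mat k (dim_col A) (\<lambda>(l, j). v ! (l * dim_col A + j)))"

definition streaming_outputs ::
  "nat \<Rightarrow> nat \<Rightarrow> prog \<Rightarrow> prog \<Rightarrow> prog \<Rightarrow> prog \<Rightarrow> nat \<Rightarrow> real mat \<Rightarrow> real mat \<Rightarrow> bool" where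
  "streaming_outputs S T ini upd qry fit k A B \<longleftrightarrow>
     (\<exists>s. streamed S T ini upd A (dim_row A) s \<and> answers S T qry fit k A s B)"

definition distributed_outputs ::
  "nat \<Rightarrow> nat \<Rightarrow> prog \<Rightarrow> prog \<Rightarrow> prog \<Rightarrow> prog \<Rightarrow> nat \<Rightarrow> real mat \<Rightarrow> comp_tree \<Rightarrow> real mat \<Rightarrow> bool"
where
  "distributed_outputs S T leaf mrg qry fit k A t B \<longleftrightarrow>
     (\<exists>s. summarized S T leaf mrg A t s \<and> answers S T qry fit k A s B)"

end

theory Submission
  imports Defs
begin

text \<open>
  For \<open>q = k + 1\<close> and every \<open>q\<close>-tuple of columns of \<open>A\<close> the algorithm maintains a \<open>q\<close> by \<open>q\<close> matrix
  \<open>R\<close> with \<open>|P x| \<le> |R x| \<le> q |P x|\<close> for all \<open>x\<close>, where \<open>P\<close> consists of the rows seen so far,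
  restricted to the tuple, and the norm is the \<open>\<ell>\<^sub>1\<close> norm. Such matrices come from a basis of vertices
  of the unit ball of \<open>x \<mapsto> |P x|\<close> whose determinant is locally maximal (an Auerbach basis); the
  vertices are orthogonal to \<open>q - 1\<close> rows, hence can be enumerated in polynomial time. Stacked
  sketches are sketched again, and since there are \<open>1 / \<gamma>\<close> levels the distortion stays polynomial in
  \<open>k\<close>. Some \<open>k\<close> columns span an approximation within a factor \<open>k + 1\<close>, by the same determinant argument
  with columns weighted by their errors. The query therefore only compares the costs of all
  \<open>k\<close>-tuples of columns. Regression onto \<open>k\<close> columns is exact because an optimum lies at a vertex.

  Every output entry is a closed expression built from bounded sums and bounded searches over the
  input, so all programs arise from one compiler, which uses a constant number of memory cells.
\<close>

section \<open>Determinants by rows\<close>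

text \<open>The extra column in \<open>q = k + 1\<close> is the one to be approximated: for
  \<open>x\<close> with last coordinate -1, \<open>|P x|\<close> is the cost of approximating the
  last column of the tuple by the other k. Sketching all \<open>d\<close> columns at once would give
  distortion \<open>d\<close> and exponentially many vertices; sketching each tuple keeps the
  distortion free of \<open>d\<close>, and \<open>d ^ q\<close> sketches are few enough since k is
  constant. The lower bound on \<open>|R x|\<close> carries no factor, so the query never
  underestimates a cost and only the upper factor enters the guarantee.

  The machine has exact field operations and comparisons but no limits, no roots and no conversion
  of reals to indices. Hence optima are sought among finitely many vertices and the branching factor
  \<open>n powr \<gamma>\<close> is replaced by an integer root. The seminorm may vanish on nonzero
  vectors, as \<open>P\<close> need not have full column rank; this is what complicates the
  determinant argument.

  The factor is \<open>(k + 1) ^ (L + 2)\<close>, where \<open>L\<close> is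
  \<open>1 / \<gamma>\<close> rounded up: one factor for the sketch at a leaf, one for each of at
  most \<open>L\<close> merging levels and one for the choice of columns.\<close>

fun dt :: "nat \<Rightarrow> (nat \<Rightarrow> nat \<Rightarrow> real) \<Rightarrow> real" where
  "dt 0 f = 1"
| "dt (Suc n) f = (\<Sum>c<Suc n. (-1) ^ c * f 0 c *
     dt n (\<lambda>i j. f (Suc i) (if j < c then j else Suc j)))"

definition dotp :: "nat \<Rightarrow> (nat \<Rightarrow> real) \<Rightarrow> (nat \<Rightarrow> real) \<Rightarrow> real" where
  "dotp q u v = (\<Sum>c<q. u c * v c)"

definition unitv :: "nat \<Rightarrow> nat \<Rightarrow> real" where
  "unitv c j = (if j = c then 1 else 0)"

text \<open>The cofactors of row \<open>l\<close> as a vector: a generalised cross product of the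
  other rows. Putting a unit vector into row \<open>l\<close> yields each cofactor as a determinant
  of the same size, without indexing minors.\<close>

definition cof :: "nat \<Rightarrow> (nat \<Rightarrow> nat \<Rightarrow> real) \<Rightarrow> nat \<Rightarrow> nat \<Rightarrow> real" where
  "cof q X l c = dt q (X(l := unitv c))"

text \<open>The recursion is the Laplace expansion along the first row; for a constant size it
  unrolls into the expression \<open>dtE\<close>. This equation transfers the theory of
  \<open>det\<close> to it.\<close>

lemma dt_det: "dt n f = det (mat n n (\<lambda>(i, j). f i j))"
proof (induction n arbitrary: f)
  case 0
  then show ?case by (simp add: det_def)
next
  case (Suc n)
  let ?A = "mat (Suc n) (Suc n) (\<lambda>(i, j). f i j)"
  have "det ?A = (\<Sum>c<Suc n. ?A $$ (0, c) * cofactor ?A 0 c)"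
    by (rule laplace_expansion_row) auto
  also have "\<dots> = (\<Sum>c<Suc n. (-1) ^ c * f 0 c *
     dt n (\<lambda>i j. f (Suc i) (if j < c then j else Suc j)))"
  proof (rule sum.cong[OF refl])
    fix c assume c: "c \<in> {..<Suc n}"
    have "mat_delete ?A 0 c = mat n n (\<lambda>(i, j). f (Suc i) (if j < c then j else Suc j))"
      using c by (intro eq_matI) (auto simp: mat_delete_def)
    then show "?A $$ (0, c) * cofactor ?A 0 c = (-1) ^ c * f 0 c *
        dt n (\<lambda>i j. f (Suc i) (if j < c then j else Suc j))"
      using c by (simp add: cofactor_def Suc.IH)
  qed
  finally show ?case by simp
qed

lemma dt_cong:
  assumes "\<And>i j. i < n \<Longrightarrow> j < n \<Longrightarrow> f i j = g i j"
  shows "dt n f = dt n g"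
  unfolding dt_det by (intro arg_cong[where f = det] eq_matI) (auto simp: assms)

lemma dotp_cong:
  assumes "\<And>c. c < q \<Longrightarrow> u c = u' c" and "\<And>c. c < q \<Longrightarrow> v c = v' c"
  shows "dotp q u v = dotp q u' v'"
  unfolding dotp_def by (rule sum.cong) (simp_all add: assms)

lemma dotp_sym: "dotp q u v = dotp q v u"
  by (simp add: dotp_def mult.commute)

lemma dotp_linear [simp]:
  "dotp q u (\<lambda>c. v c + w c) = dotp q u v + dotp q u w"
  "dotp q u (\<lambda>c. v c - w c) = dotp q u v - dotp q u w"
  "dotp q u (\<lambda>c. a * v c) = a * dotp q u v"
  "dotp q u (\<lambda>c. - v c) = - dotp q u v"
  "dotp q u (\<lambda>c. 0) = 0"
  by (simp_all add: dotp_def sum.distrib sum_subtractf sum_distrib_left sum_negf algebra_simps)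

lemma dotp_sum: "dotp q u (\<lambda>c. \<Sum>l\<in>L. w l c) = (\<Sum>l\<in>L. dotp q u (w l))"
  unfolding dotp_def sum_distrib_left by (rule sum.swap)

lemma dotp_unitv [simp]: "c < q \<Longrightarrow> dotp q u (unitv c) = u c" "c < q \<Longrightarrow> dotp q (unitv c) u = u c"
  by (simp_all add: dotp_def unitv_def if_distrib if_distribR cong: if_cong)

lemma dotp_self_pos:
  assumes "c < q" and "v c \<noteq> 0"
  shows "dotp q v v > 0"
  unfolding dotp_def using assms
  by (intro sum_pos2[of _ c]) (auto simp: zero_less_mult_iff linorder_neq_iff)

lemma dt_upd:
  assumes l: "l < q"
  shows "dt q (X(l := u)) = dotp q (cof q X l) u"
proof -
  let ?A = "\<lambda>u. mat q q (\<lambda>(i, j). (X(l := u)) i j)"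
  have lap: "dt q (X(l := u)) = (\<Sum>j<q. u j * cofactor (?A u) l j)" for u
  proof -
    have "det (?A u) = (\<Sum>j<q. ?A u $$ (l, j) * cofactor (?A u) l j)"
      by (rule laplace_expansion_row) (use l in auto)
    also have "\<dots> = (\<Sum>j<q. u j * cofactor (?A u) l j)"
      using l by (intro sum.cong) auto
    finally show ?thesis by (simp add: dt_det)
  qed
  have cofac: "cofactor (?A u) l j = cofactor (?A w) l j" for u w j
  proof -
    have "mat_delete (?A u) l j = mat_delete (?A w) l j"
      by (intro eq_matI) (auto simp: mat_delete_def)
    then show ?thesis by (simp add: cofactor_def)
  qed
  have cofactor: "cof q X l c = cofactor (?A u) l c" if "c < q" for c
  proof -
    have "cof q X l c = (\<Sum>j<q. unitv c j * cofactor (?A u) l j)"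
      unfolding cof_def lap by (rule sum.cong) (auto simp: cofac[where u = "unitv c" and w = u])
    also have "\<dots> = cofactor (?A u) l c"
      using that by (simp add: unitv_def if_distrib if_distribR cong: if_cong)
    finally show ?thesis .
  qed
  show ?thesis
    unfolding lap dotp_def by (rule sum.cong) (simp_all only: lessThan_iff cofactor mult.commute)
qed

lemma dt_eq_rows:
  assumes "i < q" "j < q" "i \<noteq> j" and "\<And>c. c < q \<Longrightarrow> X i c = X j c"
  shows "dt q X = 0"
  unfolding dt_det by (rule det_identical_rows[OF _ assms(3,1,2)]) (use assms in \<open>auto intro!: eq_vecI\<close>)

lemma cof_row: "l < q \<Longrightarrow> m < q \<Longrightarrow> dotp q (cof q X l) (X m) = (if m = l then dt q X else 0)"
  using dt_upd[of l q X "X m"] dt_eq_rows[of l q m "X(l := X m)"] by (cases "m = l") simp_all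

lemma dt_unitv: "dt q unitv = 1"
proof -
  have "mat q q (\<lambda>(i, j). unitv i j) = 1\<^sub>m q"
    by (intro eq_matI) (auto simp: unitv_def)
  then show ?thesis by (simp add: dt_det)
qed

lemma orth_rows_imp_zero:
  assumes "dt q X \<noteq> 0" and orth: "\<And>i. i < q \<Longrightarrow> dotp q (X i) v = 0" and "c < q"
  shows "v c = 0"
proof (rule ccontr)
  assume "v c \<noteq> 0"
  let ?A = "mat q q (\<lambda>(i, j). X i j)"
  have "vec q v \<noteq> 0\<^sub>v q"
    using \<open>v c \<noteq> 0\<close> \<open>c < q\<close> by (metis index_vec index_zero_vec(1))
  moreover have "?A *\<^sub>v vec q v = 0\<^sub>v q"
  proof (rule eq_vecI)
    fix i assume "i < dim_vec (0\<^sub>v q :: real vec)"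
    then have i: "i < q" by simp
    have "(?A *\<^sub>v vec q v) $ i = (\<Sum>c<q. X i c * v c)"
      using i by (auto simp: scalar_prod_def atLeast0LessThan intro!: sum.cong)
    then show "(?A *\<^sub>v vec q v) $ i = 0\<^sub>v q $ i"
      using orth[OF i] i by (simp add: dotp_def)
  qed simp
  ultimately have "det ?A = 0"
    using det_0_iff_vec_prod_zero_field[of ?A q] by (metis mat_carrier vec_carrier)
  with assms(1) show False by (simp add: dt_det)
qed

text \<open>Cramer's rule. Some combination of the rows exists because the transposed matrix is
  invertible; applying \<open>cof q X l\<close>, which annihilates every row but \<open>X l\<close>,
  isolates its coefficient.\<close>

lemma cramer_rows:
  assumes dX: "dt q X \<noteq> 0" and "c < q"
  shows "u c = (\<Sum>l<q. dotp q (cof q X l) u / dt q X * X l c)"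
proof -
  let ?A = "mat q q (\<lambda>(i, j). X j i)"
  have "det ?A = dt q X"
  proof -
    have "?A = transpose_mat (mat q q (\<lambda>(i, j). X i j))" by (intro eq_matI) auto
    then show ?thesis by (simp add: dt_det det_transpose[of _ q])
  qed
  with dX have "det ?A \<noteq> 0" by simp
  from det_non_zero_imp_unit[OF _ this, of q "()"] obtain B
    where B: "B \<in> carrier_mat q q" "?A * B = 1\<^sub>m q"
    unfolding Units_def ring_mat_def by auto
  define a where "a = B *\<^sub>v vec q u"
  have a: "a \<in> carrier_vec q" using B by (simp add: a_def)
  have "?A *\<^sub>v a = (?A * B) *\<^sub>v vec q u"
    unfolding a_def using B by (intro assoc_mult_mat_vec[symmetric, of _ q q _ q]) auto
  also have "\<dots> = vec q u" using B by simp
  finally have Aa: "?A *\<^sub>v a = vec q u" .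
  have u: "u j = (\<Sum>l<q. a $ l * X l j)" if "j < q" for j
  proof -
    have "u j = (?A *\<^sub>v a) $ j" using Aa that by simp
    also have "\<dots> = (\<Sum>l<q. a $ l * X l j)"
      using that a by (auto simp: scalar_prod_def atLeast0LessThan mult.commute intro!: sum.cong)
    finally show ?thesis .
  qed
  have "dotp q (cof q X l) u = a $ l * dt q X" if l: "l < q" for l
  proof -
    have "dotp q (cof q X l) u = dotp q (cof q X l) (\<lambda>j. \<Sum>m<q. a $ m * X m j)"
      by (rule dotp_cong) (simp_all add: u)
    also have "\<dots> = (\<Sum>m<q. a $ m * (if m = l then dt q X else 0))"
      unfolding dotp_sum dotp_linear by (rule sum.cong) (use l in \<open>auto simp: cof_row\<close>)
    also have "\<dots> = a $ l * dt q X" using l by (simp add: if_distrib cong: if_cong)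
    finally show ?thesis .
  qed
  then show ?thesis using u[OF \<open>c < q\<close>] dX by simp
qed

text \<open>Steinitz exchange, one row at a time. The cofactor vector of the row to be replaced is
  nonzero and orthogonal to all other rows, in particular to those kept outside \<open>L\<close>. So
  \<open>W\<close> contains a vector not orthogonal to it, and putting that vector into the row
  keeps the determinant nonzero.\<close>

lemma complete_basis:
  assumes "finite L" and "L \<subseteq> {..<q}" and "dt q X \<noteq> 0"
    and "\<And>v. \<exists>c<q. v c \<noteq> 0 \<Longrightarrow> (\<And>m. m < q \<Longrightarrow> m \<notin> L \<Longrightarrow> dotp q v (X m) = 0) \<Longrightarrow>
           \<exists>w\<in>W. dotp q v w \<noteq> 0"
  shows "\<exists>Y. dt q Y \<noteq> 0 \<and> (\<forall>l\<in>L. Y l \<in> W) \<and> (\<forall>m. m \<notin> L \<longrightarrow> Y m = X m)"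
proof -
  have "L' \<subseteq> L \<Longrightarrow> \<exists>Y. dt q Y \<noteq> 0 \<and> (\<forall>l\<in>L'. Y l \<in> W) \<and> (\<forall>m. m \<notin> L' \<longrightarrow> Y m = X m)"
    if "finite L'" for L'
    using that
  proof (induction L')
    case empty
    then show ?case using assms(3) by auto
  next
    case (insert l L')
    then obtain Y where Y: "dt q Y \<noteq> 0" "\<forall>l\<in>L'. Y l \<in> W" "\<forall>m. m \<notin> L' \<longrightarrow> Y m = X m" by auto
    have l: "l < q" "l \<notin> L'" using insert.prems insert.hyps assms(2) by auto
    have "\<exists>c<q. cof q Y l c \<noteq> 0"
    proof (rule ccontr)
      assume "\<not> ?thesis"
      then have "dotp q (cof q Y l) (Y l) = 0" by (simp add: dotp_def)
      then show False using cof_row[of l q l Y] l Y(1) by simp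
    qed
    moreover have "dotp q (cof q Y l) (X m) = 0" if "m < q" "m \<notin> L" for m
    proof -
      have "m \<noteq> l" "Y m = X m" using that insert.prems Y(3) by auto
      then show ?thesis using cof_row[of l q m Y] l that by simp
    qed
    ultimately obtain w where w: "w \<in> W" "dotp q (cof q Y l) w \<noteq> 0"
      using assms(4) by blast
    show ?case
    proof (intro exI[of _ "Y(l := w)"] conjI)
      show "dt q (Y(l := w)) \<noteq> 0" using w l by (simp only: dt_upd) simp
    qed (use w Y l in auto)
  qed
  from this[OF assms(1)] show ?thesis by simp
qed

lemma dt_nonzero_iff: "dt q X \<noteq> 0 \<longleftrightarrow> (\<forall>v. (\<forall>i<q. dotp q (X i) v = 0) \<longrightarrow> (\<forall>c<q. v c = 0))"
proof
  assume "dt q X \<noteq> 0"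
  then show "\<forall>v. (\<forall>i<q. dotp q (X i) v = 0) \<longrightarrow> (\<forall>c<q. v c = 0)"
    using orth_rows_imp_zero by blast
next
  assume *: "\<forall>v. (\<forall>i<q. dotp q (X i) v = 0) \<longrightarrow> (\<forall>c<q. v c = 0)"
  show "dt q X \<noteq> 0"
  proof
    let ?A = "mat q q (\<lambda>(i, j). X i j)"
    assume "dt q X = 0"
    then obtain v where v: "v \<in> carrier_vec q" "v \<noteq> 0\<^sub>v q" "?A *\<^sub>v v = 0\<^sub>v q"
      using det_0_iff_vec_prod_zero_field[of ?A q] by (auto simp: dt_det)
    have "dotp q (X i) (($) v) = 0" if i: "i < q" for i
    proof -
      have "dotp q (X i) (($) v) = (?A *\<^sub>v v) $ i"
        using i v(1) by (auto simp: scalar_prod_def dotp_def atLeast0LessThan intro!: sum.cong)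
      then show ?thesis using v(3) i by simp
    qed
    with * have "\<forall>c<q. v $ c = 0" by blast
    with v(1) have "v = 0\<^sub>v q" by (intro eq_vecI) auto
    with v(2) show False by simp
  qed
qed

text \<open>\<open>cof\<close> overwrites row \<open>l\<close>, so its content is arbitrary. This is
  why \<open>q - 1\<close> digits suffice to determine the vertex in \<open>cand\<close>.\<close>

lemma cof_cong:
  assumes "\<And>i c. i < q \<Longrightarrow> i \<noteq> l \<Longrightarrow> c < q \<Longrightarrow> X i c = Y i c"
  shows "cof q X l = cof q Y l"
  by (rule ext) (auto simp: cof_def intro!: dt_cong assms)

section \<open>Vertices of the unit ball of a seminorm\<close>

definition nrm :: "nat \<Rightarrow> nat \<Rightarrow> (nat \<Rightarrow> nat \<Rightarrow> real) \<Rightarrow> (nat \<Rightarrow> real) \<Rightarrow> real" where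
  "nrm q m P x = (\<Sum>i<m. \<bar>dotp q (P i) x\<bar>)"

definition ext_row :: "nat \<Rightarrow> (nat \<Rightarrow> nat \<Rightarrow> real) \<Rightarrow> nat \<Rightarrow> nat \<Rightarrow> real" where
  "ext_row m P i c = (if i < m then P i c else if i = m + c then 1 else 0)"

text \<open>Tuples are coded by the base \<open>b\<close> digits of one number, so that a search
  over all tuples of constant length is a single bounded search.\<close>

definition dig :: "nat \<Rightarrow> nat \<Rightarrow> nat \<Rightarrow> nat" where
  "dig b t p = t div b ^ p mod b"

definition ncand :: "nat \<Rightarrow> nat \<Rightarrow> nat" where
  "ncand q m = (m + q) ^ (q - 1)"

text \<open>
  The vertex orthogonal to the \<open>q - 1\<close> rows that the base \<open>m + q\<close> digits of \<open>t\<close> select. The unit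
  vectors are available as further rows, so that a rank-deficient \<open>P\<close> is covered as well.
\<close>

definition cand :: "nat \<Rightarrow> nat \<Rightarrow> (nat \<Rightarrow> nat \<Rightarrow> real) \<Rightarrow> nat \<Rightarrow> nat \<Rightarrow> real" where
  "cand q m P t = cof q (\<lambda>i. ext_row m P (dig (m + q) t i)) (q - 1)"

lemma nrm_nonneg [simp]: "nrm q m P x \<ge> 0"
  by (simp add: nrm_def sum_nonneg)

lemma nrm_cong:
  assumes "\<And>i c. i < m \<Longrightarrow> c < q \<Longrightarrow> P i c = P' i c" and "\<And>c. c < q \<Longrightarrow> x c = x' c"
  shows "nrm q m P x = nrm q m P' x'"
  unfolding nrm_def by (intro sum.cong arg_cong[where f = abs] dotp_cong) (auto simp: assms)

lemma nrm_scale: "nrm q m P (\<lambda>c. a * x c) = \<bar>a\<bar> * nrm q m P x"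
  by (simp add: nrm_def abs_mult sum_distrib_left)

lemma nrm_triangle: "nrm q m P (\<lambda>c. \<Sum>l\<in>L. x l c) \<le> (\<Sum>l\<in>L. nrm q m P (x l))"
  unfolding nrm_def dotp_sum by (subst sum.swap) (intro sum_mono sum_abs)

lemma dig_less: "b > 0 \<Longrightarrow> dig b t p < b"
  by (simp add: dig_def)

lemma digits_exist:
  assumes "\<And>i. i < n \<Longrightarrow> g i < b"
  shows "\<exists>t<b ^ n. \<forall>i<n. dig b t i = g i"
  using assms
proof (induction n)
  case 0
  then show ?case by auto
next
  case (Suc n)
  then obtain t where t: "t < b ^ n" "\<forall>i<n. dig b t i = g i" by auto
  have g: "g n < b" using Suc.prems by simp
  then have b: "b > 0" by simp
  define u where "u = t + g n * b ^ n"
  have "u < (1 + g n) * b ^ n" using t(1) by (simp add: u_def)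
  also have "\<dots> \<le> b * b ^ n" using g by (intro mult_right_mono) auto
  finally have "u < b ^ Suc n" by simp
  moreover have "dig b u i = g i" if "i < Suc n" for i
  proof (cases "i = n")
    case True
    then show ?thesis using t(1) b g by (simp add: dig_def u_def)
  next
    case False
    then have i: "i < n" using that by simp
    have "b ^ n = b ^ i * (b * b ^ (n - i - 1))"
    proof -
      have "n = i + Suc (n - i - 1)" using i by simp
      then show ?thesis by (metis power_add power_Suc)
    qed
    then have "u = t + b ^ i * (b * (g n * b ^ (n - i - 1)))" by (simp add: u_def)
    then have "u div b ^ i = t div b ^ i + b * (g n * b ^ (n - i - 1))" using b by simp
    then show ?thesis using t(2) i by (simp add: dig_def)
  qed
  ultimately show ?case by blast
qed

lemma dotp_ext_row_unit: "c < q \<Longrightarrow> dotp q (ext_row m P (m + c)) v = v c"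
  by (simp add: dotp_def ext_row_def if_distrib if_distribR cong: if_cong)

text \<open>Moves \<open>x\<close> along \<open>v\<close> or \<open>- v\<close>, whichever does not increase the seminorm, until one more row vanishes.\<close>

lemma descent_step:
  assumes v: "c < q" "v c \<noteq> 0"
    and vZ: "\<And>i. i < m + q \<Longrightarrow> dotp q (ext_row m P i) x = 0 \<Longrightarrow> dotp q (ext_row m P i) v = 0"
  shows "\<exists>t. nrm q m P (\<lambda>c. x c + t * v c) \<le> nrm q m P x \<and>
    {i. i < m + q \<and> dotp q (ext_row m P i) x = 0} \<subset>
    {i. i < m + q \<and> dotp q (ext_row m P i) (\<lambda>c. x c + t * v c) = 0}"
proof -
  define a where "a i = dotp q (ext_row m P i) x" for i
  define b0 where "b0 i = dotp q (ext_row m P i) v" for i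
  \<comment> \<open>The derivative of the seminorm at \<open>x\<close> in a direction with row
    values \<open>b\<close>. Rows with \<open>a i = 0\<close> contribute nothing, because
    \<open>v\<close> vanishes on them as well.\<close>
  define slope where "slope b = (\<Sum>i<m. sgn (a i) * b i)" for b :: "nat \<Rightarrow> real"
  \<comment> \<open>The sign must keep the seminorm from growing and move some row towards 0. A
    negative slope forces such a row. At slope 0 the unit row of coordinate \<open>c\<close> serves:
    it is nonzero on \<open>v\<close>, hence on \<open>x\<close>, and the sign can be chosen to suit
    it.\<close>
  have "\<exists>e. (e = 1 \<or> e = -1) \<and> slope (\<lambda>i. e * b0 i) \<le> 0 \<and> (\<exists>i<m + q. a i * (e * b0 i) < 0)"
  proof -
    have neg: "\<exists>i<m + q. a i * b i < 0" if "slope b < 0" for b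
    proof (rule ccontr)
      assume *: "\<not> ?thesis"
      have "slope b \<ge> 0"
        unfolding slope_def
      proof (rule sum_nonneg)
        fix i assume "i \<in> {..<m}"
        then have "i < m + q" by simp
        with * have "a i * b i \<ge> 0" by (meson not_less)
        then show "sgn (a i) * b i \<ge> 0"
          by (auto simp: sgn_real_def zero_le_mult_iff)
      qed
      with that show False by simp
    qed
    have sm: "slope (\<lambda>i. - b0 i) = - slope b0" by (simp add: slope_def sum_negf)
    consider "slope b0 < 0" | "slope b0 > 0" | "slope b0 = 0" by linarith
    then show ?thesis
    proof cases
      case 1
      then show ?thesis using neg[of b0] by (intro exI[of _ 1]) auto
    next
      case 2
      then show ?thesis using neg[of "\<lambda>i. - b0 i"] sm by (intro exI[of _ "-1"]) auto
    next
      case 3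
      have "b0 (m + c) \<noteq> 0" using v by (simp add: b0_def dotp_ext_row_unit)
      moreover from this have "a (m + c) \<noteq> 0"
        using vZ[of "m + c"] v(1) by (auto simp: a_def b0_def)
      ultimately consider "a (m + c) * b0 (m + c) < 0" | "a (m + c) * b0 (m + c) > 0"
        by (metis linorder_neqE_linordered_idom mult_eq_0_iff)
      then show ?thesis
      proof cases
        case 1
        then show ?thesis using 3 v(1) by (intro exI[of _ 1] conjI exI[of _ "m + c"]) auto
      next
        case 2
        then show ?thesis using 3 sm v(1) by (intro exI[of _ "-1"] conjI exI[of _ "m + c"]) auto
      qed
    qed
  qed
  then obtain e where e: "slope (\<lambda>i. e * b0 i) \<le> 0" "\<exists>i<m + q. a i * (e * b0 i) < 0" by blast
  define b where "b i = e * b0 i" for i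
  have sl: "slope b \<le> 0" and ex: "\<exists>i<m + q. a i * b i < 0" using e by (auto simp: b_def[abs_def])
  define I where "I = {i. i < m + q \<and> a i * b i < 0}"
  \<comment> \<open>The first moment at which a row becomes 0. Up to then no row changes sign, so
    the seminorm is affine in the step length.\<close>
  define s where "s = Min ((\<lambda>i. - a i / b i) ` I)"
  have I: "finite I" "I \<noteq> {}" using ex by (auto simp: I_def)
  have "s \<in> (\<lambda>i. - a i / b i) ` I" unfolding s_def using I by (intro Min_in) auto
  then obtain j where j: "j \<in> I" "s = - a j / b j" by auto
  have sle: "s \<le> - a i / b i" if "i \<in> I" for i
    unfolding s_def using I that by (intro Min_le) auto
  have s0: "s \<ge> 0"
  proof -
    have "a j * b j < 0" using j by (simp add: I_def)
    then have "- (a j * b j) / (b j)\<^sup>2 \<ge> 0" by (intro divide_nonneg_nonneg) auto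
    then show ?thesis by (cases "b j = 0") (simp_all add: j(2) power2_eq_square)
  qed
  have bj: "b j \<noteq> 0" using j by (auto simp: I_def)
  have az: "b i = 0" if "a i = 0" "i < m + q" for i
    using vZ[of i] that by (simp add: a_def b_def b0_def)
  have sgnab: "\<bar>a i + s * b i\<bar> = sgn (a i) * (a i + s * b i)" if i: "i < m + q" for i
  proof (cases "a i = 0")
    case True
    then show ?thesis using az[OF True i] by simp
  next
    case False
    have "sgn (a i) * (a i + s * b i) \<ge> 0"
    proof (cases "a i * b i < 0")
      case True
      then have sl: "s \<le> - a i / b i" using sle i by (simp add: I_def)
      from True consider "a i > 0" "b i < 0" | "a i < 0" "b i > 0" by (auto simp: mult_less_0_iff)
      then show ?thesis
      proof cases
        case 1
        then have "s * b i \<ge> - a i" using sl neg_le_divide_eq[OF 1(2), of s "- a i"] by blast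
        then show ?thesis using 1 by simp
      next
        case 2
        then have "s * b i \<le> - a i" using sl pos_le_divide_eq[OF 2(2), of s "- a i"] by blast
        then show ?thesis using 2 by simp
      qed
    next
      case nn: False
      from False consider "a i > 0" | "a i < 0" by linarith
      then show ?thesis
      proof cases
        case 1
        then have "b i \<ge> 0" using nn by (simp add: not_less zero_le_mult_iff)
        then show ?thesis using 1 s0 by simp
      next
        case 2
        then have "b i \<le> 0" using nn by (simp add: not_less zero_le_mult_iff)
        then have "s * b i \<le> 0" using s0 by (simp add: mult_nonneg_nonpos)
        then show ?thesis using 2 by simp
      qed
    qed
    then show ?thesis using False by (auto simp: sgn_real_def split: if_splits)
  qed
  have eq: "dotp q (ext_row m P i) (\<lambda>c. x c + (s * e) * v c) = a i + s * b i" for i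
    by (simp add: a_def b_def b0_def)
  have nrm_alt: "nrm q m P y = (\<Sum>i<m. \<bar>dotp q (ext_row m P i) y\<bar>)" for y
    unfolding nrm_def by (intro sum.cong refl arg_cong[where f = abs] dotp_cong) (auto simp: ext_row_def)
  have "nrm q m P (\<lambda>c. x c + (s * e) * v c) = (\<Sum>i<m. sgn (a i) * (a i + s * b i))"
    unfolding nrm_alt eq by (intro sum.cong refl sgnab) auto
  also have "\<dots> = (\<Sum>i<m. \<bar>a i\<bar>) + s * slope b"
  proof -
    have "sgn (a i) * (a i + s * b i) = \<bar>a i\<bar> + s * (sgn (a i) * b i)" for i
      by (cases "a i" "0 :: real" rule: linorder_cases) (simp_all add: sgn_real_def)
    then show ?thesis by (simp add: slope_def sum_distrib_left sum.distrib)
  qed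
  also have "\<dots> \<le> nrm q m P x"
    using s0 sl by (simp add: nrm_alt a_def[symmetric] mult_nonneg_nonpos)
  finally have le: "nrm q m P (\<lambda>c. x c + (s * e) * v c) \<le> nrm q m P x" .
  have "{i. i < m + q \<and> dotp q (ext_row m P i) x = 0} \<subseteq>
    {i. i < m + q \<and> dotp q (ext_row m P i) (\<lambda>c. x c + (s * e) * v c) = 0}"
    unfolding eq using az by (auto simp: a_def)
  moreover have "j \<in> {i. i < m + q \<and> dotp q (ext_row m P i) (\<lambda>c. x c + (s * e) * v c) = 0}"
    unfolding eq using j bj by (auto simp: I_def)
  moreover have "j \<notin> {i. i < m + q \<and> dotp q (ext_row m P i) x = 0}"
    using j by (auto simp: I_def a_def)
  ultimately show ?thesis using le by (intro exI[of _ "s * e"]) blast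
qed

text \<open>
  Among the vectors with a ratio as good as that of \<open>x\<close>, one with the most vanishing rows is a multiple
  of a vertex.
\<close>

lemma vertex_dominates:
  assumes q: "q \<ge> 1" and nx: "dotp q n x \<noteq> 0"
  shows "\<exists>t<ncand q m. dotp q n (cand q m P t) \<noteq> 0 \<and>
    nrm q m P (cand q m P t) * \<bar>dotp q n x\<bar> \<le> \<bar>dotp q n (cand q m P t)\<bar> * nrm q m P x"
proof -
  define Z where "Z x = {i. i < m + q \<and> dotp q (ext_row m P i) x = 0}" for x
  define good where "good y \<longleftrightarrow> dotp q n y \<noteq> 0 \<and>
    nrm q m P y * \<bar>dotp q n x\<bar> \<le> \<bar>dotp q n y\<bar> * nrm q m P x" for y
  have "good x" using nx by (simp add: good_def)
  moreover have "card (Z y) < Suc (m + q)" for y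
    using card_mono[of "{..<m + q}" "Z y"] by (auto simp: Z_def less_Suc_eq_le)
  ultimately obtain y where y: "good y" and ymax: "\<And>z. good z \<Longrightarrow> card (Z z) \<le> card (Z y)"
    using ex_has_greatest_nat[of good x "\<lambda>y. card (Z y)" "Suc (m + q)"] by auto
  have ny: "dotp q n y \<noteq> 0" using y by (simp add: good_def)
  define W where "W = ext_row m P ` Z y"
  \<comment> \<open>The rows vanishing at \<open>y\<close> span the space together with
    \<open>n\<close>. A nonzero \<open>v\<close> orthogonal to all of them would allow a descent
    step from \<open>y\<close> that keeps the product with \<open>n\<close>, does not increase the
    ratio and makes more rows vanish than the maximum allows.\<close>
  have W: "\<exists>w\<in>W. dotp q v w \<noteq> 0" if v: "\<exists>c<q. v c \<noteq> 0" "dotp q v n = 0" for v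
  proof (rule ccontr)
    assume *: "\<not> ?thesis"
    have "dotp q (ext_row m P i) v = 0" if "i < m + q" "dotp q (ext_row m P i) y = 0" for i
      using * that by (force simp: W_def Z_def dotp_sym[of q v])
    moreover obtain c where "c < q" "v c \<noteq> 0" using v(1) by blast
    ultimately obtain t where t: "nrm q m P (\<lambda>c. y c + t * v c) \<le> nrm q m P y"
      "Z y \<subset> Z (\<lambda>c. y c + t * v c)"
      using descent_step[of c q v m P y] unfolding Z_def by blast
    have nv: "dotp q n (\<lambda>c. y c + t * v c) = dotp q n y" using v(2) by (simp add: dotp_sym)
    have "good (\<lambda>c. y c + t * v c)"
      using y order_trans[OF mult_right_mono[OF t(1) abs_ge_zero]] unfolding good_def nv by blast
    then have "card (Z (\<lambda>c. y c + t * v c)) \<le> card (Z y)" by (rule ymax)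
    moreover have "card (Z y) < card (Z (\<lambda>c. y c + t * v c))"
      using t(2) by (intro psubset_card_mono) (auto simp: Z_def)
    ultimately show False by simp
  qed
  have "\<exists>c<q. n c \<noteq> 0"
    using nx by (auto simp: dotp_def intro: sum.neutral)
  then obtain c where c: "c < q" "n c \<noteq> 0" by blast
  \<comment> \<open>The initial basis for the exchange: unit vectors with \<open>n\<close> in place
    of one of them. Its determinant is \<open>n c\<close>.\<close>
  have "dt q (unitv(c := n)) \<noteq> 0"
  proof -
    have "cof q unitv c = cof q (unitv(c := n)) c" by (rule cof_cong) auto
    have "dt q (unitv(c := n)) = dotp q (cof q unitv c) n" by (rule dt_upd[OF c(1)])
    also have "\<dots> = dotp q (unitv c) n"
    proof (rule dotp_cong)
      fix j assume j: "j < q"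
      have "cof q unitv c j = dotp q (cof q unitv c) (unitv j)" using j by simp
      also have "\<dots> = unitv c j" using cof_row[of c q j unitv] c j by (auto simp: dt_unitv unitv_def)
      finally show "cof q unitv c j = unitv c j" .
    qed simp
    finally show ?thesis using c by simp
  qed
  moreover have "\<exists>w\<in>W. dotp q v w \<noteq> 0"
    if "\<exists>c<q. v c \<noteq> 0" "\<And>m. m < q \<Longrightarrow> m \<notin> {..<q} - {c} \<Longrightarrow> dotp q v ((unitv(c := n)) m) = 0" for v
    using W[OF that(1)] that(2)[of c] c by simp
  ultimately obtain Y where Y: "dt q Y \<noteq> 0" "\<forall>l\<in>{..<q} - {c}. Y l \<in> W" "Y c = n"
    using complete_basis[of "{..<q} - {c}" q "unitv(c := n)" W] by auto
  \<comment> \<open>\<open>n\<close> has to occupy the last row, the one that \<open>cand\<close>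
    leaves free.\<close>
  define Y' where "Y' = Y(c := Y (q - 1), q - 1 := n)"
  have Y'n: "Y' (q - 1) = n" by (simp add: Y'_def)
  have Y'W: "Y' l \<in> W" if "l < q - 1" for l
  proof (cases "l = c")
    case True
    then have "q - 1 \<in> {..<q} - {c}" using that by auto
    with Y(2) have "Y (q - 1) \<in> W" by blast
    then show ?thesis using True that by (simp add: Y'_def)
  next
    case False
    then show ?thesis using that Y(2) by (auto simp: Y'_def)
  qed
  have "dt q Y' \<noteq> 0"
    unfolding dt_nonzero_iff
  proof (intro allI impI)
    fix v d assume v: "\<forall>i<q. dotp q (Y' i) v = 0" and d: "d < q"
    have "dotp q (Y i) v = 0" if i: "i < q" for i
    proof -
      consider "i = c" | "i = q - 1" "i \<noteq> c" | "i \<noteq> c" "i \<noteq> q - 1" by blast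
      then show ?thesis
      proof cases
        case 1
        then show ?thesis using v[rule_format, of "q - 1"] q Y(3) Y'n by simp
      next
        case 2
        then show ?thesis using v c by (auto simp: Y'_def)
      next
        case 3
        then show ?thesis using v i by (auto simp: Y'_def)
      qed
    qed
    then show "v d = 0" using orth_rows_imp_zero[OF Y(1)] d by blast
  qed
  define g where "g l = (SOME i. i \<in> Z y \<and> Y' l = ext_row m P i)" for l
  have g: "g l \<in> Z y" "Y' l = ext_row m P (g l)" if "l < q - 1" for l
  proof -
    have "\<exists>i. i \<in> Z y \<and> Y' l = ext_row m P i" using Y'W[OF that] by (auto simp: W_def)
    from someI_ex[OF this] show "g l \<in> Z y" "Y' l = ext_row m P (g l)" by (auto simp: g_def)
  qed
  have "g l < m + q" if "l < q - 1" for l using g[OF that] by (simp add: Z_def)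
  then obtain t where t: "t < ncand q m" "\<forall>i<q - 1. dig (m + q) t i = g i"
    using digits_exist[of "q - 1" g "m + q"] unfolding ncand_def by blast
  define u where "u = cand q m P t"
  have u: "u = cof q Y' (q - 1)"
    unfolding u_def cand_def
  proof (rule cof_cong)
    fix i c assume "i < q" "i \<noteq> q - 1" "c < q"
    then have "i < q - 1" by simp
    then show "ext_row m P (dig (m + q) t i) c = Y' i c" using t(2) g(2) by simp
  qed
  have nu: "dotp q n u = dt q Y'"
    using cof_row[of "q - 1" q "q - 1" Y'] q Y'n by (simp add: u dotp_sym[of q n])
  define r where "r = dotp q n u / dotp q n y"
  \<comment> \<open>\<open>u\<close> and \<open>r\<close> times \<open>y\<close> have the same
    products with all rows of the basis \<open>Y'\<close>: both are orthogonal to the first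
    \<open>q - 1\<close> of them, and \<open>r\<close> is chosen to match the products with
    \<open>n\<close>.\<close>
  have "u d = r * y d" if d: "d < q" for d
  proof -
    have "dotp q (Y' i) (\<lambda>c. u c - r * y c) = 0" if i: "i < q" for i
    proof (cases "i = q - 1")
      case True
      have "dotp q n (\<lambda>c. u c - r * y c) = dotp q n u - r * dotp q n y"
        by (simp only: dotp_linear)
      then show ?thesis using ny True by (simp only: Y'n) (simp add: r_def)
    next
      case False
      then have i': "i < q - 1" using i by simp
      have "dotp q (Y' i) u = 0"
        unfolding u using cof_row[of "q - 1" q i Y'] i False q by (simp add: dotp_sym)
      moreover have "dotp q (Y' i) y = 0" using g[OF i'] by (simp add: Z_def)
      ultimately show ?thesis by simp
    qed
    from orth_rows_imp_zero[OF \<open>dt q Y' \<noteq> 0\<close> this d] show ?thesis by simp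
  qed
  then have "nrm q m P u = \<bar>r\<bar> * nrm q m P y"
    by (subst nrm_scale[symmetric]) (rule nrm_cong, auto)
  then have "nrm q m P u * \<bar>dotp q n x\<bar> = \<bar>r\<bar> * (nrm q m P y * \<bar>dotp q n x\<bar>)" by simp
  also have "\<dots> \<le> \<bar>r\<bar> * (\<bar>dotp q n y\<bar> * nrm q m P x)"
    using y by (intro mult_left_mono) (auto simp: good_def)
  also have "\<dots> = \<bar>dotp q n u\<bar> * nrm q m P x"
    using ny by (simp add: r_def abs_mult[symmetric])
  finally show ?thesis
    using t(1) nu \<open>dt q Y' \<noteq> 0\<close> unfolding u_def by (intro exI[of _ t]) auto
qed

section \<open>Spanners, sketches and regression\<close>

text \<open>Weights may vanish, so the determinant is maximised relative to \<open>w + e\<close> for small \<open>e > 0\<close>.\<close>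

lemma barycentric_spanner:
  fixes y :: "nat \<Rightarrow> nat \<Rightarrow> real"
  assumes basis: "\<And>l. l < q \<Longrightarrow> f0 l < N" "dt q (\<lambda>l. y (f0 l)) \<noteq> 0"
    and w: "\<And>t. t < N \<Longrightarrow> w t \<ge> 0"
  shows "\<exists>f. (\<forall>l<q. f l < N) \<and> dt q (\<lambda>l. y (f l)) \<noteq> 0 \<and>
    (\<forall>l<q. \<forall>t<N. w (f l) * \<bar>dotp q (cof q (\<lambda>l. y (f l)) l) (y t)\<bar> \<le>
       w t * \<bar>dt q (\<lambda>l. y (f l))\<bar>)"
proof (rule ccontr)
  assume *: "\<not> ?thesis"
  define D where "D f = \<bar>dt q (\<lambda>l. y (f l))\<bar>" for f
  define C where "C f l t = \<bar>dotp q (cof q (\<lambda>l. y (f l)) l) (y t)\<bar>" for f l t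
  define F where "F = {f \<in> {..<q} \<rightarrow>\<^sub>E {..<N}. D f \<noteq> 0}"
  have "finite ({..<q} \<rightarrow>\<^sub>E {..<N})" by (rule finite_PiE) auto
  then have "finite F" by (rule finite_subset[rotated]) (auto simp: F_def)
  \<comment> \<open>If no tuple is a spanner, every basis admits an exchange that violates its
    inequality strictly.\<close>
  have "\<forall>f\<in>F. \<exists>l t. l < q \<and> t < N \<and> w t * D f < w (f l) * C f l t"
  proof
    fix f assume "f \<in> F"
    then have f: "\<forall>l<q. f l < N" "dt q (\<lambda>l. y (f l)) \<noteq> 0" by (auto simp: F_def D_def)
    show "\<exists>l t. l < q \<and> t < N \<and> w t * D f < w (f l) * C f l t"
    proof (rule ccontr)
      assume "\<not> ?thesis"
      then have "\<forall>l<q. \<forall>t<N. w (f l) * C f l t \<le> w t * D f" by (meson not_less)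
      with * f show False unfolding D_def C_def by blast
    qed
  qed
  then obtain lt0 where "\<forall>f\<in>F. fst (lt0 f) < q \<and> snd (lt0 f) < N \<and>
      w (snd (lt0 f)) * D f < w (f (fst (lt0 f))) * C f (fst (lt0 f)) (snd (lt0 f))"
    using bchoice[of F "\<lambda>f lt. fst lt < q \<and> snd lt < N \<and> w (snd lt) * D f < w (f (fst lt)) * C f (fst lt) (snd lt)"]
    by auto
  then obtain l t where lt: "\<And>f. f \<in> F \<Longrightarrow> l f < q" "\<And>f. f \<in> F \<Longrightarrow> t f < N"
    "\<And>f. f \<in> F \<Longrightarrow> w (t f) * D f < w (f (l f)) * C f (l f) (t f)"
    using that[of "fst \<circ> lt0" "snd \<circ> lt0"] by simp
  have "\<forall>\<^sub>F e in at_right 0. (w (t f) + e) * D f < (w (f (l f)) + e) * C f (l f) (t f)"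
    if "f \<in> F" for f
  proof -
    have "((\<lambda>e. (w (f (l f)) + e) * C f (l f) (t f) - (w (t f) + e) * D f) \<longlongrightarrow>
      (w (f (l f)) + 0) * C f (l f) (t f) - (w (t f) + 0) * D f) (at_right 0)"
      by (intro tendsto_intros)
    from order_tendstoD(1)[OF this, of 0] lt(3)[OF that] show ?thesis by simp
  qed
  then have "\<forall>\<^sub>F e in at_right 0. \<forall>f\<in>F. (w (t f) + e) * D f < (w (f (l f)) + e) * C f (l f) (t f)"
    using \<open>finite F\<close> by (intro eventually_ball_finite) auto
  moreover have "\<forall>\<^sub>F e in at_right (0::real). e > 0" by (simp add: eventually_at_right_less)
  ultimately have "\<forall>\<^sub>F e in at_right 0. e > 0 \<and>
      (\<forall>f\<in>F. (w (t f) + e) * D f < (w (f (l f)) + e) * C f (l f) (t f))"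
    by eventually_elim auto
  \<comment> \<open>Finitely many strict inequalities are involved, so one positive \<open>e\<close>
    preserves all of them.\<close>
  then obtain e where e: "e > 0" "\<forall>f\<in>F. (w (t f) + e) * D f < (w (f (l f)) + e) * C f (l f) (t f)"
    using eventually_happens'[OF trivial_limit_at_right_real] by blast
  \<comment> \<open>The determinant after scaling each vector by its perturbed weight. At a
    maximiser of \<open>G\<close>, the violating exchange would increase it further.\<close>
  define G where "G f = D f / (\<Prod>l<q. w (f l) + e)" for f
  have wpos: "w (f l) + e > 0" if "f \<in> F" "l < q" for f l
    using w[of "f l"] that e(1) by (auto simp: F_def intro: add_nonneg_pos)
  have "restrict f0 {..<q} \<in> F"
  proof -
    have "dt q (\<lambda>l. y (restrict f0 {..<q} l)) = dt q (\<lambda>l. y (f0 l))" by (rule dt_cong) auto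
    then show ?thesis using basis by (auto simp: F_def D_def)
  qed
  then have "F \<noteq> {}" by auto
  obtain f where f: "f \<in> F" and fmax: "\<And>g. g \<in> F \<Longrightarrow> G g \<le> G f"
  proof -
    have "Max (G ` F) \<in> G ` F" using \<open>finite F\<close> \<open>F \<noteq> {}\<close> by (intro Max_in) auto
    then obtain f where "f \<in> F" "G f = Max (G ` F)" by auto
    then show ?thesis using that[of f] \<open>finite F\<close> by simp
  qed
  define g where "g = f(l f := t f)"
  let ?X = "\<lambda>l. y (f l)"
  have Dg: "D g = C f (l f) (t f)"
  proof -
    have "(\<lambda>l. y (g l)) = ?X(l f := y (t f))" by (auto simp: g_def)
    then show ?thesis using dt_upd[OF lt(1)[OF f], of ?X] by (simp add: D_def C_def)
  qed
  have "C f (l f) (t f) > 0"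
  proof (rule ccontr)
    assume "\<not> ?thesis"
    then have "C f (l f) (t f) = 0" by (auto simp: C_def)
    moreover have "0 \<le> (w (t f) + e) * D f" using w[OF lt(2)[OF f]] e(1) by (simp add: D_def)
    ultimately show False using bspec[OF e(2) f] by simp
  qed
  then have "g \<in> F" using f lt(1,2)[OF f] Dg by (auto simp: F_def g_def PiE_def extensional_def)
  define Q where "Q = (\<Prod>l\<in>{..<q} - {l f}. w (f l) + e)"
  have Q: "Q > 0" unfolding Q_def using wpos[OF f] by (intro prod_pos) auto
  have "(\<Prod>l<q. w (f l) + e) = (w (f (l f)) + e) * Q"
    unfolding Q_def using lt(1)[OF f] by (intro prod.remove) auto
  moreover have "(\<Prod>l<q. w (g l) + e) = (w (t f) + e) * Q"
  proof -
    have "(\<Prod>l<q. w (g l) + e) = (w (g (l f)) + e) * (\<Prod>l\<in>{..<q} - {l f}. w (g l) + e)"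
      using lt(1)[OF f] by (intro prod.remove) auto
    also have "(\<Prod>l\<in>{..<q} - {l f}. w (g l) + e) = Q"
      unfolding Q_def by (rule prod.cong) (auto simp: g_def)
    finally show ?thesis by (simp add: g_def)
  qed
  ultimately have "C f (l f) (t f) / ((w (t f) + e) * Q) \<le> D f / ((w (f (l f)) + e) * Q)"
    using fmax[OF \<open>g \<in> F\<close>] by (simp add: G_def Dg)
  moreover have "w (t f) + e > 0" "w (f (l f)) + e > 0"
    using w[OF lt(2)[OF f]] e(1) wpos[OF f lt(1)[OF f]] by auto
  moreover have "x * c \<le> y * d" if "c / (y * Q) \<le> d / (x * Q)" "x > 0" "y > 0" for x y c d :: real
  proof -
    have "c / y \<le> d / x" using that Q by (simp add: field_simps)
    then show ?thesis using that by (simp add: field_simps)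
  qed
  ultimately have "(w (f (l f)) + e) * C f (l f) (t f) \<le> (w (t f) + e) * D f"
    by blast
  with bspec[OF e(2) f] show False by simp
qed

text \<open>Bounded search that returns \<open>B\<close> if nothing below \<open>B\<close> is found,
  exactly the value that the loop of \<open>find_prog\<close> leaves in its register.\<close>

definition sel :: "nat \<Rightarrow> (nat \<Rightarrow> bool) \<Rightarrow> nat" where
  "sel B p = (LEAST i. i = B \<or> p i)"

lemma sel_works:
  assumes "i < B" and "p i"
  shows "sel B p < B \<and> p (sel B p)"
proof -
  have "sel B p = B \<or> p (sel B p)" unfolding sel_def by (rule LeastI[of _ i]) (use assms in simp)
  moreover have "sel B p \<le> i" unfolding sel_def by (rule Least_le) (use assms in simp)
  ultimately show ?thesis using assms by auto
qed

definition tuple :: "nat \<Rightarrow> nat \<Rightarrow> (nat \<Rightarrow> nat \<Rightarrow> real) \<Rightarrow> nat \<Rightarrow> nat \<Rightarrow> nat \<Rightarrow> real" where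
  "tuple q m P s l = cand q m P (dig (ncand q m) s l)"

text \<open>The Auerbach condition, tested on vertices only: with all vectors scaled to seminorm 1,
  no exchange of one member for another vertex increases the determinant. It is multiplied out
  because seminorms may be 0.\<close>

definition spanning :: "nat \<Rightarrow> nat \<Rightarrow> (nat \<Rightarrow> nat \<Rightarrow> real) \<Rightarrow> nat \<Rightarrow> bool" where
  "spanning q m P s \<longleftrightarrow> dt q (tuple q m P s) \<noteq> 0 \<and>
     (\<forall>l<q. \<forall>t<ncand q m.
        nrm q m P (tuple q m P s l) * \<bar>dotp q (cof q (tuple q m P s) l) (cand q m P t)\<bar> \<le>
        nrm q m P (cand q m P t) * \<bar>dt q (tuple q m P s)\<bar>)"

text \<open>Row \<open>l\<close> is the coordinate functional of the \<open>l\<close>-th basis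
  vector, times the seminorm of that vector. Thus the sketch of \<open>x\<close> lists the seminorms
  of the components of \<open>x\<close>, up to sign.\<close>

definition sketch :: "nat \<Rightarrow> nat \<Rightarrow> (nat \<Rightarrow> nat \<Rightarrow> real) \<Rightarrow> nat \<Rightarrow> nat \<Rightarrow> real" where
  "sketch q m P l c =
     (let s = sel (ncand q m ^ q) (spanning q m P)
      in nrm q m P (tuple q m P s l) * cof q (tuple q m P s) l c / dt q (tuple q m P s))"

text \<open>The vertices span: for nonzero \<open>v\<close>, \<open>vertex_dominates\<close> with
  the functional \<open>v\<close> yields a vertex not orthogonal to \<open>v\<close>. So the unit
  basis can be exchanged for vertices, and the seminorm serves as weight for
  \<open>barycentric_spanner\<close>.\<close>

lemma spanning_exists:
  assumes q: "q \<ge> 1"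
  shows "\<exists>s<ncand q m ^ q. spanning q m P s"
proof -
  let ?N = "ncand q m"
  let ?y = "cand q m P"
  have "\<exists>Y. dt q Y \<noteq> 0 \<and> (\<forall>l\<in>{..<q}. Y l \<in> ?y ` {..<?N}) \<and> (\<forall>m. m \<notin> {..<q} \<longrightarrow> Y m = unitv m)"
  proof (rule complete_basis)
    fix v :: "nat \<Rightarrow> real" assume "\<exists>c<q. v c \<noteq> 0"
    then have "dotp q v v \<noteq> 0" using dotp_self_pos by (metis less_irrefl)
    from vertex_dominates[OF q this, of m P] show "\<exists>w\<in>?y ` {..<?N}. dotp q v w \<noteq> 0" by auto
  qed (auto simp: dt_unitv)
  then obtain Y where Y: "dt q Y \<noteq> 0" "\<forall>l\<in>{..<q}. Y l \<in> ?y ` {..<?N}" by blast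
  have "\<forall>l\<in>{..<q}. \<exists>t. t < ?N \<and> Y l = ?y t" using Y(2) by auto
  then obtain f0 where f0: "\<And>l. l < q \<Longrightarrow> f0 l < ?N \<and> Y l = ?y (f0 l)" by (metis lessThan_iff)
  have "dt q (\<lambda>l. ?y (f0 l)) = dt q Y" by (rule dt_cong) (simp add: f0)
  with Y(1) have "dt q (\<lambda>l. ?y (f0 l)) \<noteq> 0" by simp
  from barycentric_spanner[where y = ?y and N = ?N and w = "\<lambda>t. nrm q m P (?y t)", OF _ this] f0
  obtain f where f: "\<forall>l<q. f l < ?N" "dt q (\<lambda>l. ?y (f l)) \<noteq> 0"
    "\<forall>l<q. \<forall>t<?N. nrm q m P (?y (f l)) * \<bar>dotp q (cof q (\<lambda>l. ?y (f l)) l) (?y t)\<bar> \<le>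
       nrm q m P (?y t) * \<bar>dt q (\<lambda>l. ?y (f l))\<bar>"
    by auto
  obtain s where s: "s < ?N ^ q" "\<forall>i<q. dig ?N s i = f i"
    using digits_exist[of q f ?N] f(1) by auto
  have 1: "dt q (tuple q m P s) = dt q (\<lambda>l. ?y (f l))"
    by (rule dt_cong) (simp add: tuple_def s)
  have 2: "cof q (tuple q m P s) l = cof q (\<lambda>l. ?y (f l)) l" for l
    by (rule cof_cong) (simp add: tuple_def s)
  have "spanning q m P s"
    unfolding spanning_def 1 2 using f(2,3) s(2) by (auto simp: tuple_def)
  with s(1) show ?thesis by blast
qed

text \<open>The lower bound is the triangle inequality for the expansion of \<open>x\<close> in the
  basis. For the upper bound, each coordinate functional attains its largest ratio to the seminorm
  at a vertex by \<open>vertex_dominates\<close>, and there the Auerbach condition bounds the scaled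
  coordinate by the seminorm; summing over \<open>q\<close> rows gives the factor
  \<open>q\<close>.\<close>

lemma sketch_bounds:
  assumes q: "q \<ge> 1"
  shows "nrm q m P x \<le> nrm q q (sketch q m P) x" and
    "nrm q q (sketch q m P) x \<le> real q * nrm q m P x"
proof -
  define s where "s = sel (ncand q m ^ q) (spanning q m P)"
  define X where "X = tuple q m P s"
  obtain s0 where "s0 < ncand q m ^ q" "spanning q m P s0" using spanning_exists[OF q] by blast
  then have sp: "spanning q m P s"
    unfolding s_def using sel_works[of s0 _ "spanning q m P"] by blast
  have dX: "dt q X \<noteq> 0" using sp by (simp add: spanning_def X_def)
  have R: "dotp q (sketch q m P l) x = dotp q (cof q X l) x / dt q X * nrm q m P (X l)" for l
    by (simp add: dotp_def sketch_def Let_def sum_distrib_left sum_divide_distrib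
        s_def[symmetric] X_def[symmetric] mult_ac)
  have "nrm q m P x = nrm q m P (\<lambda>c. \<Sum>l<q. dotp q (cof q X l) x / dt q X * X l c)"
    by (rule nrm_cong[OF refl]) (rule cramer_rows[OF dX])
  also have "\<dots> \<le> (\<Sum>l<q. nrm q m P (\<lambda>c. dotp q (cof q X l) x / dt q X * X l c))"
    by (rule nrm_triangle)
  also have "\<dots> = nrm q q (sketch q m P) x"
    unfolding nrm_scale nrm_def[of q q] R by (simp add: abs_mult)
  finally show "nrm q m P x \<le> nrm q q (sketch q m P) x" .
  have "\<bar>dotp q (sketch q m P l) x\<bar> \<le> nrm q m P x" if l: "l < q" for l
  proof (cases "dotp q (cof q X l) x = 0")
    case True
    then show ?thesis by (simp add: R)
  next
    case False
    let ?n = "cof q X l"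
    from vertex_dominates[OF q False, of m P] obtain t where t: "t < ncand q m"
      "dotp q ?n (cand q m P t) \<noteq> 0"
      "nrm q m P (cand q m P t) * \<bar>dotp q ?n x\<bar> \<le> \<bar>dotp q ?n (cand q m P t)\<bar> * nrm q m P x" by blast
    have "nrm q m P (X l) * \<bar>dotp q ?n (cand q m P t)\<bar> \<le> nrm q m P (cand q m P t) * \<bar>dt q X\<bar>"
      using sp l t(1) by (simp add: spanning_def X_def)
    then have "\<bar>dotp q ?n x\<bar> * (nrm q m P (X l) * \<bar>dotp q ?n (cand q m P t)\<bar>)
      \<le> \<bar>dotp q ?n x\<bar> * (nrm q m P (cand q m P t) * \<bar>dt q X\<bar>)"
      by (rule mult_left_mono) simp
    also have "\<dots> \<le> \<bar>dotp q ?n (cand q m P t)\<bar> * nrm q m P x * \<bar>dt q X\<bar>"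
      using mult_right_mono[OF t(3), of "\<bar>dt q X\<bar>"] by (simp add: mult_ac)
    finally have "\<bar>dotp q ?n (cand q m P t)\<bar> * (\<bar>dotp q ?n x\<bar> * nrm q m P (X l)) \<le>
        \<bar>dotp q ?n (cand q m P t)\<bar> * (nrm q m P x * \<bar>dt q X\<bar>)" by (simp add: mult_ac)
    then have "\<bar>dotp q ?n x\<bar> * nrm q m P (X l) \<le> nrm q m P x * \<bar>dt q X\<bar>"
      using t(2) by (simp add: mult_le_cancel_left_pos)
    then show ?thesis using dX by (simp add: R abs_mult field_simps)
  qed
  then have "nrm q q (sketch q m P) x \<le> (\<Sum>l<q. nrm q m P x)"
    unfolding nrm_def[of q q] by (intro sum_mono) auto
  then show "nrm q q (sketch q m P) x \<le> real q * nrm q m P x" by simp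
qed

section \<open>Exact regression in the l1 norm\<close>

definition best :: "nat \<Rightarrow> nat \<Rightarrow> (nat \<Rightarrow> nat \<Rightarrow> real) \<Rightarrow> nat \<Rightarrow> bool" where
  "best q m P t \<longleftrightarrow> cand q m P t (q - 1) \<noteq> 0 \<and>
     (\<forall>u<ncand q m. nrm q m P (cand q m P t) * \<bar>cand q m P u (q - 1)\<bar> \<le>
        nrm q m P (cand q m P u) * \<bar>cand q m P t (q - 1)\<bar>)"

text \<open>With last coordinate -1, \<open>nrm\<close> is the cost of approximating the last column
  of \<open>P\<close> by the others. Its minimum is the minimal ratio of the seminorm to the modulus
  of the last coordinate; this scale-invariant problem is solved by a vertex, which is then
  rescaled.\<close>

definition fit_vec :: "nat \<Rightarrow> nat \<Rightarrow> (nat \<Rightarrow> nat \<Rightarrow> real) \<Rightarrow> nat \<Rightarrow> real" where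
  "fit_vec q m P c = (let y = cand q m P (sel (ncand q m) (best q m P)) in - y c / y (q - 1))"

lemma best_exists:
  assumes q: "q \<ge> 1"
  shows "\<exists>t<ncand q m. best q m P t"
proof -
  let ?y = "cand q m P"
  define F where "F = {t. t < ncand q m \<and> ?y t (q - 1) \<noteq> 0}"
  define G where "G t = nrm q m P (?y t) / \<bar>?y t (q - 1)\<bar>" for t
  have fin: "finite F" by (simp add: F_def)
  have "dotp q (unitv (q - 1)) (unitv (q - 1)) \<noteq> 0" using q by (simp add: unitv_def)
  from vertex_dominates[OF q this, of m P] have "F \<noteq> {}" using q by (auto simp: F_def)
  then have "Min (G ` F) \<in> G ` F" using fin by (intro Min_in) auto
  then obtain t where t: "t \<in> F" "G t = Min (G ` F)" by auto
  have "nrm q m P (?y t) * \<bar>?y u (q - 1)\<bar> \<le> nrm q m P (?y u) * \<bar>?y t (q - 1)\<bar>" if u: "u < ncand q m" for u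
  proof (cases "?y u (q - 1) = 0")
    case True
    then show ?thesis by simp
  next
    case False
    then have "u \<in> F" using u by (simp add: F_def)
    then have "G t \<le> G u" using t(2) fin by simp
    then show ?thesis using False t(1) by (simp add: G_def F_def field_simps)
  qed
  then show ?thesis using t(1) by (auto simp: best_def F_def)
qed

text \<open>\<open>vertex_dominates\<close> for the last coordinate functional provides a vertex
  with a ratio no worse than that of \<open>x\<close>, and \<open>best\<close> beats every
  vertex.\<close>

lemma fit_vec_optimal:
  assumes q: "q \<ge> 1" and x: "x (q - 1) = -1"
  shows "fit_vec q m P (q - 1) = -1" and "nrm q m P (fit_vec q m P) \<le> nrm q m P x"
proof -
  define t where "t = sel (ncand q m) (best q m P)"
  let ?y = "cand q m P"
  obtain t0 where "t0 < ncand q m" "best q m P t0" using best_exists[OF q] by blast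
  then have b: "best q m P t"
    unfolding t_def using sel_works[of t0 _ "best q m P"] by blast
  then have nz: "?y t (q - 1) \<noteq> 0" by (simp add: best_def)
  have f: "fit_vec q m P = (\<lambda>c. (- 1 / ?y t (q - 1)) * ?y t c)"
    by (simp add: fit_vec_def Let_def t_def fun_eq_iff)
  show "fit_vec q m P (q - 1) = -1" using nz by (simp add: f)
  have "dotp q (unitv (q - 1)) x \<noteq> 0" using q x by simp
  from vertex_dominates[OF q this, of m P] obtain u where u: "u < ncand q m" "?y u (q - 1) \<noteq> 0"
    "nrm q m P (?y u) \<le> \<bar>?y u (q - 1)\<bar> * nrm q m P x" using q x by auto
  have "nrm q m P (?y t) * \<bar>?y u (q - 1)\<bar> \<le> nrm q m P (?y u) * \<bar>?y t (q - 1)\<bar>"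
    using b u(1) by (simp add: best_def)
  also have "\<dots> \<le> \<bar>?y u (q - 1)\<bar> * nrm q m P x * \<bar>?y t (q - 1)\<bar>"
    using u(3) by (rule mult_right_mono) simp
  finally have "\<bar>?y u (q - 1)\<bar> * nrm q m P (?y t) \<le> \<bar>?y u (q - 1)\<bar> * (nrm q m P x * \<bar>?y t (q - 1)\<bar>)"
    by (simp add: mult_ac)
  then have "nrm q m P (?y t) \<le> nrm q m P x * \<bar>?y t (q - 1)\<bar>" using u(2) by simp
  then show "nrm q m P (fit_vec q m P) \<le> nrm q m P x"
    unfolding f nrm_scale using nz by (simp add: field_simps)
qed

section \<open>Column subset selection\<close>

text \<open>Coordinates of all columns with respect to a maximal independent set of columns. The
  members of the set get the unit vectors, which supply the initial basis that
  \<open>barycentric_spanner\<close> asks for.\<close>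

lemma rank_column_coordinates:
  fixes A :: "real mat"
  assumes A: "A \<in> carrier_mat n d" and rk: "vec_space.rank n A \<le> k"
  shows "\<exists>r\<le>k. \<exists>c V. (\<forall>l<r. c l < d) \<and> (\<forall>l<r. V (c l) = unitv l) \<and>
    (\<forall>i<n. \<forall>j<d. A $$ (i, j) = (\<Sum>l<r. V j l * A $$ (i, c l)))"
proof -
  interpret vec_space "TYPE(real)" n .
  have C: "set (cols A) \<subseteq> carrier_vec n" using cols_dim A by blast
  obtain S where S: "finite S" "maximal S (\<lambda>T. T \<subseteq> set (cols A) \<and> lin_indpt T)"
    using maximal_exists_superset[of "set (cols A)" "\<lambda>T. T \<subseteq> set (cols A) \<and> lin_indpt T" "{}"]
    by (auto simp: lin_dep_def)
  have SA: "S \<subseteq> set (cols A)" and SI: "lin_indpt S" using S(2) by (auto simp: maximal_def)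
  have card: "card S \<le> k" using rk rank_card_indpt[OF A S(2)] by simp
  define r where "r = card S"
  have Sc: "S \<subseteq> carrier_vec n" using SA C by blast
  have span: "v \<in> span S" if v: "v \<in> set (cols A)" for v
  proof (cases "v \<in> S")
    case True
    then show ?thesis using Sc by (intro span_mem) auto
  next
    case False
    have "\<not> lin_indpt (insert v S)"
    proof
      assume "lin_indpt (insert v S)"
      then have "insert v S = S" using S(2) v SA by (auto simp: maximal_def)
      with False show False by blast
    qed
    then show ?thesis using lin_dep_iff_in_span[of S v] Sc SI v C False by auto
  qed
  obtain h where h: "bij_betw h {..<r} S"
    using ex_bij_betw_nat_finite[OF S(1)] by (auto simp: r_def atLeast0LessThan)
  have hS: "h l \<in> S" if "l < r" for l using h that by (auto simp: bij_betw_def)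
  have "\<forall>l\<in>{..<r}. \<exists>c. c < d \<and> h l = col A c"
  proof
    fix l assume "l \<in> {..<r}"
    then have "h l \<in> set (cols A)" using hS SA by auto
    then show "\<exists>c. c < d \<and> h l = col A c" using A by (auto simp: cols_def)
  qed
  then obtain c where c: "\<And>l. l < r \<Longrightarrow> c l < d" "\<And>l. l < r \<Longrightarrow> h l = col A (c l)"
    by (auto dest!: bchoice)
  have cinj: "l = l'" if "c l = c l'" "l < r" "l' < r" for l l'
  proof -
    have "h l = h l'" using that c by simp
    then show ?thesis using h that by (auto simp: bij_betw_def inj_on_def)
  qed
  define good where "good j v \<longleftrightarrow> (\<forall>l<r. j = c l \<longrightarrow> v = unitv l) \<and>
      (\<forall>i<n. A $$ (i, j) = (\<Sum>l<r. v l * A $$ (i, c l)))" for j v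
  have "\<exists>v. good j v" if j: "j < d" for j
  proof (cases "\<exists>l<r. j = c l")
    case True
    then obtain l where l: "l < r" "j = c l" by blast
    have "(\<Sum>l'<r. unitv l l' * A $$ (i, c l')) = A $$ (i, j)" for i
      using l by (simp add: unitv_def if_distrib if_distribR cong: if_cong)
    then have "good j (unitv l)" using l cinj by (auto simp: good_def)
    then show ?thesis by blast
  next
    case False
    have "col A j \<in> set (cols A)" using j A by (auto simp: cols_def)
    then have "col A j \<in> span S" by (rule span)
    then obtain a where a: "lincomb a S = col A j"
      using finite_in_span[OF S(1) Sc] by auto
    have "A $$ (i, j) = (\<Sum>l<r. a (h l) * A $$ (i, c l))" if i: "i < n" for i
    proof -
      have "A $$ (i, j) = col A j $ i" using A i j by simp
      also have "\<dots> = (\<Sum>x\<in>S. a x * x $ i)" unfolding a[symmetric] by (rule lincomb_index[OF i Sc])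
      also have "\<dots> = (\<Sum>l<r. a (h l) * h l $ i)"
        by (rule sum.reindex_bij_betw[OF h, symmetric])
      also have "\<dots> = (\<Sum>l<r. a (h l) * A $$ (i, c l))"
        using A i c by (intro sum.cong) auto
      finally show ?thesis .
    qed
    then have "good j (\<lambda>l. a (h l))" using False by (auto simp: good_def)
    then show ?thesis by blast
  qed
  then have "\<forall>j\<in>{..<d}. \<exists>v. good j v" by blast
  then obtain V where V: "\<And>j. j < d \<Longrightarrow> good j (V j)" by (auto dest!: bchoice)
  have "\<forall>l<r. V (c l) = unitv l" using V c(1) unfolding good_def by blast
  moreover have "\<forall>i<n. \<forall>j<d. A $$ (i, j) = (\<Sum>l<r. V j l * A $$ (i, c l))"
    using V unfolding good_def by blast
  moreover have "r \<le> k" using card by (simp add: r_def)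
  ultimately show ?thesis using c(1) by blast
qed

text \<open>The spanner is taken among the coordinate vectors of the columns of \<open>A'\<close>,
  with the error \<open>w j\<close> of column \<open>j\<close> as weight. It expresses column
  \<open>j\<close> of \<open>A'\<close> with coefficients satisfying
  \<open>w (f l) * |Z l j| \<le> w j\<close>. Replacing the columns of \<open>A'\<close> by those of
  \<open>A\<close> in this expression therefore costs at most \<open>w j\<close> for each of the
  \<open>r\<close> terms, in addition to the error \<open>w j\<close> of column \<open>j\<close>
  itself.\<close>

lemma column_subset_approx:
  fixes A A' :: "real mat"
  assumes A: "A \<in> carrier_mat n d" and A': "A' \<in> carrier_mat n d"
    and rk: "vec_space.rank n A' \<le> k" and d: "d \<ge> 1"
  shows "\<exists>J Z. (\<forall>l<k. J l < d) \<and>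
    (\<Sum>j<d. \<Sum>i<n. \<bar>A $$ (i, j) - (\<Sum>l<k. A $$ (i, J l) * Z l j)\<bar>) \<le> real (k + 1) * l1_norm (A - A')"
proof -
  obtain r c V where r: "r \<le> k" "\<forall>l<r. c l < d" "\<forall>l<r. V (c l) = unitv l"
    "\<forall>i<n. \<forall>j<d. A' $$ (i, j) = (\<Sum>l<r. V j l * A' $$ (i, c l))"
    using rank_column_coordinates[OF A' rk] by blast
  define w where "w j = (\<Sum>i<n. \<bar>A $$ (i, j) - A' $$ (i, j)\<bar>)" for j
  have w0: "w j \<ge> 0" for j by (simp add: w_def sum_nonneg)
  have l1: "l1_norm (A - A') = (\<Sum>j<d. w j)"
    using A A' unfolding l1_norm_def w_def by (subst sum.swap) (auto intro!: sum.cong)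
  have "dt r (\<lambda>l. V (c l)) = dt r unitv" using r(3) by (intro dt_cong) auto
  then have "dt r (\<lambda>l. V (c l)) \<noteq> 0" by (simp add: dt_unitv)
  from barycentric_spanner[where y = V and N = d and w = w, OF _ this] r(2) w0
  obtain f where f: "\<forall>l<r. f l < d" "dt r (\<lambda>l. V (f l)) \<noteq> 0"
    "\<forall>l<r. \<forall>j<d. w (f l) * \<bar>dotp r (cof r (\<lambda>l. V (f l)) l) (V j)\<bar> \<le> w j * \<bar>dt r (\<lambda>l. V (f l))\<bar>"
    by auto
  \<comment> \<open>Cramer coefficients, padded by 0 from \<open>r\<close> to \<open>k\<close>. The
    padding refers to column 0, which exists because \<open>d \<ge> 1\<close>.\<close>
  define Z where "Z l j = (if l < r then dotp r (cof r (\<lambda>l. V (f l)) l) (V j) / dt r (\<lambda>l. V (f l)) else 0)" for l j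
  define J where "J l = (if l < r then f l else 0)" for l
  have J: "\<forall>l<k. J l < d" using f(1) d by (simp add: J_def)
  have ext: "(\<Sum>l<k. g l * Z l j) = (\<Sum>l<r. g l * Z l j)" for g j
    using r(1) by (intro sum.mono_neutral_right) (auto simp: Z_def)
  have Zw: "w (f l) * \<bar>Z l j\<bar> \<le> w j" if "l < r" "j < d" for l j
  proof -
    have "w (f l) * \<bar>dotp r (cof r (\<lambda>l. V (f l)) l) (V j)\<bar> \<le> w j * \<bar>dt r (\<lambda>l. V (f l))\<bar>" using f(3) that by blast
    then show ?thesis using f(2) that by (simp add: Z_def abs_divide field_simps)
  qed
  have comb: "A' $$ (i, j) = (\<Sum>l<r. A' $$ (i, f l) * Z l j)" if i: "i < n" and j: "j < d" for i j
  proof -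
    have "A' $$ (i, j) = (\<Sum>m<r. V j m * A' $$ (i, c m))" using r(4) i j by blast
    also have "\<dots> = (\<Sum>m<r. (\<Sum>l<r. Z l j * V (f l) m) * A' $$ (i, c m))"
    proof (rule sum.cong[OF refl])
      fix m assume "m \<in> {..<r}"
      then have "V j m = (\<Sum>l<r. Z l j * V (f l) m)"
        using cramer_rows[OF f(2), of m "V j"] by (simp add: Z_def)
      then show "V j m * A' $$ (i, c m) = (\<Sum>l<r. Z l j * V (f l) m) * A' $$ (i, c m)" by simp
    qed
    also have "\<dots> = (\<Sum>l<r. (\<Sum>m<r. V (f l) m * A' $$ (i, c m)) * Z l j)"
      unfolding sum_distrib_right by (subst sum.swap) (simp add: mult_ac)
    also have "\<dots> = (\<Sum>l<r. A' $$ (i, f l) * Z l j)"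
      using r(4) i f(1) by (intro sum.cong) auto
    finally show ?thesis .
  qed
  have "(\<Sum>i<n. \<bar>A $$ (i, j) - (\<Sum>l<k. A $$ (i, J l) * Z l j)\<bar>) \<le> real (k + 1) * w j" if j: "j < d" for j
  proof -
    have "(\<Sum>i<n. \<bar>A $$ (i, j) - (\<Sum>l<k. A $$ (i, J l) * Z l j)\<bar>) \<le>
      (\<Sum>i<n. \<bar>A $$ (i, j) - A' $$ (i, j)\<bar> + (\<Sum>l<r. \<bar>A $$ (i, f l) - A' $$ (i, f l)\<bar> * \<bar>Z l j\<bar>))"
    proof (rule sum_mono)
      fix i assume "i \<in> {..<n}"
      then have i: "i < n" by simp
      have "A $$ (i, j) - (\<Sum>l<k. A $$ (i, J l) * Z l j) =
        (A $$ (i, j) - A' $$ (i, j)) - (\<Sum>l<r. (A $$ (i, f l) - A' $$ (i, f l)) * Z l j)"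
        unfolding ext using comb[OF i j] by (simp add: J_def left_diff_distrib sum_subtractf)
      then have "\<bar>A $$ (i, j) - (\<Sum>l<k. A $$ (i, J l) * Z l j)\<bar> \<le>
        \<bar>A $$ (i, j) - A' $$ (i, j)\<bar> + \<bar>\<Sum>l<r. (A $$ (i, f l) - A' $$ (i, f l)) * Z l j\<bar>" by simp
      also have "\<dots> \<le> \<bar>A $$ (i, j) - A' $$ (i, j)\<bar> + (\<Sum>l<r. \<bar>A $$ (i, f l) - A' $$ (i, f l)\<bar> * \<bar>Z l j\<bar>)"
        using sum_abs[of "\<lambda>l. (A $$ (i, f l) - A' $$ (i, f l)) * Z l j" "{..<r}"] by (simp add: abs_mult)
      finally show "\<bar>A $$ (i, j) - (\<Sum>l<k. A $$ (i, J l) * Z l j)\<bar> \<le>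
        \<bar>A $$ (i, j) - A' $$ (i, j)\<bar> + (\<Sum>l<r. \<bar>A $$ (i, f l) - A' $$ (i, f l)\<bar> * \<bar>Z l j\<bar>)" .
    qed
    also have "\<dots> = w j + (\<Sum>l<r. w (f l) * \<bar>Z l j\<bar>)"
      unfolding sum.distrib w_def sum_distrib_right by (subst sum.swap) simp
    also have "\<dots> \<le> w j + (\<Sum>l<r. w j)" using Zw j by (intro add_left_mono sum_mono) auto
    also have "\<dots> = real (r + 1) * w j" by (simp add: algebra_simps)
    also have "\<dots> \<le> real (k + 1) * w j" using r(1) w0 by (intro mult_right_mono) auto
    finally show ?thesis .
  qed
  then have "(\<Sum>j<d. \<Sum>i<n. \<bar>A $$ (i, j) - (\<Sum>l<k. A $$ (i, J l) * Z l j)\<bar>) \<le> (\<Sum>j<d. real (k + 1) * w j)"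
    by (intro sum_mono) auto
  then show ?thesis using J unfolding l1 sum_distrib_left[symmetric] by blast
qed

lemma rank_factored:
  fixes B :: "real mat"
  assumes B: "B \<in> carrier_mat n d"
    and "\<And>i j. i < n \<Longrightarrow> j < d \<Longrightarrow> B $$ (i, j) = (\<Sum>l<k. f i l * g l j)"
  shows "vec_space.rank n B \<le> k"
  using assms
proof (induction k arbitrary: B)
  case 0
  then have "B = 0\<^sub>m n d" by (intro eq_matI) auto
  then show ?case by (simp add: vec_space.rank_0I)
next
  case (Suc k)
  define B1 where "B1 = mat n d (\<lambda>(i, j). \<Sum>l<k. f i l * g l j)"
  define B2 where "B2 = mat n d (\<lambda>(i, j). f i k * g k j)"
  have "B = B1 + B2"
    using Suc.prems by (intro eq_matI) (auto simp: B1_def B2_def)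
  moreover have "vec_space.rank n B1 \<le> k" by (rule Suc.IH) (auto simp: B1_def)
  moreover have "vec_space.rank n B2 \<le> 1"
    by (rule vec_space.rank_le_1_product_entries[of _ _ d "\<lambda>i. f i k" "\<lambda>j. g k j"]) (auto simp: B2_def)
  moreover have "vec_space.rank n (B1 + B2) \<le> vec_space.rank n B1 + vec_space.rank n B2"
    by (rule vec_space.rank_subadditive[of _ _ d]) (auto simp: B1_def B2_def)
  ultimately show ?case by simp
qed

section \<open>Compiling sums and bounded searches\<close>

text \<open>A search also binds the index it finds for use in its last argument. It thereby takes
  the place of a let: quotients, digits and selected tuples are named in this way.\<close>

datatype rexp =
    RNat nexp
  | RIn nexp nexp
  | ROp arith_op rexp rexp
  | RLess rexp rexp
  | RSum nexp rexp
  | RFind nexp rexp rexp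

definition nv :: "real list list \<Rightarrow> (nat \<Rightarrow> nat) \<Rightarrow> nexp \<Rightarrow> nat" where
  "nv inp \<rho> e = neval inp e \<lparr>regs = \<rho>, cells = (\<lambda>_. 0), emitted = []\<rparr>"

lemma neval_nv: "neval inp e s = nv inp (regs s) e"
  unfolding nv_def by (induction e) auto

lemma nv_simps [simp]:
  "nv inp \<rho> (Num m) = m"
  "nv inp \<rho> (Reg r) = \<rho> r"
  "nv inp \<rho> (NPlus a b) = nv inp \<rho> a + nv inp \<rho> b"
  "nv inp \<rho> (NMinus a b) = nv inp \<rho> a - nv inp \<rho> b"
  "nv inp \<rho> (NTimes a b) = nv inp \<rho> a * nv inp \<rho> b"
  "nv inp \<rho> InCount = length inp"
  "nv inp \<rho> (InLength a) = (if nv inp \<rho> a < length inp then length (inp ! nv inp \<rho> a) else 0)"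
  by (simp_all add: nv_def)

fun wfn :: "nat \<Rightarrow> nexp \<Rightarrow> bool" where
  "wfn l (Num m) = True"
| "wfn l (Reg r) = (r < l)"
| "wfn l (NPlus a b) = (wfn l a \<and> wfn l b)"
| "wfn l (NMinus a b) = (wfn l a \<and> wfn l b)"
| "wfn l (NTimes a b) = (wfn l a \<and> wfn l b)"
| "wfn l InCount = True"
| "wfn l (InLength a) = wfn l a"

fun wfr :: "nat \<Rightarrow> rexp \<Rightarrow> bool" where
  "wfr l (RNat e) = wfn l e"
| "wfr l (RIn a i) = (wfn l a \<and> wfn l i)"
| "wfr l (ROp f a b) = (wfr l a \<and> wfr l b)"
| "wfr l (RLess a b) = (wfr l a \<and> wfr l b)"
| "wfr l (RSum b e) = (wfn l b \<and> wfr (Suc l) e)"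
| "wfr l (RFind b c e) = (wfn l b \<and> wfr (Suc l) c \<and> wfr (Suc l) e)"

text \<open>Total lookup: the machine would be stuck outside its input, so compiled lookups test the
  range and return 0 beyond it.\<close>

definition rin :: "real list list \<Rightarrow> nat \<Rightarrow> nat \<Rightarrow> real" where
  "rin inp a i = (if a < length inp \<and> i < length (inp ! a) then inp ! a ! i else 0)"

text \<open>Binders are named by their depth: the binder at depth \<open>l\<close> owns index register \<open>l\<close>.\<close>

fun rv :: "real list list \<Rightarrow> nat \<Rightarrow> (nat \<Rightarrow> nat) \<Rightarrow> rexp \<Rightarrow> real" where
  "rv inp l \<rho> (RNat e) = real (nv inp \<rho> e)"
| "rv inp l \<rho> (RIn a i) = rin inp (nv inp \<rho> a) (nv inp \<rho> i)"
| "rv inp l \<rho> (ROp f a b) = arith f (rv inp l \<rho> a) (rv inp l \<rho> b)"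
| "rv inp l \<rho> (RLess a b) = of_bool (rv inp l \<rho> a < rv inp l \<rho> b)"
| "rv inp l \<rho> (RSum b e) = (\<Sum>i<nv inp \<rho> b. rv inp (Suc l) (\<rho>(l := i)) e)"
| "rv inp l \<rho> (RFind b c e) =
     rv inp (Suc l) (\<rho>(l := sel (nv inp \<rho> b) (\<lambda>i. rv inp (Suc l) (\<rho>(l := i)) c > 0))) e"

text \<open>The condition is evaluated once before the loop and after every increment, so also at
  the bound itself; this is harmless because evaluation is total.\<close>

definition find_prog :: "nat \<Rightarrow> nat \<Rightarrow> nexp \<Rightarrow> prog \<Rightarrow> prog" where
  "find_prog l a b c =
     Seq (SetReg l (Num 0)) (Seq c (Seq (LoadNat (Num (a + 1)) (Num 0))
       (While (BAnd (NLess (Reg l) b) (BNot (CellLess (Num (a + 1)) (Num a))))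
          (Seq (SetReg l (NPlus (Reg l) (Num 1))) (Seq c (LoadNat (Num (a + 1)) (Num 0)))))))"

text \<open>Code for an expression at depth \<open>l\<close> and cell \<open>a\<close> leaves its
  value in cell \<open>a\<close> and may overwrite only cells from \<open>a\<close> and registers
  from \<open>l\<close> onwards. Division tests for a zero divisor, by two strict comparisons, since
  the machine would be stuck where HOL has the value 0.\<close>

fun compile :: "nat \<Rightarrow> nat \<Rightarrow> rexp \<Rightarrow> prog" where
  "compile l a (RNat e) = LoadNat (Num a) e"
| "compile l a (RIn x i) = If (BAnd (NLess x InCount) (NLess i (InLength x)))
     (LoadInput (Num a) x i) (LoadNat (Num a) (Num 0))"
| "compile l a (ROp f x y) = Seq (compile l a x) (Seq (compile l (a + 1) y)
     (if f = Div then Seq (LoadNat (Num (a + 2)) (Num 0))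
        (If (BAnd (BNot (CellLess (Num (a + 1)) (Num (a + 2)))) (BNot (CellLess (Num (a + 2)) (Num (a + 1)))))
           (LoadNat (Num a) (Num 0)) (Arith Div (Num a) (Num a) (Num (a + 1))))
      else Arith f (Num a) (Num a) (Num (a + 1))))"
| "compile l a (RLess x y) = Seq (compile l a x) (Seq (compile l (a + 1) y)
     (If (CellLess (Num a) (Num (a + 1))) (LoadNat (Num a) (Num 1)) (LoadNat (Num a) (Num 0))))"
| "compile l a (RSum b e) = Seq (LoadNat (Num a) (Num 0)) (Seq (SetReg l (Num 0))
     (While (NLess (Reg l) b) (Seq (compile (Suc l) (a + 1) e)
        (Seq (Arith Add (Num a) (Num a) (Num (a + 1))) (SetReg l (NPlus (Reg l) (Num 1)))))))"
| "compile l a (RFind b c e) = Seq (find_prog l a b (compile (Suc l) a c)) (compile (Suc l) a e)"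

section \<open>Total correctness with a time budget\<close>

definition runs ::
  "nat \<Rightarrow> nat \<Rightarrow> real list list \<Rightarrow> prog \<Rightarrow> config \<Rightarrow> nat \<Rightarrow> (config \<Rightarrow> bool) \<Rightarrow> bool" where
  "runs S W inp c s T Q \<longleftrightarrow> (\<exists>t s'. t \<le> T \<and> exec S W inp c s t s' \<and> Q s')"

lemma runs_mono:
  assumes "runs S W inp c s T Q" and "T \<le> T'" and "\<And>s'. Q s' \<Longrightarrow> Q' s'"
  shows "runs S W inp c s T' Q'"
  using assms unfolding runs_def by (meson order_trans)

lemma runs_SetReg:
  "1 \<le> T \<Longrightarrow> nv inp (regs s) e \<le> W \<Longrightarrow> Q (s\<lparr>regs := (regs s)(r := nv inp (regs s) e)\<rparr>) \<Longrightarrow>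
   runs S W inp (SetReg r e) s T Q"
  unfolding runs_def using exec.SetReg[of inp e s W S r] by (force simp: neval_nv)

lemma runs_LoadNat:
  "1 \<le> T \<Longrightarrow> a < S \<Longrightarrow> Q (s\<lparr>cells := (cells s)(a := real (nv inp (regs s) e))\<rparr>) \<Longrightarrow>
   runs S W inp (LoadNat (Num a) e) s T Q"
  unfolding runs_def using exec.LoadNat[of inp "Num a" s S W e] by (force simp: neval_nv)

lemma runs_LoadInput:
  "1 \<le> T \<Longrightarrow> a < S \<Longrightarrow> nv inp (regs s) x < length inp \<Longrightarrow> nv inp (regs s) i < length (inp ! nv inp (regs s) x) \<Longrightarrow>
   Q (s\<lparr>cells := (cells s)(a := rin inp (nv inp (regs s) x) (nv inp (regs s) i))\<rparr>) \<Longrightarrow>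
   runs S W inp (LoadInput (Num a) x i) s T Q"
  unfolding runs_def using exec.LoadInput[of inp "Num a" s S x i W] by (force simp: neval_nv rin_def)

lemma runs_Arith:
  "1 \<le> T \<Longrightarrow> a < S \<Longrightarrow> (f = Div \<Longrightarrow> cells s y \<noteq> 0) \<Longrightarrow>
   Q (s\<lparr>cells := (cells s)(a := arith f (cells s x) (cells s y))\<rparr>) \<Longrightarrow>
   runs S W inp (Arith f (Num a) (Num x) (Num y)) s T Q"
  unfolding runs_def using exec.Arith[of inp "Num a" s S f "Num y" W "Num x"] by force

lemma runs_Emit: "1 \<le> T \<Longrightarrow> Q (s\<lparr>emitted := emitted s @ [cells s a]\<rparr>) \<Longrightarrow> runs S W inp (Emit (Num a)) s T Q"
  unfolding runs_def using exec.Emit[of S W inp "Num a" s] by force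

lemma runs_Seq:
  assumes "runs S W inp c1 s T1 (\<lambda>s1. runs S W inp c2 s1 T2 Q)"
  shows "runs S W inp (Seq c1 c2) s (T1 + T2) Q"
  using assms unfolding runs_def by (meson add_mono exec.Seq)

lemma runs_If:
  assumes "beval inp b s \<Longrightarrow> runs S W inp c1 s T Q" and "\<not> beval inp b s \<Longrightarrow> runs S W inp c2 s T Q"
  shows "runs S W inp (If b c1 c2) s (T + 1) Q"
proof (cases "beval inp b s")
  case True
  then obtain t s' where "t \<le> T" "exec S W inp c1 s t s'" "Q s'" using assms(1) by (auto simp: runs_def)
  then show ?thesis using exec.IfTrue[OF True, of S W c1 t s' c2] unfolding runs_def
    by (intro exI[of _ "Suc t"] exI[of _ s']) auto
next
  case False
  then obtain t s' where "t \<le> T" "exec S W inp c2 s t s'" "Q s'" using assms(2) by (auto simp: runs_def)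
  then show ?thesis using exec.IfFalse[OF False, of S W c2 t s' c1] unfolding runs_def
    by (intro exI[of _ "Suc t"] exI[of _ s']) auto
qed

lemma runs_While:
  assumes step: "\<And>i s. i < n \<Longrightarrow> I i s \<Longrightarrow> beval inp b s \<and> runs S W inp c s T (I (Suc i))"
    and stop: "\<And>s. I n s \<Longrightarrow> \<not> beval inp b s"
    and init: "I 0 s"
  shows "runs S W inp (While b c) s (n * (T + 1) + 1) (I n)"
proof -
  have "runs S W inp (While b c) s ((n - i) * (T + 1) + 1) (I n)" if "i \<le> n" "I i s" for i s
    using that
  proof (induction "n - i" arbitrary: i s)
    case 0
    then have "i = n" by simp
    then have "\<not> beval inp b s" using 0 stop by simp
    then show ?case using exec.WhileFalse[of inp b s S W c] 0 \<open>i = n\<close> unfolding runs_def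
      by (intro exI[of _ 1] exI[of _ s]) auto
  next
    case (Suc m)
    then have i: "i < n" by simp
    obtain t1 s1 where 1: "t1 \<le> T" "exec S W inp c s t1 s1" "I (Suc i) s1"
      using step[OF i Suc.prems(2)] by (auto simp: runs_def)
    have "runs S W inp (While b c) s1 ((n - Suc i) * (T + 1) + 1) (I n)"
      using Suc.hyps(1)[of "Suc i" s1] Suc.hyps(2) i 1(3) by simp
    then obtain t2 s2 where 2: "t2 \<le> (n - Suc i) * (T + 1) + 1" "exec S W inp (While b c) s1 t2 s2" "I n s2"
      by (auto simp: runs_def)
    have "exec S W inp (While b c) s (Suc (t1 + t2)) s2"
      using exec.WhileTrue[OF conjunct1[OF step[OF i Suc.prems(2)]] 1(2) 2(2)] .
    moreover have "Suc (t1 + t2) \<le> (n - i) * (T + 1) + 1"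
    proof -
      have "n - i = Suc (n - Suc i)" using i by simp
      then show ?thesis using 1(1) 2(1) by simp
    qed
    ultimately show ?case using 2(3) unfolding runs_def by blast
  qed
  from this[of 0 s] init show ?thesis by simp
qed

section \<open>Polynomial bounds as powers of one base\<close>

definition inp_le :: "nat \<Rightarrow> real list list \<Rightarrow> bool" where
  "inp_le N inp \<longleftrightarrow> length inp \<le> N \<and> (\<forall>x\<in>set inp. length x \<le> N)"

lemma inp_le_mono: "inp_le N inp \<Longrightarrow> N \<le> M \<Longrightarrow> inp_le M inp"
  by (force simp: inp_le_def)

text \<open>All resources are bounded by single powers \<open>N ^ K\<close> with
  \<open>N \<ge> 2\<close>. Sums and products then merely change the exponent, which depends on the
  program alone.\<close>

lemma pow_add_le:
  fixes N :: nat
  assumes "2 \<le> N" and "x \<le> N ^ a" and "y \<le> N ^ b"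
  shows "x + y \<le> N ^ (a + b + 1)"
proof -
  have "x + y \<le> N ^ (a + b) + N ^ (a + b)"
    using assms by (intro add_mono order_trans[OF assms(2) power_increasing] order_trans[OF assms(3) power_increasing]) auto
  also have "\<dots> \<le> N * N ^ (a + b)" using assms(1) by (simp flip: mult_2)
  finally show ?thesis by simp
qed

lemma pow_mult_le: "(x :: nat) \<le> N ^ a \<Longrightarrow> y \<le> N ^ b \<Longrightarrow> x * y \<le> N ^ (a + b)"
  unfolding power_add by (rule mult_mono) auto

lemma pow_const_le: "2 \<le> N \<Longrightarrow> m \<le> (N :: nat) ^ m"
  by (meson less_exp less_imp_le order_trans power_mono zero_le_numeral)

lemma nv_poly: "\<exists>K. \<forall>inp \<rho> N l. wfn l e \<longrightarrow> 2 \<le> N \<longrightarrow> inp_le N inp \<longrightarrow> (\<forall>j<l. \<rho> j \<le> N) \<longrightarrow> nv inp \<rho> e \<le> N ^ K"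
proof (induction e)
  case (Num m)
  show ?case by (intro exI[of _ m]) (simp add: pow_const_le)
next
  case (Reg r)
  show ?case by (intro exI[of _ 1]) simp
next
  case (NPlus a b)
  then obtain K1 K2 where
    "\<forall>inp \<rho> N l. wfn l a \<longrightarrow> 2 \<le> N \<longrightarrow> inp_le N inp \<longrightarrow> (\<forall>j<l. \<rho> j \<le> N) \<longrightarrow> nv inp \<rho> a \<le> N ^ K1"
    "\<forall>inp \<rho> N l. wfn l b \<longrightarrow> 2 \<le> N \<longrightarrow> inp_le N inp \<longrightarrow> (\<forall>j<l. \<rho> j \<le> N) \<longrightarrow> nv inp \<rho> b \<le> N ^ K2" by blast
  then show ?case
    by (intro exI[of _ "K1 + K2 + 1"] allI impI, simp only: nv_simps, intro pow_add_le) auto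
next
  case (NMinus a b)
  then obtain K where
    "\<forall>inp \<rho> N l. wfn l a \<longrightarrow> 2 \<le> N \<longrightarrow> inp_le N inp \<longrightarrow> (\<forall>j<l. \<rho> j \<le> N) \<longrightarrow> nv inp \<rho> a \<le> N ^ K" by blast
  then show ?case by (intro exI[of _ K]) (auto intro: order_trans[OF diff_le_self])
next
  case (NTimes a b)
  then obtain K1 K2 where
    "\<forall>inp \<rho> N l. wfn l a \<longrightarrow> 2 \<le> N \<longrightarrow> inp_le N inp \<longrightarrow> (\<forall>j<l. \<rho> j \<le> N) \<longrightarrow> nv inp \<rho> a \<le> N ^ K1"
    "\<forall>inp \<rho> N l. wfn l b \<longrightarrow> 2 \<le> N \<longrightarrow> inp_le N inp \<longrightarrow> (\<forall>j<l. \<rho> j \<le> N) \<longrightarrow> nv inp \<rho> b \<le> N ^ K2" by blast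
  then show ?case
    by (intro exI[of _ "K1 + K2"] allI impI, simp only: nv_simps, intro pow_mult_le) auto
next
  case InCount
  show ?case by (intro exI[of _ 1]) (simp add: inp_le_def)
next
  case (InLength a)
  show ?case by (intro exI[of _ 1]) (simp add: inp_le_def)
qed

lemma nv_agree: "wfn l e \<Longrightarrow> (\<And>j. j < l \<Longrightarrow> \<rho> j = \<rho>' j) \<Longrightarrow> nv inp \<rho> e = nv inp \<rho>' e"
  by (induction e) auto

lemma wfn_mono: "wfn l e \<Longrightarrow> l \<le> l' \<Longrightarrow> wfn l' e"
  by (induction e) auto

lemma rv_agree: "wfr l e \<Longrightarrow> (\<And>j. j < l \<Longrightarrow> \<rho> j = \<rho>' j) \<Longrightarrow> rv inp l \<rho> e = rv inp l \<rho>' e"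
proof (induction e arbitrary: l \<rho> \<rho>')
  case (RSum b e)
  have "nv inp \<rho> b = nv inp \<rho>' b" using RSum.prems by (intro nv_agree) auto
  moreover have "rv inp (Suc l) (\<rho>(l := i)) e = rv inp (Suc l) (\<rho>'(l := i)) e" for i
    using RSum.prems by (intro RSum.IH) auto
  ultimately show ?case by simp
next
  case (RFind b c e)
  have "nv inp \<rho> b = nv inp \<rho>' b" using RFind.prems by (intro nv_agree) auto
  moreover have "rv inp (Suc l) (\<rho>(l := i)) c = rv inp (Suc l) (\<rho>'(l := i)) c" for i
    using RFind.prems by (intro RFind.IH(1)) auto
  moreover have "rv inp (Suc l) (\<rho>(l := i)) e = rv inp (Suc l) (\<rho>'(l := i)) e" for i
    using RFind.prems by (intro RFind.IH(2)) auto
  ultimately show ?case by simp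
next
  case (RNat e)
  then show ?case using nv_agree[of l e \<rho> \<rho>' inp] by simp
next
  case (RIn a i)
  then show ?case using nv_agree[of l a \<rho> \<rho>' inp] nv_agree[of l i \<rho> \<rho>' inp] by simp
next
  case (ROp f a b)
  have "rv inp l \<rho> a = rv inp l \<rho>' a" "rv inp l \<rho> b = rv inp l \<rho>' b"
    using ROp.prems by (auto intro!: ROp.IH)
  then show ?case by simp
next
  case (RLess a b)
  have "rv inp l \<rho> a = rv inp l \<rho>' a" "rv inp l \<rho> b = rv inp l \<rho>' b"
    using RLess.prems by (auto intro!: RLess.IH)
  then show ?case by simp
qed

section \<open>Correctness and cost of compiled expressions\<close>

definition leaves :: "nat \<Rightarrow> nat \<Rightarrow> config \<Rightarrow> real \<Rightarrow> config \<Rightarrow> bool" where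
  "leaves l a s v s' \<longleftrightarrow> cells s' a = v \<and> (\<forall>b<a. cells s' b = cells s b) \<and>
     (\<forall>j<l. regs s' j = regs s j) \<and> emitted s' = emitted s"

text \<open>One constant \<open>K\<close> per expression bounds the number of cells and is the
  exponent for time and register contents: memory is constant and time polynomial in the
  sizes.\<close>

definition evaluates :: "nat \<Rightarrow> rexp \<Rightarrow> bool" where
  "evaluates K e \<longleftrightarrow> (\<forall>S W inp l a s N. wfr l e \<longrightarrow> 2 \<le> N \<longrightarrow> inp_le N inp \<longrightarrow>
     (\<forall>j<l. regs s j \<le> N) \<longrightarrow> a + K \<le> S \<longrightarrow> N ^ K \<le> W \<longrightarrow>
     runs S W inp (compile l a e) s (N ^ K) (leaves l a s (rv inp l (regs s) e)))"

lemma evaluatesD: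
  assumes "evaluates K e" "wfr l e" "2 \<le> N" "inp_le N inp" "\<And>j. j < l \<Longrightarrow> regs s j \<le> N"
    "a + K \<le> S" "N ^ K \<le> W" "N ^ K \<le> T" "v = rv inp l (regs s) e"
  shows "runs S W inp (compile l a e) s T (leaves l a s v)"
proof -
  have "\<forall>j<l. regs s j \<le> N" using assms(5) by blast
  then have 1: "runs S W inp (compile l a e) s (N ^ K) (leaves l a s v)"
    using assms(1)[unfolded evaluates_def, THEN spec[of _ S], THEN spec[of _ W], THEN spec[of _ inp],
        THEN spec[of _ l], THEN spec[of _ a], THEN spec[of _ s], THEN spec[of _ N]] assms(2-4,6,7)
    unfolding assms(9) by blast
  show ?thesis by (rule runs_mono[OF 1 assms(8)])
qed

lemma find_prog_runs:
  assumes c: "evaluates Kc c" "wfr (Suc l) c" and b: "wfn l b"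
    and N: "2 \<le> N" "inp_le N inp" "\<And>j. j < l \<Longrightarrow> regs s j \<le> N" "nv inp (regs s) b \<le> N"
    and S: "a + Kc + 2 \<le> S" and W: "N ^ Kc \<le> W" "N \<le> W"
  shows "runs S W inp (find_prog l a b (compile (Suc l) a c)) s (1 + (N ^ Kc + (1 + (N * (N ^ Kc + 3) + 1))))
    (\<lambda>s'. regs s' l = sel (nv inp (regs s) b) (\<lambda>i. rv inp (Suc l) ((regs s)(l := i)) c > 0) \<and>
       (\<forall>x<a. cells s' x = cells s x) \<and> (\<forall>j<l. regs s' j = regs s j) \<and> emitted s' = emitted s)"
proof -
  define B where "B = nv inp (regs s) b"
  define p where "p i \<longleftrightarrow> rv inp (Suc l) ((regs s)(l := i)) c > 0" for i
  define n where "n = sel B p"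
  have n: "n \<le> B" "n = B \<or> p n" unfolding n_def sel_def
    by (rule Least_le, simp) (rule LeastI[of _ B], simp)
  have notp: "i \<noteq> B \<and> \<not> p i" if "i < n" for i
    using not_less_Least[of i "\<lambda>i. i = B \<or> p i"] that unfolding n_def sel_def by simp
  \<comment> \<open>The loop test sees the condition only through cell \<open>a\<close>, so the
    invariant records that it has already been evaluated at the current index and that the next cell
    holds the 0 it is compared with.\<close>
  define I where "I i s' \<longleftrightarrow> regs s' l = i \<and> cells s' a = rv inp (Suc l) ((regs s)(l := i)) c \<and>
    cells s' (a + 1) = 0 \<and>
    (\<forall>x<a. cells s' x = cells s x) \<and> (\<forall>j<l. regs s' j = regs s j) \<and> emitted s' = emitted s" for i and s' :: config
  have eval: "runs S W inp (Seq (compile (Suc l) a c) (LoadNat (Num (a + 1)) (Num 0))) s1 (N ^ Kc + 1) (I i)"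
    if s1: "regs s1 l = i" "i \<le> N" "\<forall>x<a. cells s1 x = cells s x" "\<forall>j<l. regs s1 j = regs s j"
      "emitted s1 = emitted s" for s1 i
  proof (rule runs_Seq)
    have val: "rv inp (Suc l) ((regs s)(l := i)) c = rv inp (Suc l) (regs s1) c"
      using s1 by (intro rv_agree[OF c(2)]) (auto simp: less_Suc_eq)
    have "runs S W inp (compile (Suc l) a c) s1 (N ^ Kc)
        (leaves (Suc l) a s1 (rv inp (Suc l) ((regs s)(l := i)) c))"
      using s1 N S W by (intro evaluatesD[OF c N(1)] val) (auto simp: less_Suc_eq)
    then show "runs S W inp (compile (Suc l) a c) s1 (N ^ Kc)
        (\<lambda>s1. runs S W inp (LoadNat (Num (a + 1)) (Num 0)) s1 1 (I i))"
      by (rule runs_mono) (use s1 S in \<open>auto simp: leaves_def I_def intro!: runs_LoadNat\<close>)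
  qed
  have W0: "0 \<le> W" by simp
  have loop: "runs S W inp (While (BAnd (NLess (Reg l) b) (BNot (CellLess (Num (a + 1)) (Num a))))
          (Seq (SetReg l (NPlus (Reg l) (Num 1))) (Seq (compile (Suc l) a c) (LoadNat (Num (a + 1)) (Num 0)))))
          s1 (n * ((1 + (N ^ Kc + 1)) + 1) + 1) (I n)" if "I 0 s1" for s1
  proof (rule runs_While[where I = I, OF _ _ that])
    fix i s1 assume i: "i < n" and I: "I i s1"
    have bb: "nv inp (regs s1) b = B"
      unfolding B_def using I by (intro nv_agree[OF b]) (auto simp: I_def)
    have "i < B" using i n(1) by simp
    moreover have "\<not> cells s1 (a + 1) < cells s1 a" using notp[OF i] I by (simp add: I_def p_def)
    moreover have "runs S W inp (Seq (SetReg l (NPlus (Reg l) (Num 1)))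
        (Seq (compile (Suc l) a c) (LoadNat (Num (a + 1)) (Num 0)))) s1 (1 + (N ^ Kc + 1)) (I (Suc i))"
    proof (rule runs_Seq, rule runs_SetReg[OF order_refl])
      show "nv inp (regs s1) (NPlus (Reg l) (Num 1)) \<le> W"
        using I \<open>i < B\<close> N(4) W(2) by (simp add: I_def B_def)
      show "runs S W inp (Seq (compile (Suc l) a c) (LoadNat (Num (a + 1)) (Num 0)))
          (s1\<lparr>regs := (regs s1)(l := nv inp (regs s1) (NPlus (Reg l) (Num 1)))\<rparr>) (N ^ Kc + 1) (I (Suc i))"
        by (rule eval) (use I \<open>i < B\<close> N(4) in \<open>auto simp: I_def B_def\<close>)
    qed
    ultimately show "beval inp (BAnd (NLess (Reg l) b) (BNot (CellLess (Num (a + 1)) (Num a)))) s1 \<and>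
      runs S W inp (Seq (SetReg l (NPlus (Reg l) (Num 1)))
        (Seq (compile (Suc l) a c) (LoadNat (Num (a + 1)) (Num 0)))) s1 (1 + (N ^ Kc + 1)) (I (Suc i))"
      using I bb by (simp add: neval_nv I_def)
  next
    fix s1 assume I: "I n s1"
    have "nv inp (regs s1) b = B"
      unfolding B_def using I by (intro nv_agree[OF b]) (auto simp: I_def)
    then show "\<not> beval inp (BAnd (NLess (Reg l) b) (BNot (CellLess (Num (a + 1)) (Num a)))) s1"
      using n(2) I by (auto simp: neval_nv I_def p_def)
  qed
  have "runs S W inp (find_prog l a b (compile (Suc l) a c)) s (1 + (N ^ Kc + (1 + (N * (N ^ Kc + 3) + 1)))) (I n)"
    unfolding find_prog_def
  proof (rule runs_Seq, rule runs_SetReg[OF order_refl])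
    let ?s = "s\<lparr>regs := (regs s)(l := nv inp (regs s) (Num 0))\<rparr>"
    have le: "n * ((1 + (N ^ Kc + 1)) + 1) + 1 \<le> N * (N ^ Kc + 3) + 1"
      using n(1) N(4) by (intro add_right_mono mult_mono) (auto simp: B_def)
    have "runs S W inp (Seq (compile (Suc l) a c) (LoadNat (Num (a + 1)) (Num 0))) ?s (N ^ Kc + 1) (I 0)"
      by (rule eval) auto
    then have 1: "runs S W inp (compile (Suc l) a c) ?s (N ^ Kc)
        (\<lambda>s1. runs S W inp (LoadNat (Num (a + 1)) (Num 0)) s1 1 (I 0))"
    proof -
      have val: "rv inp (Suc l) ((regs s)(l := 0)) c = rv inp (Suc l) (regs ?s) c" by simp
      have "runs S W inp (compile (Suc l) a c) ?s (N ^ Kc)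
          (leaves (Suc l) a ?s (rv inp (Suc l) ((regs s)(l := 0)) c))"
        using N S W by (intro evaluatesD[OF c N(1)] val) (auto simp: less_Suc_eq)
      then show ?thesis
        by (rule runs_mono) (use S in \<open>auto simp: leaves_def I_def intro!: runs_LoadNat\<close>)
    qed
    show "runs S W inp (Seq (compile (Suc l) a c) (Seq (LoadNat (Num (a + 1)) (Num 0))
       (While (BAnd (NLess (Reg l) b) (BNot (CellLess (Num (a + 1)) (Num a))))
          (Seq (SetReg l (NPlus (Reg l) (Num 1))) (Seq (compile (Suc l) a c) (LoadNat (Num (a + 1)) (Num 0)))))))
       ?s (N ^ Kc + (1 + (N * (N ^ Kc + 3) + 1))) (I n)"
      by (rule runs_Seq, rule runs_mono[OF 1 order_refl], rule runs_Seq, erule runs_mono[OF _ order_refl],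
          rule runs_mono[OF loop le])
  qed simp
  then show ?thesis
    by (rule runs_mono) (auto simp: I_def n_def B_def p_def[abs_def])
qed

lemma binary_runs:
  assumes K: "evaluates K1 x" "evaluates K2 y" and wf: "wfr l x" "wfr l y"
    and N: "2 \<le> N" "inp_le N inp" "\<forall>j<l. regs s j \<le> N"
    and S: "a + K1 + K2 + 1 \<le> S" and W: "N ^ K1 \<le> W" "N ^ K2 \<le> W"
    and fin: "\<And>s1 s2. leaves l a s (rv inp l (regs s) x) s1 \<Longrightarrow>
      leaves l (a + 1) s1 (rv inp l (regs s) y) s2 \<Longrightarrow> runs S W inp c s2 T (leaves l a s v)"
  shows "runs S W inp (Seq (compile l a x) (Seq (compile l (a + 1) y) c)) s
    (N ^ K1 + (N ^ K2 + T)) (leaves l a s v)"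
proof (rule runs_Seq)
  have "runs S W inp (compile l a x) s (N ^ K1) (leaves l a s (rv inp l (regs s) x))"
    using N wf S W by (intro evaluatesD[OF K(1) _ N(1,2)]) auto
  then show "runs S W inp (compile l a x) s (N ^ K1) (\<lambda>s1.
      runs S W inp (Seq (compile l (a + 1) y) c) s1 (N ^ K2 + T) (leaves l a s v))"
  proof (rule runs_mono[OF _ order_refl])
    fix s1 :: config assume s1: "leaves l a s (rv inp l (regs s) x) s1"
    have y: "rv inp l (regs s) y = rv inp l (regs s1) y"
      using s1 wf by (intro rv_agree) (auto simp: leaves_def)
    have "runs S W inp (compile l (a + 1) y) s1 (N ^ K2) (leaves l (a + 1) s1 (rv inp l (regs s) y))"
      using N wf S W s1 by (intro evaluatesD[OF K(2) _ N(1,2)] y) (auto simp: leaves_def)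
    then show "runs S W inp (Seq (compile l (a + 1) y) c) s1 (N ^ K2 + T) (leaves l a s v)"
      by (intro runs_Seq runs_mono[OF _ order_refl fin[OF s1]])
  qed
qed

lemma evaluates_exists: "\<exists>K. evaluates K e"
proof (induction e)
  case (RNat e)
  have "evaluates 1 (RNat e)"
    unfolding evaluates_def
  proof (intro allI impI)
    fix S W :: nat and inp :: "real list list" and l a :: nat and s :: config and N :: nat assume "2 \<le> N" "a + 1 \<le> S"
    then show "runs S W inp (compile l a (RNat e)) s (N ^ 1) (leaves l a s (rv inp l (regs s) (RNat e)))"
      unfolding compile.simps by (intro runs_LoadNat) (auto simp: leaves_def)
  qed
  then show ?case by blast
next
  case (RIn x i)
  have "evaluates 1 (RIn x i)"
    unfolding evaluates_def
  proof (intro allI impI)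
    fix S W :: nat and inp :: "real list list" and l a :: nat and s :: config and N :: nat assume N: "2 \<le> N" "a + 1 \<le> S"
    have "runs S W inp (compile l a (RIn x i)) s (1 + 1) (leaves l a s (rv inp l (regs s) (RIn x i)))"
      unfolding compile.simps
      by (rule runs_If) (use N in \<open>auto simp: neval_nv leaves_def rin_def intro!: runs_LoadInput runs_LoadNat split: if_splits\<close>)
    then show "runs S W inp (compile l a (RIn x i)) s (N ^ 1) (leaves l a s (rv inp l (regs s) (RIn x i)))"
      by (rule runs_mono) (use N in auto)
  qed
  then show ?case by blast
next
  case (ROp f x y)
  then obtain K1 K2 where K: "evaluates K1 x" "evaluates K2 y" by blast
  define K where "K = K1 + K2 + 1 + 4 + 1"
  have "evaluates K (ROp f x y)"
    unfolding evaluates_def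
  proof (intro allI impI)
    fix S W :: nat and inp :: "real list list" and l a :: nat and s :: config and N :: nat
    assume wf: "wfr l (ROp f x y)" and N: "2 \<le> N" "inp_le N inp" "\<forall>j<l. regs s j \<le> N"
      and S: "a + K \<le> S" and W: "N ^ K \<le> W"
    have le: "N ^ K1 + N ^ K2 + 4 \<le> N ^ K"
      unfolding K_def using N by (intro pow_add_le pow_const_le) auto
    let ?v = "rv inp l (regs s) (ROp f x y)"
    let ?c = "if f = Div then Seq (LoadNat (Num (a + 2)) (Num 0))
        (If (BAnd (BNot (CellLess (Num (a + 1)) (Num (a + 2)))) (BNot (CellLess (Num (a + 2)) (Num (a + 1)))))
           (LoadNat (Num a) (Num 0)) (Arith Div (Num a) (Num a) (Num (a + 1))))
      else Arith f (Num a) (Num a) (Num (a + 1))"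
    have fin: "runs S W inp ?c s2 (1 + (1 + 1)) (leaves l a s ?v)"
      if s1: "leaves l a s (rv inp l (regs s) x) s1"
        and s2: "leaves l (a + 1) s1 (rv inp l (regs s) y) s2" for s1 s2
    proof (cases "f = Div")
      case True
      have "runs S W inp (Seq (LoadNat (Num (a + 2)) (Num 0))
        (If (BAnd (BNot (CellLess (Num (a + 1)) (Num (a + 2)))) (BNot (CellLess (Num (a + 2)) (Num (a + 1)))))
           (LoadNat (Num a) (Num 0)) (Arith Div (Num a) (Num a) (Num (a + 1))))) s2 (1 + (1 + 1)) (leaves l a s ?v)"
        by (rule runs_Seq, rule runs_LoadNat[OF order_refl], use S in \<open>simp add: K_def\<close>, rule runs_If)
          (use s1 s2 S True in \<open>auto simp: K_def leaves_def intro!: runs_LoadNat runs_Arith\<close>)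
      then show ?thesis using True by simp
    next
      case False
      have "runs S W inp (Arith f (Num a) (Num a) (Num (a + 1))) s2 1 (leaves l a s ?v)"
        using False s1 s2 S by (intro runs_Arith) (auto simp: K_def leaves_def)
      then have "runs S W inp (Arith f (Num a) (Num a) (Num (a + 1))) s2 (1 + (1 + 1)) (leaves l a s ?v)"
        by (rule runs_mono) auto
      then show ?thesis using False by simp
    qed
    have "runs S W inp (compile l a (ROp f x y)) s (N ^ K1 + (N ^ K2 + (1 + (1 + 1)))) (leaves l a s ?v)"
      unfolding compile.simps
      by (rule binary_runs[OF K _ _ N]) (use wf S W le fin in \<open>auto simp: K_def\<close>)
    then show "runs S W inp (compile l a (ROp f x y)) s (N ^ K) (leaves l a s ?v)"
      by (rule runs_mono) (use le in auto)
  qed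
  then show ?case by blast
next
  case (RLess x y)
  then obtain K1 K2 where K: "evaluates K1 x" "evaluates K2 y" by blast
  define K where "K = K1 + K2 + 1 + 4 + 1"
  have "evaluates K (RLess x y)"
    unfolding evaluates_def
  proof (intro allI impI)
    fix S W :: nat and inp :: "real list list" and l a :: nat and s :: config and N :: nat
    assume wf: "wfr l (RLess x y)" and N: "2 \<le> N" "inp_le N inp" "\<forall>j<l. regs s j \<le> N"
      and S: "a + K \<le> S" and W: "N ^ K \<le> W"
    have le: "N ^ K1 + N ^ K2 + 4 \<le> N ^ K"
      unfolding K_def using N by (intro pow_add_le pow_const_le) auto
    let ?v = "rv inp l (regs s) (RLess x y)"
    let ?c = "If (CellLess (Num a) (Num (a + 1))) (LoadNat (Num a) (Num 1)) (LoadNat (Num a) (Num 0))"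
    have fin: "runs S W inp ?c s2 (1 + 1) (leaves l a s ?v)"
      if s1: "leaves l a s (rv inp l (regs s) x) s1"
        and s2: "leaves l (a + 1) s1 (rv inp l (regs s) y) s2" for s1 s2
      by (rule runs_If) (use s1 s2 S in \<open>auto simp: K_def leaves_def intro!: runs_LoadNat\<close>)
    have "runs S W inp (compile l a (RLess x y)) s (N ^ K1 + (N ^ K2 + (1 + 1))) (leaves l a s ?v)"
      unfolding compile.simps
      by (rule binary_runs[OF K _ _ N]) (use wf S W le fin in \<open>auto simp: K_def\<close>)
    then show "runs S W inp (compile l a (RLess x y)) s (N ^ K) (leaves l a s ?v)"
      by (rule runs_mono) (use le in auto)
  qed
  then show ?case by blast
next
  case (RSum b e)
  then obtain Ke where Ke: "evaluates Ke e" by blast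
  obtain Kb0 where Kb0: "\<forall>inp \<rho> N l. wfn l b \<longrightarrow> 2 \<le> N \<longrightarrow> inp_le N inp \<longrightarrow> (\<forall>j<l. \<rho> j \<le> N) \<longrightarrow>
      nv inp \<rho> b \<le> N ^ Kb0" using nv_poly[of b] by blast
  define Kb where "Kb = Suc Kb0"
  \<comment> \<open>The exponent copies the shape of the estimate \<open>le\<close> below: products
    add exponents, every sum adds one more, and the constant 3 is at most
    \<open>N ^ 3\<close>.\<close>
  define K where "K = (Kb + (Kb * Ke + 3 + 1)) + 3 + 1"
  have "evaluates K (RSum b e)"
    unfolding evaluates_def
  proof (intro allI impI)
    fix S W :: nat and inp :: "real list list" and l a :: nat and s :: config and N :: nat
    assume wf: "wfr l (RSum b e)" and N: "2 \<le> N" "inp_le N inp" "\<forall>j<l. regs s j \<le> N"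
      and S: "a + K \<le> S" and W: "N ^ K \<le> W"
    \<comment> \<open>Under the binder the new register ranges up to the value of \<open>b\<close>,
      which may exceed \<open>N\<close>. The body is therefore charged with respect to the larger
      base \<open>N1\<close>; the successor in \<open>Kb\<close> ensures
      \<open>N \<le> N1\<close>.\<close>
    define N1 where "N1 = N ^ Kb"
    have NN1: "N \<le> N1" using N(1) self_le_power[of N Kb] by (simp add: N1_def Kb_def)
    have N1: "2 \<le> N1" "inp_le N1 inp" "\<forall>j<l. regs s j \<le> N1"
      using NN1 N inp_le_mono[OF N(2) NN1] by (auto intro: order_trans)
    define B where "B = nv inp (regs s) b"
    have "B \<le> N ^ Kb0" unfolding B_def using Kb0 wf N by auto
    also have "\<dots> \<le> N1" using N(1) unfolding N1_def Kb_def by (intro power_increasing) auto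
    finally have B: "B \<le> N1" .
    have N1e: "N1 ^ Ke = N ^ (Kb * Ke)" by (simp add: N1_def power_mult)
    have le: "N1 * (N1 ^ Ke + 3) + 3 \<le> N ^ K"
      unfolding K_def N1e unfolding N1_def using N
      by (intro pow_add_le pow_mult_le pow_const_le) auto
    have N1W: "N1 \<le> W" "N1 ^ Ke \<le> W"
    proof -
      have "N1 * 1 \<le> N1 * (N1 ^ Ke + 3)" by (intro mult_left_mono) auto
      then show "N1 \<le> W" using le W by linarith
      have "1 * N1 ^ Ke \<le> N1 * (N1 ^ Ke + 3)" using N1(1) by (intro mult_mono) auto
      then show "N1 ^ Ke \<le> W" using le W by linarith
    qed
    have KeS: "a + 1 + Ke \<le> S"
    proof -
      have "Ke \<le> Kb * Ke" by (simp add: Kb_def)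
      then show ?thesis using S unfolding K_def by linarith
    qed
    let ?f = "\<lambda>i. rv inp (Suc l) ((regs s)(l := i)) e"
    define I where "I i s' \<longleftrightarrow> regs s' l = i \<and> cells s' a = (\<Sum>j<i. ?f j) \<and>
      (\<forall>x<a. cells s' x = cells s x) \<and> (\<forall>j<l. regs s' j = regs s j) \<and> emitted s' = emitted s" for i and s' :: config
    let ?body = "Seq (compile (Suc l) (a + 1) e)
        (Seq (Arith Add (Num a) (Num a) (Num (a + 1))) (SetReg l (NPlus (Reg l) (Num 1))))"
    have loop: "runs S W inp (While (NLess (Reg l) b) ?body) s1 (B * ((N1 ^ Ke + (1 + 1)) + 1) + 1) (I B)"
      if "I 0 s1" for s1
    proof (rule runs_While[where I = I, OF _ _ that])
      fix i s1 assume i: "i < B" and I: "I i s1"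
      have bb: "nv inp (regs s1) b = B"
        unfolding B_def using I wf by (intro nv_agree) (auto simp: I_def)
      have v: "?f i = rv inp (Suc l) (regs s1) e"
        using I wf by (intro rv_agree) (auto simp: I_def less_Suc_eq)
      have "runs S W inp (compile (Suc l) (a + 1) e) s1 (N1 ^ Ke) (leaves (Suc l) (a + 1) s1 (?f i))"
        using wf N1 I i B KeS N1W by (intro evaluatesD[OF Ke _ N1(1,2)] v) (auto simp: I_def less_Suc_eq)
      then have "runs S W inp ?body s1 (N1 ^ Ke + (1 + 1)) (I (Suc i))"
      proof (intro runs_Seq, elim runs_mono[OF _ order_refl])
        fix s2 assume s2: "leaves (Suc l) (a + 1) s1 (?f i) s2"
        show "runs S W inp (Seq (Arith Add (Num a) (Num a) (Num (a + 1))) (SetReg l (NPlus (Reg l) (Num 1)))) s2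
            (1 + 1) (I (Suc i))"
          by (intro runs_Seq runs_Arith runs_SetReg) (use s2 I i B N1W KeS in \<open>auto simp: leaves_def I_def\<close>)
      qed
      then show "beval inp (NLess (Reg l) b) s1 \<and> runs S W inp ?body s1 (N1 ^ Ke + (1 + 1)) (I (Suc i))"
        using I i bb by (simp add: neval_nv I_def)
    next
      fix s1 assume I: "I B s1"
      have "nv inp (regs s1) b = B"
        unfolding B_def using I wf by (intro nv_agree) (auto simp: I_def)
      then show "\<not> beval inp (NLess (Reg l) b) s1" using I by (simp add: neval_nv I_def)
    qed
    have "runs S W inp (compile l a (RSum b e)) s (1 + (1 + (B * ((N1 ^ Ke + (1 + 1)) + 1) + 1))) (I B)"
      unfolding compile.simps
      by (intro runs_Seq runs_LoadNat runs_SetReg loop) (use KeS in \<open>auto simp: I_def\<close>)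
    moreover have "1 + (1 + (B * ((N1 ^ Ke + (1 + 1)) + 1) + 1)) \<le> N ^ K"
    proof -
      have "B * (N1 ^ Ke + 3) \<le> N1 * (N1 ^ Ke + 3)" using B by (rule mult_right_mono) simp
      then show ?thesis using le by (simp add: algebra_simps)
    qed
    ultimately show "runs S W inp (compile l a (RSum b e)) s (N ^ K) (leaves l a s (rv inp l (regs s) (RSum b e)))"
      by (rule runs_mono) (auto simp: I_def leaves_def B_def)
  qed
  then show ?case by blast
next
  case (RFind b c e)
  then obtain Kc Ke where Kce: "evaluates Kc c" "evaluates Ke e" by blast
  obtain Kb0 where Kb0: "\<forall>inp \<rho> N l. wfn l b \<longrightarrow> 2 \<le> N \<longrightarrow> inp_le N inp \<longrightarrow> (\<forall>j<l. \<rho> j \<le> N) \<longrightarrow>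
      nv inp \<rho> b \<le> N ^ Kb0" using nv_poly[of b] by blast
  define Kb where "Kb = Suc Kb0"
  define K where "K = ((Kb + (Kb * Kc + 3 + 1)) + (Kb * Kc + Kb * Ke + 1) + 1) + 3 + 1"
  have "evaluates K (RFind b c e)"
    unfolding evaluates_def
  proof (intro allI impI)
    fix S W :: nat and inp :: "real list list" and l a :: nat and s :: config and N :: nat
    assume wf: "wfr l (RFind b c e)" and N: "2 \<le> N" "inp_le N inp" "\<forall>j<l. regs s j \<le> N"
      and S: "a + K \<le> S" and W: "N ^ K \<le> W"
    define N1 where "N1 = N ^ Kb"
    have NN1: "N \<le> N1" using N(1) self_le_power[of N Kb] by (simp add: N1_def Kb_def)
    have N1: "2 \<le> N1" "inp_le N1 inp" "\<And>j. j < l \<Longrightarrow> regs s j \<le> N1"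
      using NN1 N inp_le_mono[OF N(2) NN1] by (auto intro: order_trans)
    define B where "B = nv inp (regs s) b"
    have "B \<le> N ^ Kb0" unfolding B_def using Kb0 wf N by auto
    also have "\<dots> \<le> N1" using N(1) unfolding N1_def Kb_def by (intro power_increasing) auto
    finally have B: "B \<le> N1" .
    have N1p: "N1 ^ j = N ^ (Kb * j)" for j by (simp add: N1_def power_mult)
    have le: "N1 * (N1 ^ Kc + 3) + (N1 ^ Kc + N1 ^ Ke) + 3 \<le> N ^ K"
      unfolding K_def N1p unfolding N1_def using N
      by (intro pow_add_le pow_mult_le pow_const_le) auto
    have N1W: "N1 \<le> W" "N1 ^ Kc \<le> W" "N1 ^ Ke \<le> W"
    proof -
      have "N1 * 1 \<le> N1 * (N1 ^ Kc + 3)" by (intro mult_left_mono) auto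
      then show "N1 \<le> W" using le W by linarith
    qed (use le W in linarith)+
    have KS: "a + Kc + 2 \<le> S" "a + Ke \<le> S"
    proof -
      have "Kc \<le> Kb * Kc" "Ke \<le> Kb * Ke" by (simp_all add: Kb_def)
      then show "a + Kc + 2 \<le> S" "a + Ke \<le> S" using S unfolding K_def by linarith+
    qed
    define n where "n = sel B (\<lambda>i. rv inp (Suc l) ((regs s)(l := i)) c > 0)"
    have n: "n \<le> N1"
    proof -
      have "n \<le> B" unfolding n_def sel_def by (rule Least_le) simp
      with B show ?thesis by simp
    qed
    let ?v = "rv inp l (regs s) (RFind b c e)"
    have "runs S W inp (compile l a (RFind b c e)) s
        ((1 + (N1 ^ Kc + (1 + (N1 * (N1 ^ Kc + 3) + 1)))) + N1 ^ Ke) (leaves l a s ?v)"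
      unfolding compile.simps
    proof (rule runs_Seq, rule runs_mono[OF find_prog_runs[OF Kce(1)] order_refl])
      fix s1 :: config
      assume s1: "regs s1 l = sel (nv inp (regs s) b) (\<lambda>i. rv inp (Suc l) ((regs s)(l := i)) c > 0) \<and>
       (\<forall>x<a. cells s1 x = cells s x) \<and> (\<forall>j<l. regs s1 j = regs s j) \<and> emitted s1 = emitted s"
      then have s1n: "regs s1 l = n" by (simp add: n_def B_def)
      have v: "?v = rv inp (Suc l) (regs s1) e"
        unfolding rv.simps using s1 wf by (intro rv_agree) (auto simp: less_Suc_eq)
      have "runs S W inp (compile (Suc l) a e) s1 (N1 ^ Ke) (leaves (Suc l) a s1 ?v)"
        using wf N1 s1 s1n n KS N1W by (intro evaluatesD[OF Kce(2) _ N1(1,2)] v) (auto simp: less_Suc_eq)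
      then show "runs S W inp (compile (Suc l) a e) s1 (N1 ^ Ke) (leaves l a s ?v)"
        by (rule runs_mono) (use s1 in \<open>auto simp: leaves_def\<close>)
    qed (use wf N1 KS N1W B in \<open>auto simp: B_def\<close>)
    then show "runs S W inp (compile l a (RFind b c e)) s (N ^ K) (leaves l a s ?v)"
      by (rule runs_mono) (use le in auto)
  qed
  then show ?case by blast
qed

text \<open>Register 2 receives the result of a preliminary search, register 3 runs over the output positions.\<close>

definition out_prog :: "nexp \<Rightarrow> rexp \<Rightarrow> nexp \<Rightarrow> rexp \<Rightarrow> prog" where
  "out_prog b c sz e =
     Seq (find_prog 2 0 b (compile 3 0 c))
       (Seq (SetReg 3 (Num 0))
         (While (NLess (Reg 3) sz)
           (Seq (compile 4 0 e) (Seq (Emit (Num 0)) (SetReg 3 (NPlus (Reg 3) (Num 1)))))))"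

definition env0 :: "nat \<Rightarrow> nat \<Rightarrow> nat \<Rightarrow> nat" where
  "env0 n d = (\<lambda>_. 0)(0 := n, 1 := d)"

lemma out_prog_runs:
  "\<exists>K. \<forall>n d inp N S W m. wfn 2 b \<longrightarrow> wfr 3 c \<longrightarrow> wfn 3 sz \<longrightarrow> wfr 4 e \<longrightarrow>
     2 \<le> N \<longrightarrow> n \<le> N \<longrightarrow> d \<le> N \<longrightarrow> inp_le N inp \<longrightarrow> K \<le> S \<longrightarrow> N ^ K \<le> W \<longrightarrow>
     m = sel (nv inp (env0 n d) b) (\<lambda>i. rv inp 3 ((env0 n d)(2 := i)) c > 0) \<longrightarrow>
     runs S W inp (out_prog b c sz e) (start n d) (N ^ K)
       (\<lambda>s'. emitted s' = map (\<lambda>i. rv inp 4 ((env0 n d)(2 := m, 3 := i)) e)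
          [0..<nv inp ((env0 n d)(2 := m)) sz])"
proof -
  obtain Kc Ke where K: "evaluates Kc c" "evaluates Ke e" using evaluates_exists by blast
  obtain Kb0 where Kb0: "\<forall>inp \<rho> N l. wfn l b \<longrightarrow> 2 \<le> N \<longrightarrow> inp_le N inp \<longrightarrow> (\<forall>j<l. \<rho> j \<le> N) \<longrightarrow>
      nv inp \<rho> b \<le> N ^ Kb0" using nv_poly[of b] by blast
  obtain Ks0 where Ks0: "\<forall>inp \<rho> N l. wfn l sz \<longrightarrow> 2 \<le> N \<longrightarrow> inp_le N inp \<longrightarrow> (\<forall>j<l. \<rho> j \<le> N) \<longrightarrow>
      nv inp \<rho> sz \<le> N ^ Ks0" using nv_poly[of sz] by blast
  define Kb where "Kb = Suc Kb0"
  define Ks where "Ks = Kb * Suc Ks0"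
  define K where "K = ((Kb + (Kb * Kc + 3 + 1)) + Kb * Kc + 1) + 3 + 1 + (Ks + (Ks * Ke + 3 + 1) + 2 + 1) + 1"
  show ?thesis
  proof (intro exI[of _ K] allI impI)
    fix n d :: nat and inp and N S W m :: nat
    assume wf: "wfn 2 b" "wfr 3 c" "wfn 3 sz" "wfr 4 e"
      and N: "2 \<le> N" "n \<le> N" "d \<le> N" "inp_le N inp" and S: "K \<le> S" and W: "N ^ K \<le> W"
      and m: "m = sel (nv inp (env0 n d) b) (\<lambda>i. rv inp 3 ((env0 n d)(2 := i)) c > 0)"
    \<comment> \<open>The base is enlarged twice: register 2 stays below \<open>N1\<close>, and the
      output position in register 3 below \<open>N2\<close>.\<close>
    define N1 where "N1 = N ^ Kb"
    define N2 where "N2 = N ^ Ks"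
    have st: "regs (start n d) = env0 n d" "emitted (start n d) = []" by (simp_all add: start_def env0_def)
    have env: "env0 n d j \<le> N" for j using N by (auto simp: env0_def)
    have NN1: "N \<le> N1" using N(1) self_le_power[of N Kb] by (simp add: N1_def Kb_def)
    have N1: "2 \<le> N1" "inp_le N1 inp" "\<And>j. regs (start n d) j \<le> N1"
      using NN1 N inp_le_mono[OF N(4) NN1] env unfolding st by (auto intro: order_trans)
    have "nv inp (env0 n d) b \<le> N ^ Kb0" using Kb0 wf N env by blast
    also have "\<dots> \<le> N1" using N(1) unfolding N1_def Kb_def by (intro power_increasing) auto
    finally have B: "nv inp (env0 n d) b \<le> N1" .
    have mB: "m \<le> N1"
    proof -
      have "m \<le> nv inp (env0 n d) b" unfolding m sel_def by (rule Least_le) simp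
      with B show ?thesis by simp
    qed
    define \<rho> where "\<rho> = (env0 n d)(2 := m)"
    have \<rho>: "\<rho> j \<le> N1" for j using mB env[of j] NN1 by (auto simp: \<rho>_def)
    define Z where "Z = nv inp \<rho> sz"
    have N12: "N1 ^ Suc Ks0 = N2" unfolding N1_def N2_def Ks_def by (rule power_mult[symmetric])
    have "Z \<le> N1 ^ Ks0" unfolding Z_def using Ks0 wf(3) N1 \<rho> by blast
    also have "\<dots> \<le> N2" using N1(1) unfolding N12[symmetric] by (intro power_increasing) auto
    finally have Z: "Z \<le> N2" .
    have N1N2: "N1 \<le> N2" using N1(1) self_le_power[of N1 "Suc Ks0"] unfolding N12 by simp
    have N2: "2 \<le> N2" "inp_le N2 inp" using N1 N1N2 inp_le_mono[OF N1(2) N1N2] by auto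
    have N1p: "N1 ^ j = N ^ (Kb * j)" for j by (simp add: N1_def power_mult)
    have N2p: "N2 ^ j = N ^ (Ks * j)" for j by (simp add: N2_def power_mult)
    have le: "(N1 * (N1 ^ Kc + 3) + N1 ^ Kc + 3) + (N2 * (N2 ^ Ke + 3) + 2) \<le> N ^ K"
      unfolding K_def N1p N2p unfolding N1_def N2_def using N
      by (intro pow_add_le pow_mult_le pow_const_le) auto
    have NW: "N1 \<le> W" "N1 ^ Kc \<le> W" "N2 \<le> W" "N2 ^ Ke \<le> W"
    proof -
      have "N1 * 1 \<le> N1 * (N1 ^ Kc + 3)" by (intro mult_left_mono) auto
      then show "N1 \<le> W" using le W by linarith
      show "N1 ^ Kc \<le> W" using le W by linarith
      have "N2 * 1 \<le> N2 * (N2 ^ Ke + 3)" by (intro mult_left_mono) auto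
      then show "N2 \<le> W" using le W by linarith
      have "1 * N2 ^ Ke \<le> N2 * (N2 ^ Ke + 3)" using N2(1) by (intro mult_mono) auto
      then show "N2 ^ Ke \<le> W" using le W by linarith
    qed
    have KS: "0 + Kc + 2 \<le> S" "0 + Ke \<le> S" "0 < S"
    proof -
      have "Kc \<le> Kb * Kc" "Ke \<le> Ks * Ke" by (simp_all add: Kb_def Ks_def)
      then show "0 + Kc + 2 \<le> S" "0 + Ke \<le> S" "0 < S" using S unfolding K_def by linarith+
    qed
    let ?out = "\<lambda>i. rv inp 4 (\<rho>(3 := i)) e"
    define I where "I i s' \<longleftrightarrow> regs s' 3 = i \<and> (\<forall>j<3. regs s' j = \<rho> j) \<and>
      emitted s' = map ?out [0..<i]" for i and s' :: config
    let ?body = "Seq (compile 4 0 e) (Seq (Emit (Num 0)) (SetReg 3 (NPlus (Reg 3) (Num 1))))"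
    have loop: "runs S W inp (While (NLess (Reg 3) sz) ?body) s1 (Z * ((N2 ^ Ke + (1 + 1)) + 1) + 1) (I Z)"
      if "I 0 s1" for s1
    proof (rule runs_While[where I = I, OF _ _ that])
      fix i s1 assume i: "i < Z" and I: "I i s1"
      have bb: "nv inp (regs s1) sz = Z"
        unfolding Z_def using I wf by (intro nv_agree) (auto simp: I_def)
      have v: "?out i = rv inp 4 (regs s1) e"
        using I wf by (intro rv_agree) (auto simp: I_def less_Suc_eq numeral_eq_Suc)
      have "regs s1 j \<le> N2" if "j < 4" for j
      proof (cases "j = 3")
        case True
        then show ?thesis using I i Z by (simp add: I_def)
      next
        case False
        then have "regs s1 j = \<rho> j" using I that by (simp add: I_def)
        then show ?thesis using \<rho>[of j] N1N2 by simp
      qed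
      then have "runs S W inp (compile 4 0 e) s1 (N2 ^ Ke) (leaves 4 0 s1 (?out i))"
        using wf N2 KS NW by (intro evaluatesD[OF K(2) _ N2(1,2)] v) auto
      then have "runs S W inp ?body s1 (N2 ^ Ke + (1 + 1)) (I (Suc i))"
      proof (intro runs_Seq, elim runs_mono[OF _ order_refl])
        fix s2 assume s2: "leaves 4 0 s1 (?out i) s2"
        show "runs S W inp (Seq (Emit (Num 0)) (SetReg 3 (NPlus (Reg 3) (Num 1)))) s2 (1 + 1) (I (Suc i))"
          by (intro runs_Seq runs_Emit runs_SetReg) (use s2 I i Z NW in \<open>auto simp: leaves_def I_def\<close>)
      qed
      then show "beval inp (NLess (Reg 3) sz) s1 \<and> runs S W inp ?body s1 (N2 ^ Ke + (1 + 1)) (I (Suc i))"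
        using I i bb by (simp add: neval_nv I_def)
    next
      fix s1 assume I: "I Z s1"
      have "nv inp (regs s1) sz = Z"
        unfolding Z_def using I wf by (intro nv_agree) (auto simp: I_def)
      then show "\<not> beval inp (NLess (Reg 3) sz) s1" using I by (simp add: neval_nv I_def)
    qed
    have "runs S W inp (out_prog b c sz e) (start n d)
        ((1 + (N1 ^ Kc + (1 + (N1 * (N1 ^ Kc + 3) + 1)))) + (1 + (Z * ((N2 ^ Ke + (1 + 1)) + 1) + 1))) (I Z)"
      unfolding out_prog_def
    proof (rule runs_Seq, rule runs_mono[OF _ order_refl])
      show "runs S W inp (find_prog 2 0 b (compile 3 0 c)) (start n d) (1 + (N1 ^ Kc + (1 + (N1 * (N1 ^ Kc + 3) + 1))))
        (\<lambda>s'. regs s' 2 = sel (nv inp (regs (start n d)) b) (\<lambda>i. rv inp (Suc 2) ((regs (start n d))(2 := i)) c > 0) \<and>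
          (\<forall>x<0. cells s' x = cells (start n d) x) \<and> (\<forall>j<2. regs s' j = regs (start n d) j) \<and>
          emitted s' = emitted (start n d))"
        using find_prog_runs[OF K(1), of 2 b N1 inp "start n d" 0 S W] wf N1 KS NW B
        by (simp add: st)
    next
      fix s1 :: config
      assume s1: "regs s1 2 = sel (nv inp (regs (start n d)) b) (\<lambda>i. rv inp (Suc 2) ((regs (start n d))(2 := i)) c > 0) \<and>
          (\<forall>x<0. cells s1 x = cells (start n d) x) \<and> (\<forall>j<2. regs s1 j = regs (start n d) j) \<and>
          emitted s1 = emitted (start n d)"
      then have r2: "regs s1 2 = m" by (simp add: m st)
      have r: "regs s1 j = \<rho> j" if "j < 3" for j
      proof (cases "j = 2")
        case True
        then show ?thesis using r2 by (simp add: \<rho>_def)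
      next
        case False
        then show ?thesis using s1 that by (simp add: \<rho>_def st)
      qed
      show "runs S W inp (Seq (SetReg 3 (Num 0)) (While (NLess (Reg 3) sz) ?body)) s1
          (1 + (Z * ((N2 ^ Ke + (1 + 1)) + 1) + 1)) (I Z)"
        by (intro runs_Seq runs_SetReg loop) (use r s1 st in \<open>auto simp: I_def\<close>)
    qed
    moreover have "(1 + (N1 ^ Kc + (1 + (N1 * (N1 ^ Kc + 3) + 1)))) + (1 + (Z * ((N2 ^ Ke + (1 + 1)) + 1) + 1)) \<le> N ^ K"
    proof -
      have "Z * (N2 ^ Ke + 3) \<le> N2 * (N2 ^ Ke + 3)" using Z by (rule mult_right_mono) simp
      then show ?thesis using le by (simp add: algebra_simps)
    qed
    ultimately show "runs S W inp (out_prog b c sz e) (start n d) (N ^ K)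
       (\<lambda>s'. emitted s' = map (\<lambda>i. rv inp 4 ((env0 n d)(2 := m, 3 := i)) e)
          [0..<nv inp ((env0 n d)(2 := m)) sz])"
      by (rule runs_mono) (simp add: I_def Z_def \<rho>_def)
  qed
qed

section \<open>Denotations of expressions\<close>

type_synonym ctx = "nat \<times> (nat \<Rightarrow> nat)"

text \<open>An expression as a function of its binding depth.\<close>

type_synonym expr = "nat \<Rightarrow> rexp"

text \<open>Entry of a matrix, given by an expression for the row and a fixed column.\<close>

type_synonym access = "nexp \<Rightarrow> nat \<Rightarrow> expr"

definition le_ctx :: "ctx \<Rightarrow> ctx \<Rightarrow> bool" (infix "\<lesssim>" 50) where
  "w \<lesssim> w' \<longleftrightarrow> fst w \<le> fst w' \<and> (\<forall>j<fst w. snd w' j = snd w j)"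

lemma le_ctx_refl [simp]: "w \<lesssim> w"
  by (simp add: le_ctx_def)

lemma le_ctx_trans: "w \<lesssim> w' \<Longrightarrow> w' \<lesssim> w'' \<Longrightarrow> w \<lesssim> w''"
  by (auto simp: le_ctx_def)

definition nden :: "real list list \<Rightarrow> ctx \<Rightarrow> nexp \<Rightarrow> nat \<Rightarrow> bool" where
  "nden inp w x i \<longleftrightarrow> wfn (fst w) x \<and> nv inp (snd w) x = i"

text \<open>Quantifying over all extensions of the context makes denotations stable under further
  binders (\<open>den_mono\<close>). Expressions can then be combined without renaming, since an
  \<open>expr\<close> places its own registers above whatever depth it is used at.\<close>

definition den :: "real list list \<Rightarrow> ctx \<Rightarrow> expr \<Rightarrow> real \<Rightarrow> bool" where
  "den inp w e v \<longleftrightarrow> (\<forall>w'. w \<lesssim> w' \<longrightarrow> wfr (fst w') (e (fst w')) \<and> rv inp (fst w') (snd w') (e (fst w')) = v)"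

lemma nden_mono: "nden inp w x i \<Longrightarrow> w \<lesssim> w' \<Longrightarrow> nden inp w' x i"
  unfolding nden_def le_ctx_def using nv_agree[of "fst w" x "snd w'" "snd w" inp] by (auto intro: wfn_mono)

lemma den_mono: "den inp w e v \<Longrightarrow> w \<lesssim> w' \<Longrightarrow> den inp w' e v"
  unfolding den_def by (blast intro: le_ctx_trans)

named_theorems den_intro

lemma nden_Num [den_intro]: "nden inp w (Num m) m"
  by (simp add: nden_def)

lemma nden_NPlus [den_intro]: "nden inp w x i \<Longrightarrow> nden inp w y j \<Longrightarrow> nden inp w (NPlus x y) (i + j)"
  by (simp add: nden_def)

lemma nden_NMinus [den_intro]: "nden inp w x i \<Longrightarrow> nden inp w y j \<Longrightarrow> nden inp w (NMinus x y) (i - j)"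
  by (simp add: nden_def)

lemma nden_NTimes [den_intro]: "nden inp w x i \<Longrightarrow> nden inp w y j \<Longrightarrow> nden inp w (NTimes x y) (i * j)"
  by (simp add: nden_def)

lemma nden_InCount [den_intro]: "nden inp w InCount (length inp)"
  by (simp add: nden_def)

fun npow :: "nexp \<Rightarrow> nat \<Rightarrow> nexp" where
  "npow x 0 = Num 1"
| "npow x (Suc m) = NTimes x (npow x m)"

lemma nden_npow [den_intro]: "nden inp w x i \<Longrightarrow> nden inp w (npow x m) (i ^ m)"
  by (induction m) (auto simp: nden_def)

definition natE :: "nexp \<Rightarrow> expr" where "natE x = (\<lambda>l. RNat x)"
definition inE :: "nexp \<Rightarrow> nexp \<Rightarrow> expr" where "inE a i = (\<lambda>l. RIn a i)"
definition opE :: "arith_op \<Rightarrow> expr \<Rightarrow> expr \<Rightarrow> expr" where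
  "opE f a b = (\<lambda>l. ROp f (a l) (b l))"
definition lessE :: "expr \<Rightarrow> expr \<Rightarrow> expr" where
  "lessE a b = (\<lambda>l. RLess (a l) (b l))"
text \<open>Higher-order syntax: the body is a HOL function of the bound index, which is
  instantiated with the register of the current depth.\<close>

definition sumE :: "nexp \<Rightarrow> (nexp \<Rightarrow> expr) \<Rightarrow> expr" where
  "sumE b F = (\<lambda>l. RSum b (F (Reg l) (Suc l)))"
definition findE :: "nexp \<Rightarrow> (nexp \<Rightarrow> expr) \<Rightarrow> (nexp \<Rightarrow> expr) \<Rightarrow> expr" where
  "findE b C F = (\<lambda>l. RFind b (C (Reg l) (Suc l)) (F (Reg l) (Suc l)))"

abbreviation "numE m \<equiv> natE (Num m)"
abbreviation "addE \<equiv> opE Add"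
abbreviation "subE \<equiv> opE Sub"
abbreviation "mulE \<equiv> opE Mul"
abbreviation "divE \<equiv> opE Div"

lemma den_natE: "nden inp w x i \<Longrightarrow> den inp w (natE x) (real i)"
  unfolding den_def natE_def using nden_mono[of inp w x i] by (auto simp: nden_def)

lemma den_numE: "real m = v \<Longrightarrow> den inp w (numE m) v"
  using den_natE[OF nden_Num] by blast

lemma den_inE: "nden inp w a i \<Longrightarrow> nden inp w x j \<Longrightarrow> den inp w (inE a x) (rin inp i j)"
  unfolding den_def inE_def using nden_mono[of inp w a i] nden_mono[of inp w x j] by (auto simp: nden_def)

lemma den_opE: "den inp w a x \<Longrightarrow> den inp w b y \<Longrightarrow> den inp w (opE f a b) (arith f x y)"
  unfolding den_def opE_def by simp

lemma den_arith:
  assumes "den inp w a x" and "den inp w b y"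
  shows "den inp w (addE a b) (x + y)" and "den inp w (subE a b) (x - y)"
    and "den inp w (mulE a b) (x * y)" and "den inp w (divE a b) (x / y)"
  using den_opE[OF assms] by (metis arith.simps)+

lemma den_lessE: "den inp w a x \<Longrightarrow> den inp w b y \<Longrightarrow> den inp w (lessE a b) (of_bool (x < y))"
  unfolding den_def lessE_def by simp

lemma binder_ctx:
  assumes "w \<lesssim> w'"
  shows "w \<lesssim> (Suc (fst w'), (snd w')(fst w' := i))" and
    "nden inp (Suc (fst w'), (snd w')(fst w' := i)) (Reg (fst w')) i"
  using assms by (auto simp: le_ctx_def nden_def)

lemma den_sumE:
  assumes b: "nden inp w b B"
    and F: "\<And>w' z i. w \<lesssim> w' \<Longrightarrow> nden inp w' z i \<Longrightarrow> den inp w' (F z) (f i)"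
  shows "den inp w (sumE b F) (\<Sum>i<B. f i)"
  unfolding den_def
proof (intro allI impI)
  fix w' assume w': "w \<lesssim> w'"
  have "nden inp w' b B" using nden_mono[OF b w'] .
  moreover have "den inp (Suc (fst w'), (snd w')(fst w' := i)) (F (Reg (fst w'))) (f i)" for i
    by (rule F[OF binder_ctx[OF w']])
  then have "wfr (Suc (fst w')) (F (Reg (fst w')) (Suc (fst w')))"
    "rv inp (Suc (fst w')) ((snd w')(fst w' := i)) (F (Reg (fst w')) (Suc (fst w'))) = f i" for i
    unfolding den_def by (metis fst_conv snd_conv le_ctx_refl)+
  ultimately show "wfr (fst w') (sumE b F (fst w')) \<and>
      rv inp (fst w') (snd w') (sumE b F (fst w')) = (\<Sum>i<B. f i)"
    by (simp add: sumE_def nden_def)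
qed

lemma den_findE:
  assumes b: "nden inp w b B"
    and C: "\<And>w' z i. w \<lesssim> w' \<Longrightarrow> nden inp w' z i \<Longrightarrow> den inp w' (C z) (of_bool (p i))"
    and F: "\<And>w' z. w \<lesssim> w' \<Longrightarrow> nden inp w' z (sel B p) \<Longrightarrow> den inp w' (F z) v"
  shows "den inp w (findE b C F) v"
  unfolding den_def
proof (intro allI impI)
  fix w' assume w': "w \<lesssim> w'"
  have "nden inp w' b B" using nden_mono[OF b w'] .
  moreover have "den inp (Suc (fst w'), (snd w')(fst w' := sel B p)) (F (Reg (fst w'))) v"
    by (rule F[OF binder_ctx[OF w']])
  then have "wfr (Suc (fst w')) (F (Reg (fst w')) (Suc (fst w')))"
    "rv inp (Suc (fst w')) ((snd w')(fst w' := sel B p)) (F (Reg (fst w')) (Suc (fst w'))) = v"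
    unfolding den_def by (metis fst_conv snd_conv le_ctx_refl)+
  moreover have "den inp (Suc (fst w'), (snd w')(fst w' := i)) (C (Reg (fst w'))) (of_bool (p i))" for i
    by (rule C[OF binder_ctx[OF w']])
  then have "wfr (Suc (fst w')) (C (Reg (fst w')) (Suc (fst w')))"
    "rv inp (Suc (fst w')) ((snd w')(fst w' := i)) (C (Reg (fst w')) (Suc (fst w'))) = of_bool (p i)" for i
    unfolding den_def by (metis fst_conv snd_conv le_ctx_refl)+
  ultimately show "wfr (fst w') (findE b C F (fst w')) \<and>
      rv inp (fst w') (snd w') (findE b C F (fst w')) = v"
    by (simp add: findE_def nden_def)
qed

text \<open>Truth values are the reals 0 and 1, and connectives are arithmetic. \<open>ifE\<close>
  evaluates both branches, which is safe because evaluation is total.\<close>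

definition notE :: "expr \<Rightarrow> expr" where "notE a = subE (numE 1) a"
definition andE :: "expr \<Rightarrow> expr \<Rightarrow> expr" where "andE a b = mulE a b"
definition leE :: "expr \<Rightarrow> expr \<Rightarrow> expr" where "leE a b = notE (lessE b a)"
definition eqE :: "expr \<Rightarrow> expr \<Rightarrow> expr" where "eqE a b = andE (leE a b) (leE b a)"
definition ifE :: "expr \<Rightarrow> expr \<Rightarrow> expr \<Rightarrow> expr" where
  "ifE c a b = addE (mulE c a) (mulE (notE c) b)"
definition absE :: "expr \<Rightarrow> expr" where
  "absE a = ifE (lessE a (numE 0)) (subE (numE 0) a) a"
definition allE :: "nexp \<Rightarrow> (nexp \<Rightarrow> expr) \<Rightarrow> expr" where
  "allE b F = lessE (sumE b (\<lambda>z. notE (F z))) (numE 1)"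

text \<open>Unrolled sum over a range that is fixed with the program. Its index is a HOL number, so
  it may select a row or column of a constant-size matrix, as \<open>cofE\<close> requires;
  \<open>sumE\<close> is for ranges known only at run time.\<close>

fun ssum :: "nat \<Rightarrow> (nat \<Rightarrow> expr) \<Rightarrow> expr" where
  "ssum 0 f = numE 0"
| "ssum (Suc n) f = addE (ssum n f) (f n)"

fun sall :: "nat \<Rightarrow> (nat \<Rightarrow> expr) \<Rightarrow> expr" where
  "sall 0 f = numE 1"
| "sall (Suc n) f = andE (sall n f) (f n)"

lemma den_cong: "den inp w e v \<Longrightarrow> v = v' \<Longrightarrow> den inp w e v'"
  by simp

lemma den_notE: "den inp w a (of_bool p) \<Longrightarrow> den inp w (notE a) (of_bool (\<not> p))"
  unfolding notE_def by (rule den_cong[OF den_arith(2)[OF den_numE[OF refl]]]) auto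

lemma den_andE:
  "den inp w a (of_bool p) \<Longrightarrow> den inp w b (of_bool p') \<Longrightarrow> den inp w (andE a b) (of_bool (p \<and> p'))"
  unfolding andE_def by (rule den_cong[OF den_arith(3)]) auto

lemma den_leE: "den inp w a x \<Longrightarrow> den inp w b y \<Longrightarrow> den inp w (leE a b) (of_bool (x \<le> y))"
  unfolding leE_def by (rule den_cong[OF den_notE[OF den_lessE]]) auto

lemma den_eqE: "den inp w a x \<Longrightarrow> den inp w b y \<Longrightarrow> p = (x = y) \<Longrightarrow> den inp w (eqE a b) (of_bool p)"
  unfolding eqE_def by (rule den_cong[OF den_andE[OF den_leE den_leE]]) auto

lemma den_nat_eqE:
  "nden inp w x i \<Longrightarrow> nden inp w y j \<Longrightarrow> den inp w (eqE (natE x) (natE y)) (of_bool (i = j))"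
  by (rule den_eqE[OF den_natE den_natE]) simp_all

lemma den_ifE:
  "den inp w c (of_bool p) \<Longrightarrow> den inp w a x \<Longrightarrow> den inp w b y \<Longrightarrow>
   den inp w (ifE c a b) (if p then x else y)"
  unfolding ifE_def
  by (rule den_cong[OF den_arith(1)[OF den_arith(3) den_arith(3)[OF den_notE]]]) auto

lemma den_absE: "den inp w a x \<Longrightarrow> den inp w (absE a) \<bar>x\<bar>"
  unfolding absE_def
  by (rule den_cong[OF den_ifE[OF den_lessE[OF _ den_numE[OF refl]] den_arith(2)[OF den_numE[OF refl]]]]) auto

lemma den_ssum:
  "(\<And>i. i < n \<Longrightarrow> den inp w (f i) (g i)) \<Longrightarrow> den inp w (ssum n f) (\<Sum>i<n. g i)"
  by (induction n) (auto intro: den_numE den_arith)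

lemma den_sall:
  "(\<And>i. i < n \<Longrightarrow> den inp w (f i) (of_bool (p i))) \<Longrightarrow> den inp w (sall n f) (of_bool (\<forall>i<n. p i))"
proof (induction n)
  case 0
  then show ?case by (auto intro: den_numE)
next
  case (Suc n)
  then have "den inp w (sall (Suc n) f) (of_bool ((\<forall>i<n. p i) \<and> p n))"
    unfolding sall.simps by (intro den_andE Suc.IH) simp_all
  then show ?case by (rule den_cong) (auto simp: less_Suc_eq)
qed

lemma den_allE:
  assumes "nden inp w b B"
    and "\<And>w' z i. w \<lesssim> w' \<Longrightarrow> nden inp w' z i \<Longrightarrow> den inp w' (F z) (of_bool (p i))"
  shows "den inp w (allE b F) (of_bool (\<forall>i<B. p i))"
proof -
  have "den inp w (allE b F) (of_bool ((\<Sum>i<B. of_bool (\<not> p i)) < (real 1)))"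
    unfolding allE_def by (intro den_lessE den_sumE assms den_notE den_natE nden_Num)
  moreover have "(\<Sum>i<B. of_bool (\<not> p i)) < (real 1) \<longleftrightarrow> (\<forall>i<B. p i)"
  proof
    assume *: "(\<Sum>i<B. of_bool (\<not> p i)) < (real 1)"
    show "\<forall>i<B. p i"
    proof (rule ccontr)
      assume "\<not> ?thesis"
      then obtain i where i: "i < B" "\<not> p i" by blast
      have "(of_bool (\<not> p i) :: real) \<le> (\<Sum>i<B. of_bool (\<not> p i))"
        using i by (intro member_le_sum) auto
      with * i show False by simp
    qed
  next
    assume "\<forall>i<B. p i"
    then have "(\<Sum>i<B. of_bool (\<not> p i)) = (0 :: real)" by (intro sum.neutral) auto
    then show "(\<Sum>i<B. of_bool (\<not> p i)) < (real 1)" by simp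
  qed
  ultimately show ?thesis by simp
qed

text \<open>Index expressions have no division, so the quotient is found as the least
  \<open>z\<close> with \<open>x < (z + 1) * y\<close>. The search bound \<open>x\<close> is right
  even for \<open>y = 1\<close>: no smaller \<open>z\<close> passes the test, and the default value
  \<open>x\<close> is the quotient.\<close>

definition letdiv :: "nexp \<Rightarrow> nexp \<Rightarrow> (nexp \<Rightarrow> expr) \<Rightarrow> expr" where
  "letdiv x y F = findE x (\<lambda>z. lessE (natE x) (natE (NTimes (NPlus z (Num 1)) y))) F"

definition letdig :: "nexp \<Rightarrow> nat \<Rightarrow> nexp \<Rightarrow> (nexp \<Rightarrow> expr) \<Rightarrow> expr" where
  "letdig b p x F = letdiv x (npow b p) (\<lambda>u. letdiv u b (\<lambda>v. F (NMinus u (NTimes v b))))"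

lemma sel_div:
  assumes "j > 0"
  shows "sel i (\<lambda>t. i < (t + 1) * j) = i div j"
  unfolding sel_def
proof (rule Least_equality)
  show "i div j = i \<or> i < (i div j + 1) * j"
    using dividend_less_div_times[OF assms, of i] by (simp add: mult.commute)
next
  fix t assume t: "t = i \<or> i < (t + 1) * j"
  show "i div j \<le> t"
  proof (cases "t = i")
    case True
    then show ?thesis by simp
  next
    case False
    then have "i < (t + 1) * j" using t by simp
    then have "i div j < t + 1" using assms by (simp add: less_mult_imp_div_less)
    then show ?thesis by simp
  qed
qed

lemma den_letdiv:
  assumes x: "nden inp w x i" and y: "nden inp w y j" and j: "j > 0"
    and F: "\<And>w' z. w \<lesssim> w' \<Longrightarrow> nden inp w' z (i div j) \<Longrightarrow> den inp w' (F z) v"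
  shows "den inp w (letdiv x y F) v"
  unfolding letdiv_def
proof (rule den_findE[OF x])
  fix w' z t assume w': "w \<lesssim> w'" "nden inp w' z t"
  have "den inp w' (lessE (natE x) (natE (NTimes (NPlus z (Num 1)) y))) (of_bool (real i < real ((t + 1) * j)))"
    by (intro den_lessE den_natE nden_NTimes nden_NPlus nden_Num w'(2) nden_mono[OF x w'(1)] nden_mono[OF y w'(1)])
  then show "den inp w' (lessE (natE x) (natE (NTimes (NPlus z (Num 1)) y))) (of_bool (i < (t + 1) * j))"
    by (simp only: of_nat_less_iff)
next
  fix w' z assume "w \<lesssim> w'" "nden inp w' z (sel i (\<lambda>t. i < (t + 1) * j))"
  then show "den inp w' (F z) v" unfolding sel_div[OF j] by (rule F)
qed

lemma den_letdig:
  assumes x: "nden inp w x i" and b: "nden inp w b B" and B: "B > 0"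
    and F: "\<And>w' z. w \<lesssim> w' \<Longrightarrow> nden inp w' z (dig B i p) \<Longrightarrow> den inp w' (F z) v"
  shows "den inp w (letdig b p x F) v"
  unfolding letdig_def
proof (rule den_letdiv[OF x nden_npow[OF b]])
  fix w1 u assume 1: "w \<lesssim> w1" "nden inp w1 u (i div B ^ p)"
  show "den inp w1 (letdiv u b (\<lambda>v. F (NMinus u (NTimes v b)))) v"
  proof (rule den_letdiv[OF 1(2) nden_mono[OF b 1(1)] B])
    fix w2 t assume 2: "w1 \<lesssim> w2" "nden inp w2 t (i div B ^ p div B)"
    have w2: "w \<lesssim> w2" using 1(1) 2(1) by (rule le_ctx_trans)
    have "nden inp w2 (NMinus u (NTimes t b)) (i div B ^ p - i div B ^ p div B * B)"
      by (intro nden_NMinus nden_NTimes nden_mono[OF 1(2) 2(1)] 2(2) nden_mono[OF b w2])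
    then show "den inp w2 (F (NMinus u (NTimes t b))) v"
      by (intro F[OF w2]) (simp add: dig_def minus_div_mult_eq_mod)
  qed
qed (use B in simp)

section \<open>Expressions for vertices, sketches and regression\<close>

definition accden :: "real list list \<Rightarrow> ctx \<Rightarrow> access \<Rightarrow> (nat \<Rightarrow> nat \<Rightarrow> real) \<Rightarrow> bool" where
  "accden inp w acc P \<longleftrightarrow> (\<forall>w' z i c. w \<lesssim> w' \<longrightarrow> nden inp w' z i \<longrightarrow> den inp w' (acc z c) (P i c))"

lemma accdenI: "(\<And>w' z i c. w \<lesssim> w' \<Longrightarrow> nden inp w' z i \<Longrightarrow> den inp w' (acc z c) (P i c)) \<Longrightarrow> accden inp w acc P"
  by (simp add: accden_def)

lemma accdenD: "accden inp w acc P \<Longrightarrow> nden inp w z i \<Longrightarrow> den inp w (acc z c) (P i c)"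
  unfolding accden_def using le_ctx_refl by blast

lemma accden_mono: "accden inp w acc P \<Longrightarrow> w \<lesssim> w' \<Longrightarrow> accden inp w' acc P"
  unfolding accden_def by (blast intro: le_ctx_trans)

definition dotE :: "nat \<Rightarrow> (nat \<Rightarrow> expr) \<Rightarrow> (nat \<Rightarrow> expr) \<Rightarrow> expr" where
  "dotE q u v = ssum q (\<lambda>c. mulE (u c) (v c))"

definition nrmE :: "nat \<Rightarrow> nexp \<Rightarrow> access \<Rightarrow> (nat \<Rightarrow> expr) \<Rightarrow> expr" where
  "nrmE q M acc y = sumE M (\<lambda>z. absE (dotE q (acc z) y))"

fun dtE :: "nat \<Rightarrow> (nat \<Rightarrow> nat \<Rightarrow> expr) \<Rightarrow> expr" where
  "dtE 0 f = numE 1"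
| "dtE (Suc n) f = ssum (Suc n) (\<lambda>c. mulE (mulE (if even c then numE 1 else subE (numE 0) (numE 1)) (f 0 c))
     (dtE n (\<lambda>i j. f (Suc i) (if j < c then j else Suc j))))"

definition cofE :: "nat \<Rightarrow> (nat \<Rightarrow> nat \<Rightarrow> expr) \<Rightarrow> nat \<Rightarrow> nat \<Rightarrow> expr" where
  "cofE q X l c = dtE q (X(l := (\<lambda>j. numE (if j = c then 1 else 0))))"

lemma den_dotE:
  "(\<And>c. den inp w (u c) (x c)) \<Longrightarrow> (\<And>c. den inp w (v c) (y c)) \<Longrightarrow> den inp w (dotE q u v) (dotp q x y)"
  unfolding dotE_def dotp_def by (intro den_ssum den_arith)

lemma den_nrmE:
  assumes M: "nden inp w M m" and acc: "accden inp w acc P" and y: "\<And>c. den inp w (y c) (x c)"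
  shows "den inp w (nrmE q M acc y) (nrm q m P x)"
  unfolding nrmE_def nrm_def
proof (intro den_sumE[OF M] den_absE den_dotE)
  fix w' z i c assume w': "w \<lesssim> w'" "nden inp w' z i"
  show "den inp w' (acc z c) (P i c)" by (rule accdenD[OF accden_mono[OF acc w'(1)] w'(2)])
  show "den inp w' (y c) (x c)" by (rule den_mono[OF y w'(1)])
qed

lemma den_dtE: "(\<And>i c. den inp w (X i c) (f i c)) \<Longrightarrow> den inp w (dtE n X) (dt n f)"
proof (induction n arbitrary: X f)
  case 0
  then show ?case by (auto intro: den_numE)
next
  case (Suc n)
  have sgn: "den inp w (if even c then numE 1 else subE (numE 0) (numE 1)) ((-1) ^ c)" for c
  proof (cases "even c")
    case True
    then show ?thesis by (auto intro: den_numE)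
  next
    case False
    then show ?thesis using den_arith(2)[OF den_numE[OF refl, of inp w 0] den_numE[OF refl, of inp w 1]] by simp
  qed
  show ?case
    unfolding dtE.simps dt.simps by (intro den_ssum den_arith sgn Suc)
qed

lemma den_cofE: "(\<And>i c. den inp w (X i c) (f i c)) \<Longrightarrow> den inp w (cofE q X l c) (cof q f l c)"
  unfolding cofE_def cof_def by (rule den_dtE) (auto simp: unitv_def intro: den_numE)

definition extE :: "nexp \<Rightarrow> access \<Rightarrow> nexp \<Rightarrow> nat \<Rightarrow> expr" where
  "extE M acc z c = ifE (lessE (natE z) (natE M)) (acc z c) (eqE (natE z) (natE (NPlus M (Num c))))"

definition candE :: "nat \<Rightarrow> nexp \<Rightarrow> access \<Rightarrow> nexp \<Rightarrow> nat \<Rightarrow> expr" where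
  "candE q M acc t c = cofE q (\<lambda>i j. letdig (NPlus M (Num q)) i t (\<lambda>z. extE M acc z j)) (q - 1) c"

definition ncandE :: "nat \<Rightarrow> nexp \<Rightarrow> nexp" where
  "ncandE q M = npow (NPlus M (Num q)) (q - 1)"

lemma nden_ncandE [den_intro]: "nden inp w M m \<Longrightarrow> nden inp w (ncandE q M) (ncand q m)"
  unfolding ncandE_def ncand_def by (intro den_intro)

lemma accden_extE:
  assumes M: "nden inp w M m" and acc: "accden inp w acc P"
  shows "accden inp w (extE M acc) (ext_row m P)"
proof (rule accdenI)
  fix w' z i c assume w': "w \<lesssim> w'" "nden inp w' z i"
  have M': "nden inp w' M m" by (rule nden_mono[OF M w'(1)])
  have "den inp w' (extE M acc z c) (if real i < real m then P i c else of_bool (i = m + c))"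
    unfolding extE_def
    by (intro den_ifE den_lessE den_natE w'(2) M' accdenD[OF accden_mono[OF acc w'(1)]]
        den_nat_eqE nden_NPlus nden_Num)
  then show "den inp w' (extE M acc z c) (ext_row m P i c)"
    by (rule den_cong) (simp add: ext_row_def)
qed

lemma accden_candE:
  assumes M: "nden inp w M m" and acc: "accden inp w acc P" and q: "q \<ge> 1"
  shows "accden inp w (candE q M acc) (cand q m P)"
proof (rule accdenI)
  fix w' z t c assume w': "w \<lesssim> w'" "nden inp w' z t"
  have M': "nden inp w' M m" by (rule nden_mono[OF M w'(1)])
  show "den inp w' (candE q M acc z c) (cand q m P t c)"
    unfolding candE_def cand_def
  proof (intro den_cofE den_letdig[OF w'(2) nden_NPlus[OF M' nden_Num]])
    fix w2 u i j assume "w' \<lesssim> w2" and u: "nden inp w2 u (dig (m + q) t i)"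
    then have "w \<lesssim> w2" using w'(1) le_ctx_trans by blast
    then show "den inp w2 (extE M acc u j) (ext_row m P (dig (m + q) t i) j)"
      by (intro accdenD[OF accden_mono[OF accden_extE[OF M acc]]] u)
  qed (use q in simp)
qed

definition tupleE :: "nat \<Rightarrow> nexp \<Rightarrow> access \<Rightarrow> nexp \<Rightarrow> nat \<Rightarrow> nat \<Rightarrow> expr" where
  "tupleE q M acc s l c = letdig (ncandE q M) l s (\<lambda>z. candE q M acc z c)"

lemma den_tupleE:
  assumes M: "nden inp w M m" and acc: "accden inp w acc P" and q: "q \<ge> 1" and s: "nden inp w z s"
  shows "den inp w (tupleE q M acc z l c) (tuple q m P s l c)"
  unfolding tupleE_def tuple_def
proof (rule den_letdig[OF s nden_ncandE[OF M]])
  fix w' u assume w': "w \<lesssim> w'" "nden inp w' u (dig (ncand q m) s l)"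
  then show "den inp w' (candE q M acc u c) (cand q m P (dig (ncand q m) s l) c)"
    by (intro accdenD[OF accden_mono[OF accden_candE[OF M acc q]]])
qed (use q in \<open>simp add: ncand_def\<close>)

definition spanningE :: "nat \<Rightarrow> nexp \<Rightarrow> access \<Rightarrow> nexp \<Rightarrow> expr" where
  "spanningE q M acc s = andE (notE (eqE (dtE q (tupleE q M acc s)) (numE 0)))
     (sall q (\<lambda>l. allE (ncandE q M) (\<lambda>t.
        leE (mulE (nrmE q M acc (tupleE q M acc s l))
               (absE (dotE q (cofE q (tupleE q M acc s) l) (candE q M acc t))))
            (mulE (nrmE q M acc (candE q M acc t)) (absE (dtE q (tupleE q M acc s)))))))"

lemma den_spanningE:
  assumes M: "nden inp w M m" and acc: "accden inp w acc P" and q: "q \<ge> 1" and s: "nden inp w z s"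
  shows "den inp w (spanningE q M acc z) (of_bool (spanning q m P s))"
  unfolding spanningE_def spanning_def
proof (intro den_andE den_notE den_sall den_allE den_leE den_arith den_absE
    den_eqE[where y = 0 and x = "dt q (tuple q m P s)"] den_dtE den_tupleE[OF M acc q s] den_numE nden_ncandE[OF M])
  fix w' u t l assume w': "w \<lesssim> w'" and u: "nden inp w' u t"
  have M': "nden inp w' M m" by (rule nden_mono[OF M w'])
  have acc': "accden inp w' acc P" by (rule accden_mono[OF acc w'])
  have tup: "den inp w' (tupleE q M acc z l c) (tuple q m P s l c)" for l c
    by (rule den_tupleE[OF M' acc' q nden_mono[OF s w']])
  have cnd: "den inp w' (candE q M acc u c) (cand q m P t c)" for c
    by (rule accdenD[OF accden_candE[OF M' acc' q] u])
  show "den inp w' (nrmE q M acc (tupleE q M acc z l)) (nrm q m P (tuple q m P s l))"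
    by (rule den_nrmE[OF M' acc' tup])
  show "den inp w' (nrmE q M acc (candE q M acc u)) (nrm q m P (cand q m P t))"
    by (rule den_nrmE[OF M' acc' cnd])
  show "den inp w' (dotE q (cofE q (tupleE q M acc z) l) (candE q M acc u))
      (dotp q (cof q (tuple q m P s) l) (cand q m P t))"
    by (intro den_dotE den_cofE tup cnd)
  show "den inp w' (tupleE q M acc z i c) (tuple q m P s i c)" for i c by (rule tup)
qed simp_all

text \<open>The position of the entry is known only at run time, while \<open>cofE\<close> takes
  constant indices. Summing over all \<open>q * q\<close> positions with an indicator bridges the
  two; \<open>pickE\<close> below does the same in one dimension.\<close>

definition sketchE :: "nat \<Rightarrow> nexp \<Rightarrow> access \<Rightarrow> nexp \<Rightarrow> nexp \<Rightarrow> expr" where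
  "sketchE q M acc l c = findE (npow (ncandE q M) q) (spanningE q M acc) (\<lambda>s.
     ssum q (\<lambda>l0. ssum q (\<lambda>c0. mulE (andE (eqE (natE l) (numE l0)) (eqE (natE c) (numE c0)))
       (divE (mulE (nrmE q M acc (tupleE q M acc s l0)) (cofE q (tupleE q M acc s) l0 c0))
          (dtE q (tupleE q M acc s))))))"

lemma den_sketchE:
  assumes M: "nden inp w M m" and acc: "accden inp w acc P" and q: "q \<ge> 1"
    and l: "nden inp w zl l" "l < q" and c: "nden inp w zc c" "c < q"
  shows "den inp w (sketchE q M acc zl zc) (sketch q m P l c)"
  unfolding sketchE_def
proof (rule den_findE[where p = "spanning q m P" and B = "ncand q m ^ q"])
  show "nden inp w (npow (ncandE q M) q) (ncand q m ^ q)" by (intro den_intro M)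
next
  fix w' z s assume w': "w \<lesssim> w'" and z: "nden inp w' z s"
  show "den inp w' (spanningE q M acc z) (of_bool (spanning q m P s))"
    by (rule den_spanningE[OF nden_mono[OF M w'] accden_mono[OF acc w'] q z])
next
  fix w' z assume w': "w \<lesssim> w'" and z: "nden inp w' z (sel (ncand q m ^ q) (spanning q m P))"
  have M': "nden inp w' M m" by (rule nden_mono[OF M w'])
  have acc': "accden inp w' acc P" by (rule accden_mono[OF acc w'])
  let ?s = "sel (ncand q m ^ q) (spanning q m P)"
  have tup: "den inp w' (tupleE q M acc z l c) (tuple q m P ?s l c)" for l c
    by (rule den_tupleE[OF M' acc' q z])
  let ?v = "\<lambda>l0 c0. nrm q m P (tuple q m P ?s l0) * cof q (tuple q m P ?s) l0 c0 / dt q (tuple q m P ?s)"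
  have "den inp w' (ssum q (\<lambda>l0. ssum q (\<lambda>c0. mulE (andE (eqE (natE zl) (numE l0)) (eqE (natE zc) (numE c0)))
       (divE (mulE (nrmE q M acc (tupleE q M acc z l0)) (cofE q (tupleE q M acc z) l0 c0))
          (dtE q (tupleE q M acc z))))))
      (\<Sum>l0<q. \<Sum>c0<q. of_bool (l = l0 \<and> c = c0) * ?v l0 c0)"
    by (intro den_ssum den_arith den_andE den_nrmE[OF M' acc'] den_cofE den_dtE tup
        den_nat_eqE nden_Num nden_mono[OF l(1) w'] nden_mono[OF c(1) w'])
  moreover have "(\<Sum>l0<q. \<Sum>c0<q. of_bool (l = l0 \<and> c = c0) * ?v l0 c0) = ?v l c"
  proof -
    have "(\<Sum>c0<q. of_bool (l = l0 \<and> c = c0) * ?v l0 c0) = (if l0 = l then ?v l c else 0)" for l0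
      using c(2) by (auto simp: of_bool_def if_distrib if_distribR cong: if_cong)
    then show ?thesis using l(2) by simp
  qed
  ultimately show "den inp w' (ssum q (\<lambda>l0. ssum q (\<lambda>c0. mulE (andE (eqE (natE zl) (numE l0)) (eqE (natE zc) (numE c0)))
       (divE (mulE (nrmE q M acc (tupleE q M acc z l0)) (cofE q (tupleE q M acc z) l0 c0))
          (dtE q (tupleE q M acc z)))))) (sketch q m P l c)"
    by (simp add: sketch_def Let_def)
qed

definition bestE :: "nat \<Rightarrow> nexp \<Rightarrow> access \<Rightarrow> nexp \<Rightarrow> expr" where
  "bestE q M acc t = andE (notE (eqE (candE q M acc t (q - 1)) (numE 0)))
     (allE (ncandE q M) (\<lambda>u.
        leE (mulE (nrmE q M acc (candE q M acc t)) (absE (candE q M acc u (q - 1))))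
            (mulE (nrmE q M acc (candE q M acc u)) (absE (candE q M acc t (q - 1))))))"

lemma den_bestE:
  assumes M: "nden inp w M m" and acc: "accden inp w acc P" and q: "q \<ge> 1" and t: "nden inp w z t"
  shows "den inp w (bestE q M acc z) (of_bool (best q m P t))"
  unfolding bestE_def best_def
proof (intro den_andE den_notE den_allE den_leE den_arith den_absE den_numE nden_ncandE[OF M]
    den_eqE[where y = 0 and x = "cand q m P t (q - 1)"] accdenD[OF accden_candE[OF M acc q] t])
  fix w' u v assume w': "w \<lesssim> w'" and u: "nden inp w' u v"
  have M': "nden inp w' M m" by (rule nden_mono[OF M w'])
  have acc': "accden inp w' acc P" by (rule accden_mono[OF acc w'])
  have cu: "den inp w' (candE q M acc u c) (cand q m P v c)" for c
    by (rule accdenD[OF accden_candE[OF M' acc' q] u])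
  have ct: "den inp w' (candE q M acc z c) (cand q m P t c)" for c
    by (rule accdenD[OF accden_candE[OF M' acc' q] nden_mono[OF t w']])
  show "den inp w' (nrmE q M acc (candE q M acc z)) (nrm q m P (cand q m P t))"
    by (rule den_nrmE[OF M' acc' ct])
  show "den inp w' (nrmE q M acc (candE q M acc u)) (nrm q m P (cand q m P v))"
    by (rule den_nrmE[OF M' acc' cu])
  show "den inp w' (candE q M acc u (q - 1)) (cand q m P v (q - 1))" by (rule cu)
  show "den inp w' (candE q M acc z (q - 1)) (cand q m P t (q - 1))" by (rule ct)
qed simp_all

definition fitE :: "nat \<Rightarrow> nexp \<Rightarrow> access \<Rightarrow> nat \<Rightarrow> expr" where
  "fitE q M acc c = findE (ncandE q M) (bestE q M acc)
     (\<lambda>t. divE (subE (numE 0) (candE q M acc t c)) (candE q M acc t (q - 1)))"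

lemma den_fitE:
  assumes M: "nden inp w M m" and acc: "accden inp w acc P" and q: "q \<ge> 1"
  shows "den inp w (fitE q M acc c) (fit_vec q m P c)"
  unfolding fitE_def
proof (rule den_findE[where p = "best q m P" and B = "ncand q m", OF nden_ncandE[OF M]])
  fix w' z s assume w': "w \<lesssim> w'" and z: "nden inp w' z s"
  show "den inp w' (bestE q M acc z) (of_bool (best q m P s))"
    by (rule den_bestE[OF nden_mono[OF M w'] accden_mono[OF acc w'] q z])
next
  fix w' z assume w': "w \<lesssim> w'" and z: "nden inp w' z (sel (ncand q m) (best q m P))"
  let ?t = "sel (ncand q m) (best q m P)"
  have c: "den inp w' (candE q M acc z c) (cand q m P ?t c)" for c
    by (rule accdenD[OF accden_candE[OF nden_mono[OF M w'] accden_mono[OF acc w'] q] z])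
  have "den inp w' (divE (subE (numE 0) (candE q M acc z c)) (candE q M acc z (q - 1)))
     ((real 0 - cand q m P ?t c) / cand q m P ?t (q - 1))"
    by (intro den_arith c den_numE refl)
  then show "den inp w' (divE (subE (numE 0) (candE q M acc z c)) (candE q M acc z (q - 1))) (fit_vec q m P c)"
    by (simp add: fit_vec_def Let_def)
qed

section \<open>Query and fit\<close>

definition colsel :: "real mat \<Rightarrow> nat \<Rightarrow> nat \<Rightarrow> nat \<Rightarrow> real" where
  "colsel A \<tau> i c = A $$ (i, dig (dim_col A) \<tau> c)"

text \<open>\<open>J + j * d ^ k\<close> codes the \<open>k\<close> columns coded by
  \<open>J\<close> followed by column \<open>j\<close>. The sum is thus the sketched cost of
  approximating every column by the \<open>k\<close> columns of \<open>J\<close>.\<close>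

definition tcost :: "nat \<Rightarrow> nat \<Rightarrow> nat \<Rightarrow> (nat \<Rightarrow> nat \<Rightarrow> nat \<Rightarrow> real) \<Rightarrow> nat \<Rightarrow> real" where
  "tcost k d m P J = (\<Sum>j<d. nrm (k + 1) m (P (J + j * d ^ k)) (fit_vec (k + 1) m (P (J + j * d ^ k))))"

definition choice :: "nat \<Rightarrow> nat \<Rightarrow> nat \<Rightarrow> (nat \<Rightarrow> nat \<Rightarrow> nat \<Rightarrow> real) \<Rightarrow> nat" where
  "choice k d m P = sel (d ^ k) (\<lambda>J. \<forall>J'<d ^ k. tcost k d m P J \<le> tcost k d m P J')"

definition right_factor :: "nat \<Rightarrow> nat \<Rightarrow> nat \<Rightarrow> (nat \<Rightarrow> nat \<Rightarrow> nat \<Rightarrow> real) \<Rightarrow> nat \<Rightarrow> nat \<Rightarrow> real" where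
  "right_factor k d m P l j = fit_vec (k + 1) m (P (choice k d m P + j * d ^ k)) l"

text \<open>Regression with rows and columns exchanged: the rows of \<open>V\<close> act as the
  available columns, and the row \<open>a\<close> as the target column.\<close>

definition fit_rows :: "nat \<Rightarrow> (nat \<Rightarrow> nat \<Rightarrow> real) \<Rightarrow> (nat \<Rightarrow> real) \<Rightarrow> nat \<Rightarrow> nat \<Rightarrow> real" where
  "fit_rows k V a j c = (if c < k then V c j else a j)"

definition left_factor :: "nat \<Rightarrow> nat \<Rightarrow> (nat \<Rightarrow> nat \<Rightarrow> real) \<Rightarrow> (nat \<Rightarrow> real) \<Rightarrow> nat \<Rightarrow> real" where
  "left_factor k d V a l = fit_vec (k + 1) d (fit_rows k V a) l"

definition sketches :: "nat \<Rightarrow> real mat \<Rightarrow> real \<Rightarrow> nat \<Rightarrow> (nat \<Rightarrow> nat \<Rightarrow> nat \<Rightarrow> real) \<Rightarrow> bool" where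
  "sketches k A D m P \<longleftrightarrow> (\<forall>\<tau><dim_col A ^ (k + 1). \<forall>x.
     nrm (k + 1) (dim_row A) (colsel A \<tau>) x \<le> nrm (k + 1) m (P \<tau>) x \<and>
     nrm (k + 1) m (P \<tau>) x \<le> D * nrm (k + 1) (dim_row A) (colsel A \<tau>) x)"

text \<open>Programs see matrices through \<open>rin\<close>, which agrees with the intended entries
  on the index range only.\<close>

lemma fit_vec_cong:
  assumes P: "\<And>i c. i < m \<Longrightarrow> c < q \<Longrightarrow> P i c = P' i c"
  shows "fit_vec q m P = fit_vec q m P'"
proof -
  have "cand q m P t = cand q m P' t" for t
    unfolding cand_def by (rule cof_cong) (simp add: ext_row_def P)
  then have c: "cand q m P = cand q m P'" by blast
  have "nrm q m P = nrm q m P'" by (rule ext, rule nrm_cong) (simp_all add: P)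
  then have "best q m P = best q m P'" by (simp add: best_def c fun_eq_iff)
  then show ?thesis by (intro ext) (simp only: fit_vec_def c)
qed

lemma dig_append:
  assumes "J < d ^ k" "j < d"
  shows "J + j * d ^ k < d ^ (k + 1)" and "dig d (J + j * d ^ k) k = j"
    and "c < k \<Longrightarrow> dig d (J + j * d ^ k) c = dig d J c"
proof -
  have "J + j * d ^ k < (1 + j) * d ^ k" using assms by simp
  also have "\<dots> \<le> d * d ^ k" using assms by (intro mult_right_mono) auto
  finally show "J + j * d ^ k < d ^ (k + 1)" by simp
  show "dig d (J + j * d ^ k) k = j" using assms by (simp add: dig_def)
  assume c: "c < k"
  have "d > 0" using assms by simp
  have "k = c + Suc (k - c - 1)" using c by simp
  then have "d ^ k = d ^ c * (d * d ^ (k - c - 1))" by (metis power_add power_Suc)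
  then have eq: "J + j * d ^ k = J + d ^ c * (d * (j * d ^ (k - c - 1)))" by simp
  have "(J + j * d ^ k) div d ^ c = J div d ^ c + d * (j * d ^ (k - c - 1))"
    unfolding eq using \<open>d > 0\<close> by simp
  then show "dig d (J + j * d ^ k) c = dig d J c" by (simp add: dig_def)
qed

lemma dotp_Suc: "dotp (k + 1) u v = (\<Sum>c<k. u c * v c) + u k * v k"
  by (simp add: dotp_def)

lemma choice_optimal:
  assumes d: "d \<ge> 1" and J: "J < d ^ k"
  shows "choice k d m P < d ^ k" and "tcost k d m P (choice k d m P) \<le> tcost k d m P J"
proof -
  let ?f = "tcost k d m P"
  have "Min (?f ` {..<d ^ k}) \<in> ?f ` {..<d ^ k}" using J by (intro Min_in) auto
  then obtain J0 where J0: "J0 < d ^ k" "?f J0 = Min (?f ` {..<d ^ k})" by auto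
  then have "\<forall>J'<d ^ k. ?f J0 \<le> ?f J'" by simp
  from sel_works[where p = "\<lambda>J. \<forall>J'<d ^ k. ?f J \<le> ?f J'", OF J0(1) this] J
  show "choice k d m P < d ^ k" and "?f (choice k d m P) \<le> ?f J"
    unfolding choice_def by blast+
qed

text \<open>The optimal row fits are at least as good as using the chosen columns of
  \<open>A\<close> as left factor. The cost of that is at most its sketched cost, which by choice is
  at most the sketched cost of the columns from \<open>column_subset_approx\<close>. As each
  regression is optimal, the latter is at most the sketched cost of their coefficients
  \<open>Z\<close>, and there the upper sketch bound contributes \<open>D\<close>.\<close>

lemma query_guarantee:
  assumes A: "A \<in> carrier_mat n d" and A': "A' \<in> carrier_mat n d"
    and rk: "vec_space.rank n A' \<le> k" and d: "d \<ge> 1"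
    and sk: "sketches k A D m P" and D: "D \<ge> 0"
    and V: "V = right_factor k d m P"
  shows "(\<Sum>i<n. \<Sum>j<d. \<bar>A $$ (i, j) - (\<Sum>l<k. left_factor k d V (\<lambda>j. A $$ (i, j)) l * V l j)\<bar>)
    \<le> D * real (k + 1) * l1_norm (A - A')"
proof -
  let ?q = "k + 1"
  define T where "T \<tau> x = nrm ?q n (colsel A \<tau>) x" for \<tau> x
  have dims: "dim_row A = n" "dim_col A = d" using A by auto
  have T: "T \<tau> x \<le> nrm ?q m (P \<tau>) x" "nrm ?q m (P \<tau>) x \<le> D * T \<tau> x" if "\<tau> < d ^ ?q" for \<tau> x
    using sk that unfolding sketches_def T_def dims by blast+
  obtain J Z where J: "\<forall>l<k. J l < d"
    "(\<Sum>j<d. \<Sum>i<n. \<bar>A $$ (i, j) - (\<Sum>l<k. A $$ (i, J l) * Z l j)\<bar>) \<le> real (k + 1) * l1_norm (A - A')"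
    using column_subset_approx[OF A A' rk d] by blast
  obtain J0 where J0: "J0 < d ^ k" "\<forall>l<k. dig d J0 l = J l"
    using digits_exist[of k J d] J(1) by auto
  define Js where "Js = choice k d m P"
  have Js: "Js < d ^ k" "tcost k d m P Js \<le> tcost k d m P J0"
    unfolding Js_def using choice_optimal[OF d J0(1)] by auto
  define x where "x j c = (if c < k then Z c j else -1)" for j c
  have xk: "x j (?q - 1) = -1" for j by (simp add: x_def)
  have "tcost k d m P J0 \<le> (\<Sum>j<d. D * (\<Sum>i<n. \<bar>A $$ (i, j) - (\<Sum>l<k. A $$ (i, J l) * Z l j)\<bar>))"
    unfolding tcost_def
  proof (rule sum_mono)
    fix j assume "j \<in> {..<d}"
    then have j: "j < d" by simp
    have "nrm ?q m (P (J0 + j * d ^ k)) (fit_vec ?q m (P (J0 + j * d ^ k))) \<le> nrm ?q m (P (J0 + j * d ^ k)) (x j)"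
      by (rule fit_vec_optimal(2)) (simp_all add: x_def)
    also have "\<dots> \<le> D * T (J0 + j * d ^ k) (x j)" by (rule T(2)[OF dig_append(1)[OF J0(1) j]])
    also have "T (J0 + j * d ^ k) (x j) = (\<Sum>i<n. \<bar>A $$ (i, j) - (\<Sum>l<k. A $$ (i, J l) * Z l j)\<bar>)"
      unfolding T_def nrm_def
    proof (rule sum.cong[OF refl])
      fix i
      have "(\<Sum>c<k. colsel A (J0 + j * d ^ k) i c * x j c) = (\<Sum>l<k. A $$ (i, J l) * Z l j)"
        using J0 j by (intro sum.cong) (auto simp: colsel_def dims x_def dig_append(3))
      moreover have "colsel A (J0 + j * d ^ k) i k * x j k = - A $$ (i, j)"
        using J0 j by (simp add: colsel_def dims x_def dig_append(2))
      ultimately show "\<bar>dotp ?q (colsel A (J0 + j * d ^ k) i) (x j)\<bar> = \<bar>A $$ (i, j) - (\<Sum>l<k. A $$ (i, J l) * Z l j)\<bar>"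
        unfolding dotp_Suc by simp
    qed
    finally show "nrm ?q m (P (J0 + j * d ^ k)) (fit_vec ?q m (P (J0 + j * d ^ k))) \<le>
      D * (\<Sum>i<n. \<bar>A $$ (i, j) - (\<Sum>l<k. A $$ (i, J l) * Z l j)\<bar>)" .
  qed
  also have "\<dots> \<le> D * (real (k + 1) * l1_norm (A - A'))"
    unfolding sum_distrib_left[symmetric] using J(2) D by (rule mult_left_mono)
  finally have upper: "tcost k d m P J0 \<le> D * real (k + 1) * l1_norm (A - A')" by (simp add: mult.assoc)
  have "(\<Sum>j<d. \<Sum>i<n. \<bar>A $$ (i, j) - (\<Sum>l<k. A $$ (i, dig d Js l) * V l j)\<bar>) \<le> tcost k d m P Js"
    unfolding tcost_def
  proof (rule sum_mono)
    fix j assume "j \<in> {..<d}"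
    then have j: "j < d" by simp
    let ?x = "fit_vec ?q m (P (Js + j * d ^ k))"
    have Vl: "V l j = ?x l" for l by (simp add: V right_factor_def Js_def)
    have xk: "?x k = -1" using fit_vec_optimal(1)[of ?q "\<lambda>_. -1" m "P (Js + j * d ^ k)"] by simp
    have "(\<Sum>i<n. \<bar>A $$ (i, j) - (\<Sum>l<k. A $$ (i, dig d Js l) * V l j)\<bar>) = T (Js + j * d ^ k) ?x"
      unfolding T_def nrm_def
    proof (rule sum.cong[OF refl])
      fix i
      have "(\<Sum>c<k. colsel A (Js + j * d ^ k) i c * ?x c) = (\<Sum>l<k. A $$ (i, dig d Js l) * V l j)"
        using Js j by (intro sum.cong) (auto simp: colsel_def dims Vl dig_append(3))
      moreover have "colsel A (Js + j * d ^ k) i k * ?x k = - A $$ (i, j)"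
        using Js j xk by (simp add: colsel_def dims dig_append(2))
      ultimately show "\<bar>A $$ (i, j) - (\<Sum>l<k. A $$ (i, dig d Js l) * V l j)\<bar> = \<bar>dotp ?q (colsel A (Js + j * d ^ k) i) ?x\<bar>"
        unfolding dotp_Suc by simp
    qed
    also have "\<dots> \<le> nrm ?q m (P (Js + j * d ^ k)) ?x" by (rule T(1)[OF dig_append(1)[OF Js(1) j]])
    finally show "(\<Sum>i<n. \<bar>A $$ (i, j) - (\<Sum>l<k. A $$ (i, dig d Js l) * V l j)\<bar>) \<le> nrm ?q m (P (Js + j * d ^ k)) ?x" .
  qed
  moreover have "(\<Sum>i<n. \<Sum>j<d. \<bar>A $$ (i, j) - (\<Sum>l<k. left_factor k d V (\<lambda>j. A $$ (i, j)) l * V l j)\<bar>) \<le>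
    (\<Sum>i<n. \<Sum>j<d. \<bar>A $$ (i, j) - (\<Sum>l<k. A $$ (i, dig d Js l) * V l j)\<bar>)"
  proof (rule sum_mono)
    fix i assume "i \<in> {..<n}"
    let ?a = "\<lambda>j. A $$ (i, j)"
    let ?u = "fit_vec ?q d (fit_rows k V ?a)"
    \<comment> \<open>The competitor for row \<open>i\<close>: its own entries in the chosen
      columns.\<close>
    define y where "y c = (if c < k then A $$ (i, dig d Js c) else -1)" for c
    have yk: "y (?q - 1) = -1" by (simp add: y_def)
    have uk: "?u k = -1" using fit_vec_optimal(1)[of ?q y d "fit_rows k V ?a"] yk by simp
    have gen: "nrm ?q d (fit_rows k V ?a) z = (\<Sum>j<d. \<bar>?a j - (\<Sum>l<k. z l * V l j)\<bar>)" if "z k = -1" for z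
      unfolding nrm_def dotp_Suc using that
      by (intro sum.cong refl) (simp add: fit_rows_def mult.commute abs_minus_commute)
    have "(\<Sum>j<d. \<bar>?a j - (\<Sum>l<k. left_factor k d V ?a l * V l j)\<bar>) = nrm ?q d (fit_rows k V ?a) ?u"
      unfolding gen[of ?u, OF uk] left_factor_def by simp
    also have "\<dots> \<le> nrm ?q d (fit_rows k V ?a) y" by (rule fit_vec_optimal(2)) (simp_all add: y_def)
    also have "\<dots> = (\<Sum>j<d. \<bar>?a j - (\<Sum>l<k. A $$ (i, dig d Js l) * V l j)\<bar>)"
      by (subst gen) (simp_all add: y_def)
    finally show "(\<Sum>j<d. \<bar>?a j - (\<Sum>l<k. left_factor k d V ?a l * V l j)\<bar>) \<le>
      (\<Sum>j<d. \<bar>?a j - (\<Sum>l<k. A $$ (i, dig d Js l) * V l j)\<bar>)" .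
  qed
  ultimately show ?thesis
    using upper Js(2) sum.swap[of "\<lambda>j i. \<bar>A $$ (i, j) - (\<Sum>l<k. A $$ (i, dig d Js l) * V l j)\<bar>" "{..<n}" "{..<d}"]
    by linarith
qed

lemma l1_lowrank_approxI:
  assumes A: "A \<in> carrier_mat n d" and B: "B \<in> carrier_mat n d" and rk: "vec_space.rank n B \<le> k"
    and C: "C > 0"
    and le: "\<And>A'. A' \<in> carrier_mat n d \<Longrightarrow> vec_space.rank n A' \<le> k \<Longrightarrow> l1_norm (A - B) \<le> C * l1_norm (A - A')"
  shows "l1_lowrank_approx k C A B"
proof -
  have dims: "dim_row A = n" "dim_col A = d" using A by auto
  let ?X = "{A' \<in> carrier_mat n d. vec_space.rank n A' \<le> k}"
  have "0\<^sub>m n d \<in> ?X" by (simp add: vec_space.rank_0I)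
  then have "?X \<noteq> {}" by blast
  then have "l1_norm (A - B) / C \<le> (INF A'\<in>?X. l1_norm (A - A'))"
    using le C by (intro cINF_greatest) (auto simp: divide_le_eq mult.commute)
  then have "l1_norm (A - B) \<le> C * l1_opt k A"
    using C by (simp add: l1_opt_def dims divide_le_eq mult.commute)
  then show ?thesis using B rk by (simp add: l1_lowrank_approx_def dims)
qed

text \<open>The branching factor that the programs compute for themselves: the \<open>L\<close>-th
  root of \<open>n\<close>, rounded up. For \<open>L \<ge> 1 / \<gamma>\<close> it is at most
  \<open>n powr \<gamma>\<close> rounded up, which the machine cannot evaluate directly.\<close>

definition root_of :: "nat \<Rightarrow> nat \<Rightarrow> nat" where
  "root_of L n = sel n (\<lambda>t. n \<le> t ^ L)"

definition root_prog :: "nat \<Rightarrow> nexp \<Rightarrow> expr \<Rightarrow> prog" where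
  "root_prog L sz F = out_prog (Reg 0) (leE (natE (Reg 0)) (natE (npow (Reg 2) L)) 3) sz (F 4)"

definition ctx2 :: "nat \<Rightarrow> nat \<Rightarrow> nat \<Rightarrow> ctx" where
  "ctx2 L n d = (3, (env0 n d)(2 := root_of L n))"

definition ctx3 :: "nat \<Rightarrow> nat \<Rightarrow> nat \<Rightarrow> nat \<Rightarrow> ctx" where
  "ctx3 L n d e = (4, (env0 n d)(2 := root_of L n, 3 := e))"

lemma ctx_nden [den_intro]:
  "nden inp (ctx2 L n d) (Reg 0) n" "nden inp (ctx2 L n d) (Reg 1) d"
  "nden inp (ctx2 L n d) (Reg 2) (root_of L n)"
  "nden inp (ctx3 L n d e) (Reg 0) n" "nden inp (ctx3 L n d e) (Reg 1) d"
  "nden inp (ctx3 L n d e) (Reg 2) (root_of L n)" "nden inp (ctx3 L n d e) (Reg 3) e"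
  by (simp_all add: nden_def ctx2_def ctx3_def env0_def)

text \<open>The interface between programs and mathematics: a denotation of the output entry at a
  general position yields \<open>computes\<close>, with a constant that depends on the program
  only.\<close>

definition computed_within :: "nat \<Rightarrow> nat \<Rightarrow> nexp \<Rightarrow> expr \<Rightarrow> bool" where
  "computed_within K L sz F \<longleftrightarrow> (\<forall>n d inp N S T size f.
     nden inp (ctx2 L n d) sz size \<longrightarrow> (\<forall>e. den inp (ctx3 L n d e) F (f e)) \<longrightarrow>
     2 \<le> N \<longrightarrow> n \<le> N \<longrightarrow> d \<le> N \<longrightarrow> inp_le N inp \<longrightarrow> K \<le> S \<longrightarrow> N ^ K \<le> T \<longrightarrow>
     sum_list (map length inp) \<le> S \<longrightarrow> size \<le> S \<longrightarrow>
     computes S T (root_prog L sz F) n d inp (map f [0..<size]))"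

lemma root_prog_computes: "\<exists>K. computed_within K L sz F"
proof -
  let ?C = "leE (natE (Reg 0)) (natE (npow (Reg 2) L))"
  obtain K where K: "\<forall>n d inp N S W m. wfn 2 (Reg 0) \<longrightarrow> wfr 3 (?C 3) \<longrightarrow> wfn 3 sz \<longrightarrow> wfr 4 (F 4) \<longrightarrow>
     2 \<le> N \<longrightarrow> n \<le> N \<longrightarrow> d \<le> N \<longrightarrow> inp_le N inp \<longrightarrow> K \<le> S \<longrightarrow> N ^ K \<le> W \<longrightarrow>
     m = sel (nv inp (env0 n d) (Reg 0)) (\<lambda>i. rv inp 3 ((env0 n d)(2 := i)) (?C 3) > 0) \<longrightarrow>
     runs S W inp (out_prog (Reg 0) (?C 3) sz (F 4)) (start n d) (N ^ K)
       (\<lambda>s'. emitted s' = map (\<lambda>i. rv inp 4 ((env0 n d)(2 := m, 3 := i)) (F 4))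
          [0..<nv inp ((env0 n d)(2 := m)) sz])"
    using out_prog_runs[of "Reg 0" "?C 3" sz "F 4"] by blast
  show ?thesis
    unfolding computed_within_def
  proof (intro exI[of _ "Suc K"] allI impI)
    fix n d inp N S T size f
    assume sz: "nden inp (ctx2 L n d) sz size" and F: "\<forall>e. den inp (ctx3 L n d e) F (f e)"
      and N: "2 \<le> N" "n \<le> N" "d \<le> N" "inp_le N inp" and S: "Suc K \<le> S" and T: "N ^ Suc K \<le> T"
      and len: "sum_list (map length inp) \<le> S" "size \<le> S"
    have C: "den inp (3, (env0 n d)(2 := i)) ?C (of_bool (n \<le> i ^ L))" for i
    proof -
      have "nden inp (3, (env0 n d)(2 := i)) (Reg 0) n" "nden inp (3, (env0 n d)(2 := i)) (Reg 2) i"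
        by (simp_all add: nden_def env0_def)
      then have "den inp (3, (env0 n d)(2 := i)) ?C (of_bool (real n \<le> real (i ^ L)))"
        by (intro den_leE den_natE nden_npow)
      then show ?thesis by (simp only: of_nat_le_iff)
    qed
    have C': "wfr 3 (?C 3)" "rv inp 3 ((env0 n d)(2 := i)) (?C 3) = of_bool (n \<le> i ^ L)" for i
      using C[of i] unfolding den_def by (metis fst_conv snd_conv le_ctx_refl)+
    have F': "wfr 4 (F 4)" "rv inp 4 ((env0 n d)(2 := root_of L n, 3 := e)) (F 4) = f e" for e
      using F unfolding den_def ctx3_def by (metis fst_conv snd_conv le_ctx_refl)+
    have sz': "wfn 3 sz" "nv inp ((env0 n d)(2 := root_of L n)) sz = size"
      using sz by (auto simp: nden_def ctx2_def)
    have NK: "N ^ K \<le> N ^ Suc K" "N \<le> N ^ Suc K" using N(1) by (auto intro: self_le_power)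
    have r: "root_of L n = sel (nv inp (env0 n d) (Reg 0)) (\<lambda>i. rv inp 3 ((env0 n d)(2 := i)) (?C 3) > 0)"
      unfolding C' root_of_def by (simp add: env0_def)
    have "N ^ K \<le> T" using NK T by linarith
    then have "runs S T inp (out_prog (Reg 0) (?C 3) sz (F 4)) (start n d) (N ^ K)
       (\<lambda>s'. emitted s' = map (\<lambda>i. rv inp 4 ((env0 n d)(2 := root_of L n, 3 := i)) (F 4))
          [0..<nv inp ((env0 n d)(2 := root_of L n)) sz])"
      using K C'(1) sz'(1) F'(1) N S r by auto
    then obtain t s' where "t \<le> N ^ K" "exec S T inp (root_prog L sz F) (start n d) t s'"
      "emitted s' = map f [0..<size]"
      unfolding runs_def root_prog_def F'(2) sz'(2) by blast
    then show "computes S T (root_prog L sz F) n d inp (map f [0..<size])"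
    proof -
      have "n \<le> T" "d \<le> T" using NK T N(2,3) by linarith+
      moreover have "t \<le> T" using \<open>t \<le> N ^ K\<close> \<open>N ^ K \<le> T\<close> by linarith
      ultimately show ?thesis
        using len \<open>exec S T inp (root_prog L sz F) (start n d) t s'\<close> \<open>emitted s' = map f [0..<size]\<close>
        unfolding computes_def by auto
    qed
  qed
qed

section \<open>Expressions for the query and the row fits\<close>

definition accTden :: "real list list \<Rightarrow> ctx \<Rightarrow> (nexp \<Rightarrow> access) \<Rightarrow>
    (nat \<Rightarrow> nat \<Rightarrow> nat \<Rightarrow> real) \<Rightarrow> bool" where
  "accTden inp w accT P \<longleftrightarrow> (\<forall>w' z t. w \<lesssim> w' \<longrightarrow> nden inp w' z t \<longrightarrow> accden inp w' (accT z) (P t))"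

lemma accTden_mono: "accTden inp w accT P \<Longrightarrow> w \<lesssim> w' \<Longrightarrow> accTden inp w' accT P"
  unfolding accTden_def by (blast intro: le_ctx_trans)

lemma accTdenD: "accTden inp w accT P \<Longrightarrow> nden inp w z t \<Longrightarrow> accden inp w (accT z) (P t)"
  unfolding accTden_def using le_ctx_refl by blast

definition tupE :: "nat \<Rightarrow> nexp \<Rightarrow> nexp \<Rightarrow> nexp" where
  "tupE k J j = NPlus J (NTimes j (npow (Reg 1) k))"

definition tcostE :: "nat \<Rightarrow> nexp \<Rightarrow> (nexp \<Rightarrow> access) \<Rightarrow> nexp \<Rightarrow> expr" where
  "tcostE k M accT J = sumE (Reg 1) (\<lambda>j. nrmE (k + 1) M (accT (tupE k J j)) (fitE (k + 1) M (accT (tupE k J j))))"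

definition pickE :: "nat \<Rightarrow> nexp \<Rightarrow> (nat \<Rightarrow> expr) \<Rightarrow> expr" where
  "pickE k l f = ssum k (\<lambda>i. mulE (eqE (natE l) (numE i)) (f i))"

text \<open>The entry of the right factor in row \<open>e div d\<close> and column
  \<open>e mod d\<close>, for output position \<open>e\<close>. The best tuple is searched anew for
  every entry: this costs a polynomial factor in time but keeps the memory constant.\<close>

definition queryE :: "nat \<Rightarrow> nexp \<Rightarrow> (nexp \<Rightarrow> access) \<Rightarrow> expr" where
  "queryE k M accT = letdiv (Reg 3) (Reg 1) (\<lambda>l.
     findE (npow (Reg 1) k) (\<lambda>J. allE (npow (Reg 1) k) (\<lambda>J'. leE (tcostE k M accT J) (tcostE k M accT J')))
       (\<lambda>J. pickE k l (fitE (k + 1) M (accT (tupE k J (NMinus (Reg 3) (NTimes l (Reg 1))))))))"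

lemma den_tcostE:
  assumes M: "nden inp w M m" and acc: "accTden inp w accT P" and d: "nden inp w (Reg 1) d"
    and J: "nden inp w z J"
  shows "den inp w (tcostE k M accT z) (tcost k d m P J)"
  unfolding tcostE_def tcost_def
proof (rule den_sumE[OF d])
  fix w' u j assume w': "w \<lesssim> w'" and u: "nden inp w' u j"
  have M': "nden inp w' M m" by (rule nden_mono[OF M w'])
  have "nden inp w' (tupE k z u) (J + j * d ^ k)"
    unfolding tupE_def by (intro den_intro u nden_mono[OF J w'] nden_mono[OF d w'])
  then have a: "accden inp w' (accT (tupE k z u)) (P (J + j * d ^ k))"
    by (rule accTdenD[OF accTden_mono[OF acc w']])
  show "den inp w' (nrmE (k + 1) M (accT (tupE k z u)) (fitE (k + 1) M (accT (tupE k z u))))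
     (nrm (k + 1) m (P (J + j * d ^ k)) (fit_vec (k + 1) m (P (J + j * d ^ k))))"
    by (intro den_nrmE[OF M' a] den_fitE[OF M' a]) simp
qed

lemma den_pickE:
  assumes l: "nden inp w z l" and f: "\<And>i. den inp w (f i) (v i)"
  shows "den inp w (pickE k z f) (if l < k then v l else 0)"
proof -
  have "den inp w (pickE k z f) (\<Sum>i<k. of_bool (l = i) * v i)"
    unfolding pickE_def by (intro den_ssum den_arith den_nat_eqE l f nden_Num)
  moreover have "(\<Sum>i<k. of_bool (l = i) * v i) = (if l < k then v l else 0)"
    by (auto simp: of_bool_def if_distrib if_distribR cong: if_cong)
  ultimately show ?thesis by simp
qed

lemma den_queryE:
  assumes M: "nden inp (ctx3 L n d e) M m" and acc: "accTden inp (ctx3 L n d e) accT P" and d: "d \<ge> 1"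
  shows "den inp (ctx3 L n d e) (queryE k M accT)
    (if e div d < k then right_factor k d m P (e div d) (e mod d) else 0)"
  unfolding queryE_def
proof (rule den_letdiv[OF ctx_nden(7) ctx_nden(5)])
  fix w1 zl assume w1: "ctx3 L n d e \<lesssim> w1" and zl: "nden inp w1 zl (e div d)"
  have d1: "nden inp w1 (Reg 1) d" by (rule nden_mono[OF ctx_nden(5) w1])
  let ?p = "\<lambda>J. \<forall>J'<d ^ k. tcost k d m P J \<le> tcost k d m P J'"
  show "den inp w1 (findE (npow (Reg 1) k) (\<lambda>J. allE (npow (Reg 1) k) (\<lambda>J'. leE (tcostE k M accT J) (tcostE k M accT J')))
       (\<lambda>J. pickE k zl (fitE (k + 1) M (accT (tupE k J (NMinus (Reg 3) (NTimes zl (Reg 1))))))))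
      (if e div d < k then right_factor k d m P (e div d) (e mod d) else 0)"
  proof (rule den_findE[where p = ?p, OF nden_npow[OF d1]])
    fix w2 z J assume w2: "w1 \<lesssim> w2" and z: "nden inp w2 z J"
    have d2: "nden inp w2 (Reg 1) d" by (rule nden_mono[OF d1 w2])
    show "den inp w2 (allE (npow (Reg 1) k) (\<lambda>J'. leE (tcostE k M accT z) (tcostE k M accT J'))) (of_bool (?p J))"
    proof (rule den_allE[OF nden_npow[OF d2]])
      fix w3 u J' assume w3: "w2 \<lesssim> w3" and u: "nden inp w3 u J'"
      have le: "ctx3 L n d e \<lesssim> w3" using w1 w2 w3 le_ctx_trans by blast
      have z': "nden inp w3 z J" by (rule nden_mono[OF z w3])
      show "den inp w3 (leE (tcostE k M accT z) (tcostE k M accT u)) (of_bool (tcost k d m P J \<le> tcost k d m P J'))"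
        by (intro den_leE den_tcostE nden_mono[OF M le] accTden_mono[OF acc le] nden_mono[OF d2 w3] z' u)
    qed
  next
    fix w2 z assume w2: "w1 \<lesssim> w2" and z: "nden inp w2 z (sel (d ^ k) ?p)"
    have le: "ctx3 L n d e \<lesssim> w2" using w1 w2 le_ctx_trans by blast
    have zl2: "nden inp w2 zl (e div d)" by (rule nden_mono[OF zl w2])
    have "nden inp w2 (tupE k z (NMinus (Reg 3) (NTimes zl (Reg 1)))) (sel (d ^ k) ?p + (e - e div d * d) * d ^ k)"
      unfolding tupE_def
      by (intro nden_NPlus nden_NMinus nden_NTimes nden_npow z zl2 nden_mono[OF ctx_nden(5) le] nden_mono[OF ctx_nden(7) le])
    then have "nden inp w2 (tupE k z (NMinus (Reg 3) (NTimes zl (Reg 1)))) (choice k d m P + e mod d * d ^ k)"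
      by (simp add: choice_def minus_div_mult_eq_mod)
    then have a: "accden inp w2 (accT (tupE k z (NMinus (Reg 3) (NTimes zl (Reg 1)))))
        (P (choice k d m P + e mod d * d ^ k))"
      by (rule accTdenD[OF accTden_mono[OF acc le]])
    show "den inp w2 (pickE k zl (fitE (k + 1) M (accT (tupE k z (NMinus (Reg 3) (NTimes zl (Reg 1)))))))
      (if e div d < k then right_factor k d m P (e div d) (e mod d) else 0)"
      unfolding right_factor_def by (intro den_pickE zl2 den_fitE[OF nden_mono[OF M le] a]) simp
  qed
qed (use d in simp)

definition fit_accE :: "nat \<Rightarrow> nexp \<Rightarrow> nat \<Rightarrow> expr" where
  "fit_accE k z c = (if c < k then inE (Num 0) (NPlus (NTimes (Num c) (Reg 1)) z) else inE (Num 1) z)"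

definition row_fitE :: "nat \<Rightarrow> expr" where
  "row_fitE k = pickE k (Reg 3) (fitE (k + 1) (Reg 1) (fit_accE k))"

lemma den_row_fitE:
  shows "den [v, a] (ctx3 L n d e) (row_fitE k)
    (if e < k then left_factor k d (\<lambda>l j. rin [v, a] 0 (l * d + j)) (\<lambda>j. rin [v, a] 1 j) e else 0)"
proof -
  have "accden [v, a] (ctx3 L n d e) (fit_accE k)
      (fit_rows k (\<lambda>l j. rin [v, a] 0 (l * d + j)) (\<lambda>j. rin [v, a] 1 j))"
  proof (rule accdenI)
    fix w' z i c assume w': "ctx3 L n d e \<lesssim> w'" and z: "nden [v, a] w' z i"
    show "den [v, a] w' (fit_accE k z c)
       (fit_rows k (\<lambda>l j. rin [v, a] 0 (l * d + j)) (\<lambda>j. rin [v, a] 1 j) i c)"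
    proof (cases "c < k")
      case True
      have "den [v, a] w' (inE (Num 0) (NPlus (NTimes (Num c) (Reg 1)) z)) (rin [v, a] 0 (c * d + i))"
        by (intro den_inE nden_NPlus nden_NTimes nden_Num z nden_mono[OF ctx_nden(5) w'])
      then show ?thesis using True by (simp only: fit_accE_def fit_rows_def if_True)
    next
      case False
      have "den [v, a] w' (inE (Num 1) z) (rin [v, a] 1 i)" by (intro den_inE nden_Num z)
      then show ?thesis using False by (simp only: fit_accE_def fit_rows_def if_False)
    qed
  qed
  from den_fitE[OF ctx_nden(5) this] show ?thesis
    unfolding row_fitE_def left_factor_def by (intro den_pickE ctx_nden(7)) simp
qed

definition query_prog :: "nat \<Rightarrow> nat \<Rightarrow> nexp \<Rightarrow> (nexp \<Rightarrow> access) \<Rightarrow> prog" where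
  "query_prog k L M accT = root_prog L (NTimes (Num k) (Reg 1)) (queryE k M accT)"

definition fit_prog :: "nat \<Rightarrow> nat \<Rightarrow> prog" where
  "fit_prog k L = root_prog L (Num k) (row_fitE k)"

definition answered_within :: "nat \<Rightarrow> nat \<Rightarrow> nat \<Rightarrow> nexp \<Rightarrow> (nexp \<Rightarrow> access) \<Rightarrow> bool" where
  "answered_within K k L M accT \<longleftrightarrow> (\<forall>n d A s m P D N S T. A \<in> carrier_mat n d \<longrightarrow> d \<ge> 1 \<longrightarrow>
     (\<forall>e. nden [s] (ctx3 L n d e) M m) \<longrightarrow> (\<forall>e. accTden [s] (ctx3 L n d e) accT P) \<longrightarrow>
     sketches k A D m P \<longrightarrow> D > 0 \<longrightarrow>
     2 \<le> N \<longrightarrow> n \<le> N \<longrightarrow> d \<le> N \<longrightarrow> length s \<le> N \<longrightarrow> k * d \<le> N \<longrightarrow> K \<le> S \<longrightarrow> N ^ K \<le> T \<longrightarrow>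
     length s \<le> S \<longrightarrow> k * d + d \<le> S \<longrightarrow>
     (\<exists>B. answers S T (query_prog k L M accT) (fit_prog k L) k A s B \<and> l1_lowrank_approx k (D * real (k + 1)) A B))"

text \<open>The summary enters only through \<open>sketches\<close>, so this one correctness
  statement serves both models; they differ in the access function \<open>accT\<close>
  alone.\<close>

lemma answers_exist: "\<exists>K. answered_within K k L M accT"
proof -
  let ?qry = "query_prog k L M accT" and ?fit = "fit_prog k L"
  obtain Kq where "computed_within Kq L (NTimes (Num k) (Reg 1)) (queryE k M accT)"
    using root_prog_computes by blast
  note Kq = this[unfolded computed_within_def, folded query_prog_def]
  obtain Kf where "computed_within Kf L (Num k) (row_fitE k)"
    using root_prog_computes by blast
  note Kf = this[unfolded computed_within_def, folded fit_prog_def]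
  show ?thesis
    unfolding answered_within_def
  proof (intro exI[of _ "Kq + Kf + 2"] allI impI)
    fix n d A s m P D N S T
    assume A: "A \<in> carrier_mat n d" and d: "d \<ge> 1"
      and M: "\<forall>e. nden [s] (ctx3 L n d e) M m" and acc: "\<forall>e. accTden [s] (ctx3 L n d e) accT P"
      and sk: "sketches k A D m P" and D: "D > 0"
      and N: "2 \<le> N" "n \<le> N" "d \<le> N" "length s \<le> N" "k * d \<le> N"
      and S: "Kq + Kf + 2 \<le> S" "length s \<le> S" "k * d + d \<le> S" and T: "N ^ (Kq + Kf + 2) \<le> T"
    have dims: "dim_row A = n" "dim_col A = d" using A by auto
    have T': "N ^ Kq \<le> T" "N ^ Kf \<le> T"
      using N(1) T power_increasing[of Kq "Kq + Kf + 2" N] power_increasing[of Kf "Kq + Kf + 2" N] by linarith+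
    define V where "V = right_factor k d m P"
    define fv where "fv e = (if e div d < k then V (e div d) (e mod d) else 0)" for e
    define v where "v = map fv [0..<k * d]"
    have lv: "length v = k * d" by (simp add: v_def)
    have idx: "l * d + j < k * d" if "l < k" "j < d" for l j
    proof -
      have "l * d + j < (l + 1) * d" using that by simp
      also have "\<dots> \<le> k * d" using that by (intro mult_right_mono) auto
      finally show ?thesis .
    qed
    have vV: "v ! (l * d + j) = V l j" if "l < k" "j < d" for l j
      using that idx[OF that] by (simp add: v_def fv_def)
    have "\<forall>e. den [s] (ctx3 L n d e) (queryE k M accT) (fv e)"
      unfolding fv_def V_def using den_queryE[OF M[rule_format] acc[rule_format] d] by blast
    moreover have "nden [s] (ctx2 L n d) (NTimes (Num k) (Reg 1)) (k * d)" by (intro den_intro)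
    ultimately have q: "computes S T ?qry n d [s] v"
      unfolding v_def using Kq N S T' by (auto simp: inp_le_def)
    define a where "a i = mat_row A i" for i
    have la: "length (a i) = d" if "i < n" for i using A that by (simp add: a_def)
    have ai: "a i ! j = A $$ (i, j)" if "i < n" "j < d" for i j
      using A that by (simp add: a_def list_of_vec_index)
    let ?U = "\<lambda>i l. left_factor k d V (\<lambda>j. A $$ (i, j)) l"
    define us where "us = map (\<lambda>i. map (\<lambda>l. ?U i l) [0..<k]) [0..<n]"
    have f: "computes S T ?fit n d [v, a i] (us ! i)" if i: "i < n" for i
    proof -
      let ?f = "\<lambda>e. if e < k then left_factor k d (\<lambda>l j. rin [v, a i] 0 (l * d + j)) (\<lambda>j. rin [v, a i] 1 j) e else 0"
      have "\<forall>e. den [v, a i] (ctx3 L n d e) (row_fitE k) (?f e)" using den_row_fitE by blast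
      moreover have "nden [v, a i] (ctx2 L n d) (Num k) k" by (rule nden_Num)
      moreover have "k \<le> S" using S(3) mult_le_mono2[OF d, of k] by linarith
      ultimately have "computes S T ?fit n d [v, a i] (map ?f [0..<k])"
        using Kf N S T' la[OF i] lv by (auto simp: inp_le_def)
      moreover have "map ?f [0..<k] = us ! i"
      proof -
        have "fit_vec (k + 1) d (fit_rows k (\<lambda>l j. rin [v, a i] 0 (l * d + j)) (\<lambda>j. rin [v, a i] 1 j)) =
            fit_vec (k + 1) d (fit_rows k V (\<lambda>j. A $$ (i, j)))"
          using la[OF i] ai[OF i] vV idx lv
          by (intro fit_vec_cong) (auto simp: fit_rows_def rin_def)
        then show ?thesis using i by (simp add: us_def left_factor_def)
      qed
      ultimately show ?thesis by simp
    qed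
    define B where "B = mat_of_rows_list k us * mat k d (\<lambda>(l, j). v ! (l * d + j))"
    have Bc: "B \<in> carrier_mat n d" unfolding B_def by (intro mult_carrier_mat[of _ n k]) (simp_all add: us_def mat_of_rows_list_def)
    have Bij: "B $$ (i, j) = (\<Sum>l<k. ?U i l * V l j)" if "i < n" "j < d" for i j
    proof -
      have "B $$ (i, j) = (\<Sum>l<k. us ! i ! l * v ! (l * d + j))"
        using that by (auto simp: B_def mat_of_rows_list_def scalar_prod_def us_def atLeast0LessThan intro!: sum.cong)
      also have "\<dots> = (\<Sum>l<k. ?U i l * V l j)"
        using that by (intro sum.cong) (auto simp: us_def vV)
      finally show ?thesis .
    qed
    have "answers S T ?qry ?fit k A s B"
      unfolding answers_def dims using q f lv
      by (intro exI[of _ v] exI[of _ us]) (auto simp: B_def us_def a_def)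
    moreover have "l1_lowrank_approx k (D * real (k + 1)) A B"
    proof (rule l1_lowrank_approxI[OF A Bc])
      show "vec_space.rank n B \<le> k" by (rule rank_factored[OF Bc Bij])
      show "D * real (k + 1) > 0" using D by simp
      fix A' :: "real mat" assume "A' \<in> carrier_mat n d" "vec_space.rank n A' \<le> k"
      from query_guarantee[OF A this d sk less_imp_le[OF D] V_def]
      show "l1_norm (A - B) \<le> D * real (k + 1) * l1_norm (A - A')"
        using A Bc Bij by (simp add: l1_norm_def)
    qed
    ultimately show "\<exists>B. answers S T ?qry ?fit k A s B \<and> l1_lowrank_approx k (D * real (k + 1)) A B" by blast
  qed
qed

section \<open>Distributed summaries\<close>

definition slot :: "nat \<Rightarrow> real list \<Rightarrow> nat \<Rightarrow> nat \<Rightarrow> nat \<Rightarrow> nat \<Rightarrow> real" where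
  "slot q s off \<tau> l c = rin [s] 0 (off + ((\<tau> * q + l) * q + c))"

definition summary_size :: "nat \<Rightarrow> nat \<Rightarrow> nat" where
  "summary_size q d = d ^ q * q * q"

definition summary_sizeE :: "nat \<Rightarrow> nexp" where
  "summary_sizeE q = NTimes (NTimes (npow (Reg 1) q) (Num q)) (Num q)"

definition entry :: "nat \<Rightarrow> nat \<Rightarrow> (nat \<Rightarrow> nat \<Rightarrow> nat \<Rightarrow> real) \<Rightarrow> nat \<Rightarrow> real" where
  "entry q m P e = sketch q m (P (e div q div q)) (e div q mod q) (e mod q)"

definition entryE :: "nat \<Rightarrow> nexp \<Rightarrow> (nexp \<Rightarrow> access) \<Rightarrow> nexp \<Rightarrow> expr" where
  "entryE q M accT e = letdiv e (Num q) (\<lambda>u. letdiv u (Num q) (\<lambda>t.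
     sketchE q M (accT t) (NMinus u (NTimes t (Num q))) (NMinus e (NTimes u (Num q)))))"

lemma nden_summary_sizeE: "nden inp w (Reg 1) d \<Longrightarrow> nden inp w (summary_sizeE q) (summary_size q d)"
  unfolding summary_sizeE_def summary_size_def by (intro den_intro)

lemma nden_mod:
  assumes "nden inp w x i" "nden inp w u (i div q)"
  shows "nden inp w (NMinus x (NTimes u (Num q))) (i mod q)"
proof -
  have "nden inp w (NMinus x (NTimes u (Num q))) (i - i div q * q)"
    by (intro nden_NMinus nden_NTimes nden_Num assms)
  then show ?thesis by (simp add: minus_div_mult_eq_mod)
qed

lemma den_entryE:
  assumes M: "nden inp w M m" and acc: "accTden inp w accT P" and q: "q \<ge> 1" and e: "nden inp w z e"
  shows "den inp w (entryE q M accT z) (entry q m P e)"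
  unfolding entryE_def entry_def
proof (rule den_letdiv[OF e nden_Num])
  fix w1 u assume w1: "w \<lesssim> w1" and u: "nden inp w1 u (e div q)"
  show "den inp w1 (letdiv u (Num q) (\<lambda>t. sketchE q M (accT t) (NMinus u (NTimes t (Num q))) (NMinus z (NTimes u (Num q)))))
     (sketch q m (P (e div q div q)) (e div q mod q) (e mod q))"
  proof (rule den_letdiv[OF u nden_Num])
    fix w2 t assume w2: "w1 \<lesssim> w2" and t: "nden inp w2 t (e div q div q)"
    have le: "w \<lesssim> w2" using w1 w2 by (rule le_ctx_trans)
    have u2: "nden inp w2 u (e div q)" by (rule nden_mono[OF u w2])
    show "den inp w2 (sketchE q M (accT t) (NMinus u (NTimes t (Num q))) (NMinus z (NTimes u (Num q))))
       (sketch q m (P (e div q div q)) (e div q mod q) (e mod q))"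
      by (intro den_sketchE nden_mono[OF M le] accTdenD[OF accTden_mono[OF acc le]] t q
          nden_mod[OF u2 t] nden_mod[OF nden_mono[OF e le] u2]) (use q in auto)
  qed (use q in simp)
qed (use q in simp)

lemma entry_index_less:
  assumes "\<tau> < d ^ q" "l < q" "c < q"
  shows "(\<tau> * q + l) * q + c < summary_size q d"
proof -
  have "\<tau> * q + l < (\<tau> + 1) * q" using assms by simp
  also have "\<dots> \<le> d ^ q * q" using assms by (intro mult_right_mono) auto
  finally have "\<tau> * q + l + 1 \<le> d ^ q * q" by simp
  then have "(\<tau> * q + l + 1) * q \<le> d ^ q * q * q" by (rule mult_right_mono) simp
  then show ?thesis using assms by (simp add: summary_size_def)
qed

lemma entry_index: "l < q \<Longrightarrow> c < q \<Longrightarrow> entry q m P ((\<tau> * q + l) * q + c) = sketch q m (P \<tau>) l c"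
  by (simp add: entry_def)

lemma slot_entries:
  assumes "\<tau> < d ^ q" "l < q" "c < q"
  shows "slot q (map (entry q m P) [0..<summary_size q d]) 0 \<tau> l c = sketch q m (P \<tau>) l c"
  using entry_index_less[OF assms] entry_index[OF assms(2,3)] by (simp add: slot_def rin_def)

definition true_norm :: "nat \<Rightarrow> real mat \<Rightarrow> nat \<Rightarrow> nat list \<Rightarrow> (nat \<Rightarrow> real) \<Rightarrow> real" where
  "true_norm q A \<tau> I x = (\<Sum>i\<leftarrow>I. \<bar>dotp q (colsel A \<tau> i) x\<bar>)"

definition summarizes :: "nat \<Rightarrow> real mat \<Rightarrow> nat list \<Rightarrow> nat \<Rightarrow> real list \<Rightarrow> bool" where
  "summarizes q A I h s \<longleftrightarrow> length s = summary_size q (dim_col A) \<and>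
     (\<forall>\<tau><dim_col A ^ q. \<forall>x. true_norm q A \<tau> I x \<le> nrm q q (slot q s 0 \<tau>) x \<and>
        nrm q q (slot q s 0 \<tau>) x \<le> real q ^ h * true_norm q A \<tau> I x)"

lemma true_norm_nonneg: "true_norm q A \<tau> I x \<ge> 0"
  unfolding true_norm_def by (induction I) auto

lemma true_norm_concat: "true_norm q A \<tau> (concat Is) x = (\<Sum>I\<leftarrow>Is. true_norm q A \<tau> I x)"
  unfolding true_norm_def by (induction Is) auto

text \<open>Sketching once more preserves the lower bound without loss and costs a factor
  \<open>q\<close> in the upper one, hence the successor in the exponent.\<close>

lemma summarizes_entries:
  assumes q: "q \<ge> 1"
    and P: "\<And>\<tau> x. \<tau> < dim_col A ^ q \<Longrightarrow> true_norm q A \<tau> I x \<le> nrm q m (P \<tau>) x"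
      "\<And>\<tau> x. \<tau> < dim_col A ^ q \<Longrightarrow> nrm q m (P \<tau>) x \<le> real q ^ h * true_norm q A \<tau> I x"
  shows "summarizes q A I (Suc h) (map (entry q m P) [0..<summary_size q (dim_col A)])"
  unfolding summarizes_def
proof (intro conjI allI impI)
  fix \<tau> x assume \<tau>: "\<tau> < dim_col A ^ q"
  let ?s = "map (entry q m P) [0..<summary_size q (dim_col A)]"
  have eq: "nrm q q (slot q ?s 0 \<tau>) x = nrm q q (sketch q m (P \<tau>)) x"
    by (rule nrm_cong) (simp_all add: slot_entries[OF \<tau>])
  show "true_norm q A \<tau> I x \<le> nrm q q (slot q ?s 0 \<tau>) x"
    unfolding eq using P(1)[OF \<tau>] sketch_bounds(1)[OF q] by (rule order_trans)
  have "nrm q q (slot q ?s 0 \<tau>) x \<le> real q * nrm q m (P \<tau>) x"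
    unfolding eq by (rule sketch_bounds(2)[OF q])
  also have "\<dots> \<le> real q * (real q ^ h * true_norm q A \<tau> I x)"
    using P(2)[OF \<tau>] by (intro mult_left_mono) auto
  finally show "nrm q q (slot q ?s 0 \<tau>) x \<le> real q ^ Suc h * true_norm q A \<tau> I x"
    by (simp add: mult.assoc)
qed simp

lemma summarizes_mono:
  assumes "summarizes q A I h s" "h \<le> h'" "q \<ge> 1"
  shows "summarizes q A I h' s"
  unfolding summarizes_def
proof (intro conjI allI impI)
  fix \<tau> x assume \<tau>: "\<tau> < dim_col A ^ q"
  show "true_norm q A \<tau> I x \<le> nrm q q (slot q s 0 \<tau>) x" using assms(1) \<tau> by (simp add: summarizes_def)
  have "nrm q q (slot q s 0 \<tau>) x \<le> real q ^ h * true_norm q A \<tau> I x"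
    using assms(1) \<tau> by (simp add: summarizes_def)
  also have "\<dots> \<le> real q ^ h' * true_norm q A \<tau> I x"
    using assms(2,3) by (intro mult_right_mono power_increasing true_norm_nonneg) auto
  finally show "nrm q q (slot q s 0 \<tau>) x \<le> real q ^ h' * true_norm q A \<tau> I x" .
qed (use assms(1) in \<open>simp add: summarizes_def\<close>)

definition leaf_accE :: "nexp \<Rightarrow> nexp \<Rightarrow> nat \<Rightarrow> expr" where
  "leaf_accE t z c = letdig (Reg 1) c t (\<lambda>v. inE z v)"

definition leaf_rows :: "real list list \<Rightarrow> nat \<Rightarrow> nat \<Rightarrow> nat \<Rightarrow> nat \<Rightarrow> real" where
  "leaf_rows inp d \<tau> i c = rin inp i (dig d \<tau> c)"

definition merge_accE :: "nat \<Rightarrow> nexp \<Rightarrow> nexp \<Rightarrow> nat \<Rightarrow> expr" where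
  "merge_accE q t z c = letdiv z (Num q) (\<lambda>u.
     inE u (NPlus (NTimes (NPlus (NTimes t (Num q)) (NMinus z (NTimes u (Num q)))) (Num q)) (Num c)))"

definition merge_rows :: "nat \<Rightarrow> real list list \<Rightarrow> nat \<Rightarrow> nat \<Rightarrow> nat \<Rightarrow> real" where
  "merge_rows q inp \<tau> i c = rin inp (i div q) ((\<tau> * q + i mod q) * q + c)"

lemma accTdenI:
  "(\<And>w' zt t z i c. w \<lesssim> w' \<Longrightarrow> nden inp w' zt t \<Longrightarrow> nden inp w' z i \<Longrightarrow> den inp w' (accT zt z c) (P t i c)) \<Longrightarrow>
   accTden inp w accT P"
  unfolding accTden_def by (intro allI impI accdenI) (metis le_ctx_trans nden_mono)

lemma accTden_leaf:
  assumes "nden inp w (Reg 1) d" "d \<ge> 1"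
  shows "accTden inp w leaf_accE (leaf_rows inp d)"
proof (rule accTdenI)
  fix w' zt t z i c assume w': "w \<lesssim> w'" and t: "nden inp w' zt t" and z: "nden inp w' z i"
  show "den inp w' (leaf_accE zt z c) (leaf_rows inp d t i c)"
    unfolding leaf_accE_def leaf_rows_def
    by (rule den_letdig[OF t nden_mono[OF assms(1) w']], use assms(2) in simp, intro den_inE nden_mono[OF z])
qed

lemma accTden_merge:
  assumes q: "q \<ge> 1"
  shows "accTden inp w (merge_accE q) (merge_rows q inp)"
proof (rule accTdenI)
  fix w' zt t z i c assume w': "w \<lesssim> w'" and t: "nden inp w' zt t" and z: "nden inp w' z i"
  show "den inp w' (merge_accE q zt z c) (merge_rows q inp t i c)"
    unfolding merge_accE_def merge_rows_def
  proof (rule den_letdiv[OF z nden_Num])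
    fix w2 u assume w2: "w' \<lesssim> w2" and u: "nden inp w2 u (i div q)"
    show "den inp w2 (inE u (NPlus (NTimes (NPlus (NTimes zt (Num q)) (NMinus z (NTimes u (Num q)))) (Num q)) (Num c)))
       (rin inp (i div q) ((t * q + i mod q) * q + c))"
      by (intro den_inE nden_NPlus nden_NTimes nden_Num u nden_mono[OF t w2] nden_mod[OF nden_mono[OF z w2] u])
  qed (use q in simp)
qed

definition leaf_prog :: "nat \<Rightarrow> nat \<Rightarrow> prog" where
  "leaf_prog q L = root_prog L (summary_sizeE q) (entryE q InCount leaf_accE (Reg 3))"

definition merge_prog :: "nat \<Rightarrow> nat \<Rightarrow> prog" where
  "merge_prog q L = root_prog L (summary_sizeE q)
     (entryE q (NTimes InCount (Num q)) (merge_accE q) (Reg 3))"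

definition store_accE :: "nat \<Rightarrow> nexp \<Rightarrow> nexp \<Rightarrow> nexp \<Rightarrow> nexp \<Rightarrow> nat \<Rightarrow> expr" where
  "store_accE q off stride t z c = letdiv z (Num q) (\<lambda>u.
     inE (Num 0) (NPlus (NPlus off (NTimes u stride))
       (NPlus (NTimes (NPlus (NTimes t (Num q)) (NMinus z (NTimes u (Num q)))) (Num q)) (Num c))))"

text \<open>Equally spaced sketches read as one stacked matrix. With a stride of \<open>H\<close>
  summaries these are the slots of one level, with a stride of one summary all slots of the store;
  in the distributed model only the first block is read.\<close>

definition store_rows :: "nat \<Rightarrow> real list \<Rightarrow> nat \<Rightarrow> nat \<Rightarrow> nat \<Rightarrow> nat \<Rightarrow> nat \<Rightarrow> real" where
  "store_rows q s off stride \<tau> i c = slot q s (off + i div q * stride) \<tau> (i mod q) c"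

lemma rin_Cons0: "rin (s # ss) 0 j = rin [s] 0 j"
  by (simp add: rin_def)

lemma accTden_store:
  assumes q: "q \<ge> 1" and str: "nden (s # ss) w zs stride" and off: "nden (s # ss) w zo off"
  shows "accTden (s # ss) w (store_accE q zo zs) (store_rows q s off stride)"
proof (rule accTdenI)
  fix w' zt t z i c assume w': "w \<lesssim> w'" and t: "nden (s # ss) w' zt t" and z: "nden (s # ss) w' z i"
  show "den (s # ss) w' (store_accE q zo zs zt z c) (store_rows q s off stride t i c)"
    unfolding store_accE_def store_rows_def slot_def
  proof (rule den_letdiv[OF z nden_Num])
    fix w2 u assume w2: "w' \<lesssim> w2" and u: "nden (s # ss) w2 u (i div q)"
    have le: "w \<lesssim> w2" using w' w2 by (rule le_ctx_trans)
    have "den (s # ss) w2 (inE (Num 0) (NPlus (NPlus zo (NTimes u zs))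
       (NPlus (NTimes (NPlus (NTimes zt (Num q)) (NMinus z (NTimes u (Num q)))) (Num q)) (Num c))))
       (rin (s # ss) 0 ((off + i div q * stride) + ((t * q + i mod q) * q + c)))"
      by (intro den_inE nden_NPlus nden_NTimes nden_Num u nden_mono[OF t w2] nden_mod[OF nden_mono[OF z w2] u]
          nden_mono[OF off le] nden_mono[OF str le])
    then show "den (s # ss) w2 (inE (Num 0) (NPlus (NPlus zo (NTimes u zs))
       (NPlus (NTimes (NPlus (NTimes zt (Num q)) (NMinus z (NTimes u (Num q)))) (Num q)) (Num c))))
       (rin [s] 0 ((off + i div q * stride) + ((t * q + i mod q) * q + c)))"
      by (simp only: rin_Cons0[of s ss])
  qed (use q in simp)
qed

lemma sum_split_add: "(\<Sum>i<a + b. f i) = (\<Sum>i<a. f i) + (\<Sum>l<b. f (a + l :: nat) :: real)"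
  by (induction b) auto

text \<open>The reason why sketches can be merged: the l1 norm of a stack is the sum of the norms of
  its blocks, so two-sided bounds on the blocks add up.\<close>

lemma nrm_blocks: "nrm q (m * q) (\<lambda>i. R (i div q) (i mod q)) x = (\<Sum>u<m. nrm q q (R u) x)"
proof (induction m)
  case 0
  then show ?case by (simp add: nrm_def)
next
  case (Suc m)
  have "nrm q (Suc m * q) (\<lambda>i. R (i div q) (i mod q)) x =
      (\<Sum>i<m * q + q. \<bar>dotp q (R (i div q) (i mod q)) x\<bar>)"
    by (simp add: nrm_def add.commute)
  also have "\<dots> = (\<Sum>i<m * q. \<bar>dotp q (R (i div q) (i mod q)) x\<bar>) +
      (\<Sum>l<q. \<bar>dotp q (R ((m * q + l) div q) ((m * q + l) mod q)) x\<bar>)"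
    by (rule sum_split_add)
  finally show ?case using Suc.IH by (simp add: nrm_def)
qed

lemma sum_list_lengths_le: "(\<And>x. x \<in> set xs \<Longrightarrow> length x \<le> b) \<Longrightarrow> sum_list (map length xs) \<le> length xs * b"
  by (induction xs) (auto intro: add_mono)

text \<open>\<open>G\<close> bounds the rows at a leaf as well as the children of a node, and a row
  is no longer than a summary; hence \<open>G * summary_size q d\<close> bounds the input of every
  node. Leaves are sketched too, which makes the exponent \<open>Suc (height t)\<close>.\<close>

lemma distributed_summary:
  assumes q: "q \<ge> 1"
  shows "\<exists>K. \<forall>n d A S T N G. A \<in> carrier_mat n d \<longrightarrow> d \<ge> 1 \<longrightarrow>
     2 \<le> N \<longrightarrow> n \<le> N \<longrightarrow> d \<le> N \<longrightarrow> G \<le> N \<longrightarrow> summary_size q d \<le> N \<longrightarrow>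
     K \<le> S \<longrightarrow> N ^ K \<le> T \<longrightarrow> G * summary_size q d \<le> S \<longrightarrow> G \<ge> 1 \<longrightarrow>
     (\<forall>t. (\<forall>I\<in>set (blocks t). length I \<le> G \<and> set I \<subseteq> {..<n}) \<longrightarrow> fan_in_le G t \<longrightarrow>
       (\<exists>s. summarized S T (leaf_prog q L) (merge_prog q L) A t s \<and>
          summarizes q A (concat (blocks t)) (Suc (height t)) s))"
proof -
  obtain Kl where "computed_within Kl L (summary_sizeE q) (entryE q InCount leaf_accE (Reg 3))"
    using root_prog_computes by blast
  note Kl = this[unfolded computed_within_def, folded leaf_prog_def]
  obtain Km where "computed_within Km L (summary_sizeE q) (entryE q (NTimes InCount (Num q)) (merge_accE q) (Reg 3))"
    using root_prog_computes by blast
  note Km = this[unfolded computed_within_def, folded merge_prog_def]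
  show ?thesis
  proof (rule exI[of _ "Kl + Km"], (rule allI | rule impI)+)
    fix n d :: nat and A :: "real mat" and S T N G :: nat and t
    assume A: "A \<in> carrier_mat n d" and d: "d \<ge> 1"
      and N: "2 \<le> N" "n \<le> N" "d \<le> N" "G \<le> N" "summary_size q d \<le> N"
      and S: "Kl + Km \<le> S" "G * summary_size q d \<le> S" and T: "N ^ (Kl + Km) \<le> T" and G: "G \<ge> 1"
      and t: "\<forall>I\<in>set (blocks t). length I \<le> G \<and> set I \<subseteq> {..<n}" "fan_in_le G t"
    have dims: "dim_row A = n" "dim_col A = d" using A by auto
    have T': "N ^ Kl \<le> T" "N ^ Km \<le> T"
      using N(1) T power_increasing[of Kl "Kl + Km" N] power_increasing[of Km "Kl + Km" N] by linarith+
    have dD: "d \<le> summary_size q d"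
    proof -
      have "d ^ 1 \<le> d ^ q" using d q by (intro power_increasing) auto
      also have "\<dots> \<le> d ^ q * (q * q)" using q by simp
      finally show ?thesis by (simp add: summary_size_def mult.assoc)
    qed
    have DS: "summary_size q d \<le> S" using S(2) G by (metis le_trans mult_le_mono1 nat_mult_1)
    have size: "nden inp (ctx2 L n d) (summary_sizeE q) (summary_size q d)" for inp
      by (rule nden_summary_sizeE[OF ctx_nden(2)])
    show "\<exists>s. summarized S T (leaf_prog q L) (merge_prog q L) A t s \<and>
          summarizes q A (concat (blocks t)) (Suc (height t)) s"
      using t
    proof (induction t)
      case (Leaf I)
      define inp where "inp = map (mat_row A) I"
      have I: "length I \<le> G" "\<And>i. i \<in> set I \<Longrightarrow> i < n" using Leaf by auto
      have len: "length x \<le> d" if "x \<in> set inp" for x using that A by (auto simp: inp_def)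
      have "sum_list (map length inp) \<le> length inp * d" by (rule sum_list_lengths_le[OF len])
      also have "\<dots> \<le> G * summary_size q d" using I(1) dD by (intro mult_mono) (auto simp: inp_def)
      also note S(2)
      finally have sumS: "sum_list (map length inp) \<le> S" .
      have "inp_le N inp" using len N I(1) by (force simp: inp_le_def inp_def)
      moreover have "\<forall>e. den inp (ctx3 L n d e) (entryE q InCount leaf_accE (Reg 3))
          (entry q (length inp) (leaf_rows inp d) e)"
        using den_entryE[OF nden_InCount accTden_leaf[OF ctx_nden(5) d] q ctx_nden(7)] by blast
      ultimately have "computes S T (leaf_prog q L) n d inp
          (map (entry q (length inp) (leaf_rows inp d)) [0..<summary_size q d])"
        using Kl[rule_format, OF size _ N(1-3) _ _ T'(1) sumS DS] S(1) by auto
      moreover have eq: "nrm q (length inp) (leaf_rows inp d \<tau>) x = true_norm q A \<tau> I x"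
        if "\<tau> < d ^ q" for \<tau> x
      proof -
        have "nrm q (length inp) (leaf_rows inp d \<tau>) x = (\<Sum>i<length I. \<bar>dotp q (colsel A \<tau> (I ! i)) x\<bar>)"
          unfolding nrm_def
        proof (rule sum.cong)
          fix i assume "i \<in> {..<length I}"
          then have i: "i < length I" "I ! i < n" using I(2) by auto
          have "leaf_rows inp d \<tau> i c = colsel A \<tau> (I ! i) c" for c
            using i A d by (simp add: leaf_rows_def rin_def inp_def colsel_def dig_less list_of_vec_index)
          then show "\<bar>dotp q (leaf_rows inp d \<tau> i) x\<bar> = \<bar>dotp q (colsel A \<tau> (I ! i)) x\<bar>"
            by (simp add: dotp_def)
        qed (simp add: inp_def)
        then show ?thesis
          unfolding true_norm_def by (simp add: sum_list_sum_nth atLeast0LessThan)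
      qed
      have "summarizes q A I (Suc 0) (map (entry q (length inp) (leaf_rows inp d)) [0..<summary_size q (dim_col A)])"
        by (rule summarizes_entries[OF q]) (simp_all add: dims eq)
      ultimately show ?case
        by (intro exI[of _ "map (entry q (length inp) (leaf_rows inp d)) [0..<summary_size q d]"])
          (auto simp: dims inp_def intro!: summarized.intros(1))
    next
      case (Node ts)
      have "\<forall>t\<in>set ts. \<exists>s. summarized S T (leaf_prog q L) (merge_prog q L) A t s \<and>
          summarizes q A (concat (blocks t)) (Suc (height t)) s"
        using Node by auto
      then obtain g where g: "\<And>t. t \<in> set ts \<Longrightarrow> summarized S T (leaf_prog q L) (merge_prog q L) A t (g t)"
        "\<And>t. t \<in> set ts \<Longrightarrow> summarizes q A (concat (blocks t)) (Suc (height t)) (g t)"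
        by (auto dest!: bchoice)
      define inp where "inp = map g ts"
      have fan: "length ts \<le> G" using Node.prems(2) by simp
      have len: "length x = summary_size q d" if "x \<in> set inp" for x
        using that g(2) by (auto simp: inp_def summarizes_def dims)
      have "sum_list (map length inp) \<le> length inp * summary_size q d"
        by (rule sum_list_lengths_le) (simp add: len)
      also have "\<dots> \<le> G * summary_size q d" using fan by (intro mult_right_mono) (auto simp: inp_def)
      also note S(2)
      finally have sumS: "sum_list (map length inp) \<le> S" .
      have "inp_le N inp" using len N fan by (force simp: inp_le_def inp_def)
      moreover have "\<forall>e. den inp (ctx3 L n d e) (entryE q (NTimes InCount (Num q)) (merge_accE q) (Reg 3))
          (entry q (length inp * q) (merge_rows q inp) e)"
        using den_entryE[OF nden_NTimes[OF nden_InCount nden_Num] accTden_merge[OF q] q ctx_nden(7)] by blast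
      ultimately have comp: "computes S T (merge_prog q L) n d inp
          (map (entry q (length inp * q) (merge_rows q inp)) [0..<summary_size q d])"
        using Km[rule_format, OF size _ N(1-3) _ _ T'(2) sumS DS] S(1) by auto
      \<comment> \<open>The subtrees may differ in height; \<open>summarizes_mono\<close> raises all
        their exponents to the common \<open>h\<close> before the bounds are added.\<close>
      define h where "h = height (Node ts)"
      have ht: "Suc (height t) \<le> h" if "t \<in> set ts" for t
      proof -
        have "\<forall>t\<in>set ts. height t \<le> foldr max (map height ts) 0"
          by (induction ts) (auto simp: le_max_iff_disj)
        then show ?thesis using that by (simp add: h_def)
      qed
      have nrm: "nrm q (length inp * q) (merge_rows q inp \<tau>) x = (\<Sum>t\<leftarrow>ts. nrm q q (slot q (g t) 0 \<tau>) x)" for \<tau> x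
      proof -
        have "nrm q (length inp * q) (merge_rows q inp \<tau>) x =
          nrm q (length inp * q) (\<lambda>i. (\<lambda>u l c. rin inp u ((\<tau> * q + l) * q + c)) (i div q) (i mod q)) x"
          by (rule nrm_cong) (simp_all add: merge_rows_def)
        also have "\<dots> = (\<Sum>u<length inp. nrm q q (\<lambda>l c. rin inp u ((\<tau> * q + l) * q + c)) x)"
          by (rule nrm_blocks)
        also have "\<dots> = (\<Sum>u<length ts. nrm q q (slot q (g (ts ! u)) 0 \<tau>) x)"
          by (rule sum.cong) (auto simp: inp_def slot_def rin_def intro!: nrm_cong)
        finally show ?thesis by (simp add: sum_list_sum_nth atLeast0LessThan)
      qed
      have concat: "concat (blocks (Node ts)) = concat (map (\<lambda>t. concat (blocks t)) ts)"
        by (induction ts) auto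
      have tn: "true_norm q A \<tau> (concat (blocks (Node ts))) x =
          (\<Sum>t\<leftarrow>ts. true_norm q A \<tau> (concat (blocks t)) x)" for \<tau> x
        unfolding concat by (subst true_norm_concat) (simp add: o_def)
      have "summarizes q A (concat (blocks (Node ts))) (Suc h)
         (map (entry q (length inp * q) (merge_rows q inp)) [0..<summary_size q (dim_col A)])"
      proof (rule summarizes_entries[OF q])
        fix \<tau> x assume \<tau>: "\<tau> < dim_col A ^ q"
        have b: "true_norm q A \<tau> (concat (blocks t)) x \<le> nrm q q (slot q (g t) 0 \<tau>) x \<and>
          nrm q q (slot q (g t) 0 \<tau>) x \<le> real q ^ h * true_norm q A \<tau> (concat (blocks t)) x" if "t \<in> set ts" for t
          using summarizes_mono[OF g(2)[OF that] ht[OF that] q] \<tau> by (auto simp: summarizes_def)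
        show "true_norm q A \<tau> (concat (blocks (Node ts))) x \<le> nrm q (length inp * q) (merge_rows q inp \<tau>) x"
          unfolding tn nrm using b by (intro sum_list_mono) auto
        show "nrm q (length inp * q) (merge_rows q inp \<tau>) x \<le>
            real q ^ h * true_norm q A \<tau> (concat (blocks (Node ts))) x"
          unfolding tn nrm sum_list_const_mult[symmetric] using b by (intro sum_list_mono) auto
      qed
      moreover have "list_all2 (summarized S T (leaf_prog q L) (merge_prog q L) A) ts inp"
        unfolding inp_def using g(1) by (simp add: list_all2_conv_all_nth)
      ultimately show ?case
        using comp unfolding h_def
        by (intro exI[of _ "map (entry q (length inp * q) (merge_rows q inp)) [0..<summary_size q d]"])
          (auto simp: dims intro!: summarized.intros(2))
    qed
  qed
qed

section \<open>The streaming store\<close>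

text \<open>
  The state consists of the number of summaries on each of the \<open>H\<close> levels, followed by \<open>b\<close> slots per
  level; slot \<open>t\<close> of level \<open>l\<close> has index \<open>t * H + l\<close> and unused slots are 0. Each update empties all full
  levels at once, each into the next one, and puts the new row on level 0.
\<close>

definition cnt :: "real list \<Rightarrow> nat \<Rightarrow> real" where
  "cnt s l = rin [s] 0 l"

definition base :: "nat \<Rightarrow> real list \<Rightarrow> nat \<Rightarrow> real" where
  "base b s l = (if \<not> cnt s l < real b then 0 else cnt s l)"

definition incoming :: "nat \<Rightarrow> real list \<Rightarrow> nat \<Rightarrow> bool" where
  "incoming b s l \<longleftrightarrow> l = 0 \<or> \<not> cnt s (l - 1) < real b"

text \<open>A single row is stored as the matrix with this row on top and zeros below. It has the
  exact seminorm of the row, so level 0 has distortion 1.\<close>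

definition raw_entry :: "nat \<Rightarrow> nat \<Rightarrow> real list \<Rightarrow> nat \<Rightarrow> real" where
  "raw_entry q d a w = (if w div q mod q = 0 then if w mod q < q then rin [[], a] 1 (dig d (w div q div q) (w mod q)) else 0 else 0)"

definition level_rows :: "nat \<Rightarrow> nat \<Rightarrow> nat \<Rightarrow> real list \<Rightarrow> nat \<Rightarrow> nat \<Rightarrow> nat \<Rightarrow> nat \<Rightarrow> real" where
  "level_rows q H d s l = store_rows q s (H + l * summary_size q d) (H * summary_size q d)"

text \<open>A carry is computed from the old state \<open>s\<close>, so that consecutive full levels
  can all be emptied in the same update.\<close>

definition item :: "nat \<Rightarrow> nat \<Rightarrow> nat \<Rightarrow> nat \<Rightarrow> real list \<Rightarrow> real list \<Rightarrow> nat \<Rightarrow> nat \<Rightarrow> real" where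
  "item q H d b s a l w =
     (if l = 0 then raw_entry q d a w else entry q (b * q) (level_rows q H d s (l - 1)) w)"

text \<open>Counts are stored as reals and cannot be turned into indices. Instead of writing to the
  position given by the count, every slot compares its own number \<open>t\<close> with the
  count.\<close>

definition new_slot :: "nat \<Rightarrow> nat \<Rightarrow> nat \<Rightarrow> nat \<Rightarrow> real list \<Rightarrow> real list \<Rightarrow> nat \<Rightarrow> nat \<Rightarrow> nat \<Rightarrow> nat \<Rightarrow> real" where
  "new_slot q H d b s a t l w e =
     (if incoming b s l \<and> real t = base b s l then item q H d b s a l w
      else if \<not> cnt s l < real b then 0 else rin [s] 0 e)"

definition new_entry :: "nat \<Rightarrow> nat \<Rightarrow> nat \<Rightarrow> nat \<Rightarrow> real list \<Rightarrow> real list \<Rightarrow> nat \<Rightarrow> real" where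
  "new_entry q H d b s a e =
     (if e < H then base b s e + of_bool (incoming b s e)
      else (let u = (e - H) div summary_size q d in
        new_slot q H d b s a (u div H) (u mod H) ((e - H) mod summary_size q d) e))"

definition cntE :: "nexp \<Rightarrow> expr" where "cntE z = inE (Num 0) z"
definition fullE :: "nexp \<Rightarrow> expr" where "fullE z = notE (lessE (cntE z) (natE (Reg 2)))"
definition baseE :: "nexp \<Rightarrow> expr" where "baseE z = ifE (fullE z) (numE 0) (cntE z)"
definition incomingE :: "nexp \<Rightarrow> expr" where
  "incomingE z = ifE (eqE (natE z) (numE 0)) (numE 1) (fullE (NMinus z (Num 1)))"

definition rawE :: "nat \<Rightarrow> nexp \<Rightarrow> expr" where
  "rawE q w = letdiv w (Num q) (\<lambda>u. letdiv u (Num q) (\<lambda>t.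
     ifE (eqE (natE (NMinus u (NTimes t (Num q)))) (numE 0))
       (pickE q (NMinus w (NTimes u (Num q))) (\<lambda>c. letdig (Reg 1) c t (\<lambda>v. inE (Num 1) v))) (numE 0)))"

definition itemE :: "nat \<Rightarrow> nat \<Rightarrow> nexp \<Rightarrow> nexp \<Rightarrow> expr" where
  "itemE q H l w = ifE (eqE (natE l) (numE 0)) (rawE q w)
     (entryE q (NTimes (Reg 2) (Num q))
        (store_accE q (NPlus (Num H) (NTimes (NMinus l (Num 1)) (summary_sizeE q))) (NTimes (Num H) (summary_sizeE q))) w)"

definition slotE :: "nat \<Rightarrow> nat \<Rightarrow> expr" where
  "slotE q H = letdiv (NMinus (Reg 3) (Num H)) (summary_sizeE q) (\<lambda>u. letdiv u (Num H) (\<lambda>t.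
     let l = NMinus u (NTimes t (Num H)); w = NMinus (NMinus (Reg 3) (Num H)) (NTimes u (summary_sizeE q))
     in ifE (andE (incomingE l) (eqE (natE t) (baseE l))) (itemE q H l w)
          (ifE (fullE l) (numE 0) (inE (Num 0) (Reg 3)))))"

definition updE :: "nat \<Rightarrow> nat \<Rightarrow> expr" where
  "updE q H = ifE (lessE (natE (Reg 3)) (numE H)) (addE (baseE (Reg 3)) (incomingE (Reg 3))) (slotE q H)"

context
  fixes s a :: "real list" and b :: nat and w :: ctx
  assumes b: "nden [s, a] w (Reg 2) b"
begin

lemma den_cntE: "nden [s, a] w z l \<Longrightarrow> den [s, a] w (cntE z) (cnt s l)"
  unfolding cntE_def cnt_def rin_Cons0[of s "[a]", symmetric] by (intro den_inE nden_Num)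

lemma den_fullE: "nden [s, a] w z l \<Longrightarrow> den [s, a] w (fullE z) (of_bool (\<not> cnt s l < real b))"
  unfolding fullE_def by (intro den_notE den_lessE den_cntE den_natE b)

lemma den_baseE: "nden [s, a] w z l \<Longrightarrow> den [s, a] w (baseE z) (base b s l)"
  unfolding baseE_def base_def by (intro den_ifE den_fullE den_cntE den_numE) simp_all

lemma den_incomingE:
  assumes z: "nden [s, a] w z l"
  shows "den [s, a] w (incomingE z) (of_bool (incoming b s l))"
proof -
  have "den [s, a] w (incomingE z) (if l = 0 then 1 else of_bool (\<not> cnt s (l - 1) < real b))"
    unfolding incomingE_def
    by (intro den_ifE den_nat_eqE den_fullE den_numE nden_NMinus nden_Num z) simp_all
  then show ?thesis by (rule den_cong) (simp add: incoming_def)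
qed

end

lemma den_rawE:
  assumes d: "nden [s, a] w (Reg 1) d" "d \<ge> 1" and q: "q \<ge> 1" and z: "nden [s, a] w z e"
  shows "den [s, a] w (rawE q z) (raw_entry q d a e)"
  unfolding rawE_def raw_entry_def
proof (rule den_letdiv[OF z nden_Num])
  fix w1 u assume w1: "w \<lesssim> w1" and u: "nden [s, a] w1 u (e div q)"
  show "den [s, a] w1 (letdiv u (Num q) (\<lambda>t.
     ifE (eqE (natE (NMinus u (NTimes t (Num q)))) (numE 0))
       (pickE q (NMinus z (NTimes u (Num q))) (\<lambda>c. letdig (Reg 1) c t (\<lambda>v. inE (Num 1) v))) (numE 0)))
     (if e div q mod q = 0 then if e mod q < q then rin [[], a] 1 (dig d (e div q div q) (e mod q)) else 0 else 0)"
  proof (rule den_letdiv[OF u nden_Num])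
    fix w2 t assume w2: "w1 \<lesssim> w2" and t: "nden [s, a] w2 t (e div q div q)"
    have le: "w \<lesssim> w2" using w1 w2 by (rule le_ctx_trans)
    have u2: "nden [s, a] w2 u (e div q)" by (rule nden_mono[OF u w2])
    have z2: "nden [s, a] w2 z e" by (rule nden_mono[OF z le])
    have r: "rin [[], a] 1 j = rin [s, a] 1 j" for j by (simp add: rin_def)
    have dg: "den [s, a] w2 (letdig (Reg 1) c t (\<lambda>v. inE (Num 1) v)) (rin [[], a] 1 (dig d (e div q div q) c))" for c
      unfolding r by (rule den_letdig[OF t nden_mono[OF d(1) le]], use d(2) in simp, intro den_inE nden_Num)
    show "den [s, a] w2 (ifE (eqE (natE (NMinus u (NTimes t (Num q)))) (numE 0))
       (pickE q (NMinus z (NTimes u (Num q))) (\<lambda>c. letdig (Reg 1) c t (\<lambda>v. inE (Num 1) v))) (numE 0))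
      (if e div q mod q = 0 then if e mod q < q then rin [[], a] 1 (dig d (e div q div q) (e mod q)) else 0 else 0)"
      by (intro den_ifE den_nat_eqE den_pickE nden_mod[OF u2 t] nden_mod[OF z2 u2] nden_Num dg den_numE) simp
  qed (use q in simp)
qed (use q in simp)

lemma den_updE:
  assumes d: "d \<ge> 1" and q: "q \<ge> 1" and H: "H \<ge> 1"
  shows "den [s, a] (ctx3 L n d e) (updE q H) (new_entry q H d (root_of L n) s a e)"
proof -
  let ?w = "ctx3 L n d e"
  let ?b = "root_of L n"
  let ?D = "summary_size q d"
  have D: "?D > 0" using d q by (simp add: summary_size_def)
  have slot: "den [s, a] ?w (slotE q H) (new_slot q H d ?b s a ((e - H) div ?D div H) ((e - H) div ?D mod H) ((e - H) mod ?D) e)"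
    unfolding slotE_def
  proof (rule den_letdiv[OF nden_NMinus[OF ctx_nden(7) nden_Num] nden_summary_sizeE[OF ctx_nden(5)] D])
    fix w1 u assume w1: "?w \<lesssim> w1" and u: "nden [s, a] w1 u ((e - H) div ?D)"
    show "den [s, a] w1 (letdiv u (Num H) (\<lambda>t.
       let l = NMinus u (NTimes t (Num H)); w = NMinus (NMinus (Reg 3) (Num H)) (NTimes u (summary_sizeE q))
       in ifE (andE (incomingE l) (eqE (natE t) (baseE l))) (itemE q H l w)
            (ifE (fullE l) (numE 0) (inE (Num 0) (Reg 3)))))
       (new_slot q H d ?b s a ((e - H) div ?D div H) ((e - H) div ?D mod H) ((e - H) mod ?D) e)"
    proof (rule den_letdiv[OF u nden_Num])
      fix w2 t assume w2: "w1 \<lesssim> w2" and t: "nden [s, a] w2 t ((e - H) div ?D div H)"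
      have le: "?w \<lesssim> w2" using w1 w2 by (rule le_ctx_trans)
      have u2: "nden [s, a] w2 u ((e - H) div ?D)" by (rule nden_mono[OF u w2])
      have b2: "nden [s, a] w2 (Reg 2) ?b" by (rule nden_mono[OF ctx_nden(6) le])
      have d2: "nden [s, a] w2 (Reg 1) d" by (rule nden_mono[OF ctx_nden(5) le])
      have e2: "nden [s, a] w2 (Reg 3) e" by (rule nden_mono[OF ctx_nden(7) le])
      define zl where "zl = NMinus u (NTimes t (Num H))"
      define zw where "zw = NMinus (NMinus (Reg 3) (Num H)) (NTimes u (summary_sizeE q))"
      define l where "l = (e - H) div ?D mod H"
      have l: "nden [s, a] w2 zl l" unfolding zl_def l_def by (rule nden_mod[OF u2 t])
      have "nden [s, a] w2 zw ((e - H) - (e - H) div ?D * ?D)"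
        unfolding zw_def by (intro nden_NMinus nden_NTimes e2 nden_Num u2 nden_summary_sizeE[OF d2])
      then have w: "nden [s, a] w2 zw ((e - H) mod ?D)" by (simp add: minus_div_mult_eq_mod)
      have "accTden [s, a] w2 (store_accE q (NPlus (Num H) (NTimes (NMinus zl (Num 1)) (summary_sizeE q)))
          (NTimes (Num H) (summary_sizeE q))) (level_rows q H d s (l - 1))"
        unfolding level_rows_def
        by (intro accTden_store[OF q] nden_NPlus nden_NTimes nden_NMinus nden_Num l nden_summary_sizeE[OF d2])
      then have it: "den [s, a] w2 (itemE q H zl zw) (item q H d ?b s a l ((e - H) mod ?D))"
        unfolding itemE_def item_def
        by (intro den_ifE den_nat_eqE l nden_Num den_rawE[OF d2 d q] w den_entryE nden_NTimes b2 q)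
      have old: "den [s, a] w2 (inE (Num 0) (Reg 3)) (rin [s] 0 e)"
        unfolding rin_Cons0[of s "[a]", symmetric] by (intro den_inE nden_Num e2)
      show "den [s, a] w2 (let l = NMinus u (NTimes t (Num H)); w = NMinus (NMinus (Reg 3) (Num H)) (NTimes u (summary_sizeE q))
         in ifE (andE (incomingE l) (eqE (natE t) (baseE l))) (itemE q H l w)
            (ifE (fullE l) (numE 0) (inE (Num 0) (Reg 3))))
         (new_slot q H d ?b s a ((e - H) div ?D div H) ((e - H) div ?D mod H) ((e - H) mod ?D) e)"
        unfolding Let_def zl_def[symmetric] zw_def[symmetric] l_def[symmetric] new_slot_def
        by (intro den_ifE den_andE den_incomingE[OF b2] l den_eqE[OF den_natE[OF t] den_baseE[OF b2 l]] it
            den_fullE[OF b2] den_numE old) simp_all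
    qed (use H in simp)
  qed
  have "den [s, a] ?w (updE q H) (if real e < real H then base ?b s e + of_bool (incoming ?b s e)
     else new_slot q H d ?b s a ((e - H) div ?D div H) ((e - H) div ?D mod H) ((e - H) mod ?D) e)"
    unfolding updE_def
    by (intro den_ifE den_lessE den_natE ctx_nden nden_Num den_arith den_baseE den_incomingE slot)
  then show ?thesis by (rule den_cong) (simp add: new_entry_def Let_def)
qed

section \<open>The invariant of the streaming store\<close>

definition store_size :: "nat \<Rightarrow> nat \<Rightarrow> nat \<Rightarrow> nat \<Rightarrow> nat" where
  "store_size q H d b = H + b * H * summary_size q d"

definition store_sizeE :: "nat \<Rightarrow> nat \<Rightarrow> nexp" where
  "store_sizeE q H = NPlus (Num H) (NTimes (NTimes (Reg 2) (Num H)) (summary_sizeE q))"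

definition level_norm :: "nat \<Rightarrow> nat \<Rightarrow> nat \<Rightarrow> nat \<Rightarrow> real list \<Rightarrow> nat \<Rightarrow> nat \<Rightarrow> (nat \<Rightarrow> real) \<Rightarrow> real" where
  "level_norm q H d b s l \<tau> x = (\<Sum>t<b. nrm q q (slot q s (H + (t * H + l) * summary_size q d) \<tau>) x)"

text \<open>
  Level \<open>l\<close> holds \<open>f l\<close> summaries, each of \<open>b ^ l\<close> rows; \<open>g l\<close> is the exact seminorm of all rows
  that are summarized there.
\<close>

definition store_inv :: "nat \<Rightarrow> nat \<Rightarrow> nat \<Rightarrow> real mat \<Rightarrow> nat \<Rightarrow> real list \<Rightarrow> bool" where
  "store_inv q H b A i s \<longleftrightarrow> (let d = dim_col A in
     length s = store_size q H d b \<and>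
     (\<exists>f :: nat \<Rightarrow> nat. \<exists>g :: nat \<Rightarrow> nat \<Rightarrow> (nat \<Rightarrow> real) \<Rightarrow> real.
       (\<forall>l<H. s ! l = real (f l) \<and> f l \<le> b) \<and> (\<Sum>l<H. f l * b ^ l) = i \<and>
       (\<forall>l<H. \<forall>t<b. f l \<le> t \<longrightarrow> (\<forall>\<tau><d ^ q. \<forall>r<q. \<forall>c<q. slot q s (H + (t * H + l) * summary_size q d) \<tau> r c = 0)) \<and>
       (\<forall>\<tau><d ^ q. \<forall>x.
         (\<forall>l<H. g l \<tau> x \<le> level_norm q H d b s l \<tau> x \<and> level_norm q H d b s l \<tau> x \<le> real q ^ l * g l \<tau> x \<and> 0 \<le> g l \<tau> x) \<and>
         (\<Sum>l<H. g l \<tau> x) = (\<Sum>j<i. \<bar>dotp q (colsel A \<tau> j) x\<bar>))))"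

text \<open>Conservation under simultaneous carries: what a full level loses, the next one gains, so
  only the new item \<open>z\<close> is added, up to overflow from the top. It is applied to numbers
  of rows and to seminorms, hence the general monoid.\<close>

lemma carry_sum:
  fixes g :: "nat \<Rightarrow> 'a :: comm_monoid_add"
  shows "(\<Sum>l<Suc H. if fl l then 0 else g l) + (\<Sum>l<Suc H. if l = 0 then z else if fl (l - 1) then g (l - 1) else 0)
     + (if fl H then g H else 0) = z + (\<Sum>l<Suc H. g l)"
proof (induction H)
  case 0
  then show ?case by (simp add: add.commute)
next
  case (Suc H)
  have "(\<Sum>l<Suc (Suc H). if fl l then 0 else g l) + (\<Sum>l<Suc (Suc H). if l = 0 then z else if fl (l - 1) then g (l - 1) else 0)
     + (if fl (Suc H) then g (Suc H) else 0) =
    ((\<Sum>l<Suc H. if fl l then 0 else g l) + (\<Sum>l<Suc H. if l = 0 then z else if fl (l - 1) then g (l - 1) else 0)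
     + (if fl H then g H else 0)) + ((if fl (Suc H) then 0 else g (Suc H)) + (if fl (Suc H) then g (Suc H) else 0))"
    by (simp only: sum.lessThan_Suc[of _ "Suc H"] diff_Suc_1 nat.simps if_False ac_simps)
  also have "\<dots> = z + (\<Sum>l<Suc H. g l) + g (Suc H)"
    unfolding Suc.IH by simp
  finally show ?case by (simp add: add.assoc)
qed

lemma sum_blocks:
  fixes h :: "nat \<Rightarrow> real"
  shows "(\<Sum>u<b * H. h u) = (\<Sum>t<b. \<Sum>l<H. h (t * H + l))"
proof (induction b)
  case (Suc b)
  have "(\<Sum>u<Suc b * H. h u) = (\<Sum>u<b * H + H. h u)" by (simp add: add.commute)
  also have "\<dots> = (\<Sum>u<b * H. h u) + (\<Sum>l<H. h (b * H + l))" by (rule sum_split_add)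
  finally show ?case using Suc.IH by simp
qed simp

lemma nrm_zero_rows: "(\<And>r c. r < m \<Longrightarrow> c < q \<Longrightarrow> P r c = 0) \<Longrightarrow> nrm q m P x = 0"
  by (simp add: nrm_def dotp_def)

lemma store_inv_init:
  assumes "A \<in> carrier_mat n d"
  shows "store_inv q H b A 0 (map (\<lambda>_. 0) [0..<store_size q H d b])"
proof -
  let ?s = "map (\<lambda>_. 0) [0..<store_size q H d b] :: real list"
  have 0: "slot q ?s off \<tau> r c = 0" for off \<tau> r c by (simp add: slot_def rin_def)
  have "level_norm q H d b ?s l \<tau> x = 0" for l \<tau> x
    unfolding level_norm_def by (intro sum.neutral ballI nrm_zero_rows) (simp add: 0)
  moreover have "l < store_size q H d b" if "l < H" for l using that by (simp add: store_size_def)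
  ultimately show ?thesis
    using assms unfolding store_inv_def Let_def
    by (intro conjI exI[of _ "\<lambda>_. 0"]) (auto simp: 0)
qed

text \<open>Every level receives at most one summary, and after emptying its count is below
  \<open>b\<close>, so there is a free slot. A carried summary is the sketch of a whole level, so
  its distortion is that of the level below times \<open>q\<close>, which explains
  \<open>q ^ l\<close> on level \<open>l\<close>.\<close>

lemma store_inv_step:
  assumes A: "A \<in> carrier_mat n d" and d: "d \<ge> 1" and q: "q \<ge> 1" and H: "H \<ge> 1" and b: "b \<ge> 1"
    and i: "i < n" and nb: "n \<le> b ^ H" and inv: "store_inv q H b A i s"
  shows "store_inv q H b A (Suc i) (map (new_entry q H d b s (mat_row A i)) [0..<store_size q H d b])"
proof -
  let ?D = "summary_size q d"
  have dims: "dim_row A = n" "dim_col A = d" using A by auto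
  have D: "?D > 0" using d q by (simp add: summary_size_def)
  define a where "a = mat_row A i"
  define s' where "s' = map (new_entry q H d b s a) [0..<store_size q H d b]"
  have len: "length s = store_size q H d b" using inv unfolding store_inv_def Let_def dims by (rule conjunct1)
  have "\<exists>f :: nat \<Rightarrow> nat. \<exists>g :: nat \<Rightarrow> nat \<Rightarrow> (nat \<Rightarrow> real) \<Rightarrow> real.
       (\<forall>l<H. s ! l = real (f l) \<and> f l \<le> b) \<and> (\<Sum>l<H. f l * b ^ l) = i \<and>
       (\<forall>l<H. \<forall>t<b. f l \<le> t \<longrightarrow> (\<forall>\<tau><d ^ q. \<forall>r<q. \<forall>c<q. slot q s (H + (t * H + l) * ?D) \<tau> r c = 0)) \<and>
       (\<forall>\<tau><d ^ q. \<forall>x.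
         (\<forall>l<H. g l \<tau> x \<le> level_norm q H d b s l \<tau> x \<and> level_norm q H d b s l \<tau> x \<le> real q ^ l * g l \<tau> x \<and> 0 \<le> g l \<tau> x) \<and>
         (\<Sum>l<H. g l \<tau> x) = (\<Sum>j<i. \<bar>dotp q (colsel A \<tau> j) x\<bar>))"
    using inv unfolding store_inv_def Let_def dims by (rule conjunct2)
  then obtain f g where fg: "\<forall>l<H. s ! l = real (f l) \<and> f l \<le> b" "(\<Sum>l<H. f l * b ^ l) = i"
    "\<forall>l<H. \<forall>t<b. f l \<le> t \<longrightarrow> (\<forall>\<tau><d ^ q. \<forall>r<q. \<forall>c<q. slot q s (H + (t * H + l) * ?D) \<tau> r c = 0)"
    "\<forall>\<tau><d ^ q. \<forall>x.
         (\<forall>l<H. g l \<tau> x \<le> level_norm q H d b s l \<tau> x \<and> level_norm q H d b s l \<tau> x \<le> real q ^ l * g l \<tau> x \<and> 0 \<le> g l \<tau> x) \<and>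
         (\<Sum>l<H. g l \<tau> x) = (\<Sum>j<i. \<bar>dotp q (colsel A \<tau> j) x\<bar>)" by (elim exE conjE)
  have f: "\<And>l. l < H \<Longrightarrow> s ! l = real (f l)" "\<And>l. l < H \<Longrightarrow> f l \<le> b" "(\<Sum>l<H. f l * b ^ l) = i"
    using fg(1,2) by blast+
  have zero: "\<And>l t \<tau> r c. l < H \<Longrightarrow> t < b \<Longrightarrow> f l \<le> t \<Longrightarrow> \<tau> < d ^ q \<Longrightarrow> r < q \<Longrightarrow> c < q \<Longrightarrow>
      slot q s (H + (t * H + l) * ?D) \<tau> r c = 0" using fg(3) by blast
  have g: "\<And>l \<tau> x. l < H \<Longrightarrow> \<tau> < d ^ q \<Longrightarrow> g l \<tau> x \<le> level_norm q H d b s l \<tau> x"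
      "\<And>l \<tau> x. l < H \<Longrightarrow> \<tau> < d ^ q \<Longrightarrow> level_norm q H d b s l \<tau> x \<le> real q ^ l * g l \<tau> x"
      "\<And>l \<tau> x. l < H \<Longrightarrow> \<tau> < d ^ q \<Longrightarrow> 0 \<le> g l \<tau> x"
      "\<And>\<tau> x. \<tau> < d ^ q \<Longrightarrow> (\<Sum>l<H. g l \<tau> x) = (\<Sum>j<i. \<bar>dotp q (colsel A \<tau> j) x\<bar>)"
    using fg(4) by blast+
  define fl where "fl l \<longleftrightarrow> f l = b" for l
  have Hs: "H \<le> store_size q H d b" by (simp add: store_size_def)
  have cnt: "cnt s l = real (f l)" if "l < H" for l
    using that f(1) len Hs by (simp add: cnt_def rin_def)
  have full: "\<not> cnt s l < real b \<longleftrightarrow> fl l" if "l < H" for l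
    using f(2)[OF that] by (auto simp: cnt[OF that] fl_def)
  have base: "base b s l = real (if fl l then 0 else f l)" if "l < H" for l
    using full[OF that] cnt[OF that] unfolding base_def by auto
  have inc: "incoming b s l \<longleftrightarrow> l = 0 \<or> fl (l - 1)" if "l < H" for l
    unfolding incoming_def using full[of "l - 1"] that by auto
  \<comment> \<open>A full top level would account for \<open>b ^ H \<ge> n\<close> rows, but only
    \<open>i < n\<close> have been read. So nothing overflows.\<close>
  have top: "\<not> fl (H - 1)"
  proof
    assume "fl (H - 1)"
    then have "b * b ^ (H - 1) \<le> (\<Sum>l<H. f l * b ^ l)"
      using H member_le_sum[of "H - 1" "{..<H}" "\<lambda>l. f l * b ^ l"] by (simp add: fl_def)
    moreover have "b * b ^ (H - 1) = b ^ H" using H by (cases H) auto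
    ultimately show False using f(3) i nb by simp
  qed
  define f0 where "f0 l = (if fl l then 0 else f l)" for l
  define ic where "ic l \<longleftrightarrow> l = 0 \<or> fl (l - 1)" for l
  define f' where "f' l = f0 l + (if ic l then 1 else 0)" for l
  \<comment> \<open>The exact seminorm of the rows on a level travels upwards together with their
    summaries.\<close>
  define g' where "g' l \<tau> x = (if fl l then 0 else g l \<tau> x) +
    (if l = 0 then \<bar>dotp q (colsel A \<tau> i) x\<bar> else if fl (l - 1) then g (l - 1) \<tau> x else 0)" for l \<tau> x
  have f0b: "f0 l < b" if "l < H" for l using f(2)[OF that] b by (auto simp: f0_def fl_def)
  obtain H' where H': "H = Suc H'" using H by (cases H) auto
  have pos: "H + (t * H + l) * ?D + w < store_size q H d b" if "t < b" "l < H" "w < ?D" for t l w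
  proof -
    have "t * H + l < (t + 1) * H" using that by simp
    also have "\<dots> \<le> b * H" using that by (intro mult_right_mono) auto
    finally have "(t * H + l + 1) * ?D \<le> b * H * ?D" by (intro mult_right_mono) auto
    then show ?thesis using that by (simp add: store_size_def)
  qed
  have nw: "slot q s' (H + (t * H + l) * ?D) \<tau> r c =
      (if ic l \<and> t = f0 l then item q H d b s a l ((\<tau> * q + r) * q + c)
       else if fl l then 0 else slot q s (H + (t * H + l) * ?D) \<tau> r c)"
    if t: "t < b" and l: "l < H" and \<tau>: "\<tau> < d ^ q" and r: "r < q" and c: "c < q" for t l \<tau> r c
  proof -
    define w where "w = (\<tau> * q + r) * q + c"
    have w: "w < ?D" unfolding w_def by (rule entry_index_less[OF \<tau> r c])
    define e where "e = H + (t * H + l) * ?D + w"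
    have e: "e < store_size q H d b" unfolding e_def by (rule pos[OF t l w])
    have eH: "\<not> e < H" "(e - H) div ?D = t * H + l" "(e - H) mod ?D = w"
      using w by (simp_all add: e_def)
    have u: "(t * H + l) div H = t" "(t * H + l) mod H = l" using l by simp_all
    have "slot q s' (H + (t * H + l) * ?D) \<tau> r c = new_entry q H d b s a e"
      using e by (simp add: slot_def rin_def s'_def e_def w_def)
    also have "\<dots> = new_slot q H d b s a t l w e"
      using eH u by (simp add: new_entry_def Let_def)
    also have "\<dots> = (if ic l \<and> t = f0 l then item q H d b s a l w
       else if fl l then 0 else rin [s] 0 e)"
      unfolding new_slot_def inc[OF l] base[OF l] full[OF l] of_nat_eq_iff
      by (simp only: ic_def f0_def)
    finally show ?thesis by (simp add: slot_def e_def w_def)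
  qed
  have f'b: "f' l \<le> b" if "l < H" for l using f0b[OF that] by (simp add: f'_def)
  have cnt': "s' ! l = real (f' l)" if "l < H" for l
    using that Hs inc[OF that] base[OF that]
    by (simp add: s'_def new_entry_def f'_def f0_def ic_def)
  have sum': "(\<Sum>l<H. f' l * b ^ l) = Suc i"
  proof -
    \<comment> \<open>The \<open>b\<close> summaries of \<open>b ^ (l - 1)\<close> rows on a full
      level become one summary of \<open>b ^ l\<close> rows.\<close>
    have "f' l * b ^ l = (if fl l then 0 else f l * b ^ l) +
        (if l = 0 then 1 else if fl (l - 1) then f (l - 1) * b ^ (l - 1) else 0)" for l
      by (cases l) (auto simp: f'_def f0_def ic_def fl_def)
    then have "(\<Sum>l<H. f' l * b ^ l) = 1 + (\<Sum>l<H. f l * b ^ l)"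
      using carry_sum[of fl "\<lambda>l. f l * b ^ l" H' 1] top by (simp add: sum.distrib H')
    then show ?thesis using f(3) by simp
  qed
  have zero': "slot q s' (H + (t * H + l) * ?D) \<tau> r c = 0"
    if "l < H" "t < b" "f' l \<le> t" "\<tau> < d ^ q" "r < q" "c < q" for l t \<tau> r c
  proof -
    have "\<not> (ic l \<and> t = f0 l)" using that(3) by (auto simp: f'_def)
    moreover have "fl l \<or> slot q s (H + (t * H + l) * ?D) \<tau> r c = 0"
    proof (cases "fl l")
      case False
      then have "f l \<le> t" using that(3) by (simp add: f'_def f0_def)
      from zero[OF that(1,2) this that(4-6)] show ?thesis by simp
    qed simp
    ultimately show ?thesis using nw[OF that(2,1,4-6)] by auto
  qed
  have lev: "level_norm q H d b s' l \<tau> x = (if fl l then 0 else level_norm q H d b s l \<tau> x) +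
      (if ic l then nrm q q (\<lambda>r c. item q H d b s a l ((\<tau> * q + r) * q + c)) x else 0)"
    if l: "l < H" and \<tau>: "\<tau> < d ^ q" for l \<tau> x
  proof -
    let ?I = "nrm q q (\<lambda>r c. item q H d b s a l ((\<tau> * q + r) * q + c)) x"
    let ?o = "\<lambda>t. if fl l then 0 else nrm q q (slot q s (H + (t * H + l) * ?D) \<tau>) x"
    \<comment> \<open>The slot about to be written contributes nothing before the write, so writing
      to it simply adds the seminorm of the new summary.\<close>
    have o0: "?o (f0 l) = 0"
      using zero[OF l f0b[OF l] _ \<tau>] by (auto simp: f0_def intro!: nrm_zero_rows)
    have "level_norm q H d b s' l \<tau> x = (\<Sum>t<b. ?o t + (if t = f0 l then (if ic l then ?I else 0) else 0))"
      unfolding level_norm_def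
    proof (rule sum.cong[OF refl])
      fix t assume "t \<in> {..<b}"
      then have t: "t < b" by simp
      have "nrm q q (slot q s' (H + (t * H + l) * ?D) \<tau>) x =
          nrm q q (\<lambda>r c. if ic l \<and> t = f0 l then item q H d b s a l ((\<tau> * q + r) * q + c)
            else if fl l then 0 else slot q s (H + (t * H + l) * ?D) \<tau> r c) x"
        by (rule nrm_cong) (simp_all add: nw[OF t l \<tau>])
      also have "\<dots> = (if ic l \<and> t = f0 l then ?I else ?o t)"
      proof -
        have 0: "nrm q q (\<lambda>r c. 0) x = 0" by (rule nrm_zero_rows) simp
        have "nrm q q (\<lambda>r c. if p then X r c else if r' then 0 else Y r c) x =
          (if p then nrm q q X x else if r' then 0 else nrm q q Y x)" for p r' X Y
          by (cases p; cases r') (simp_all add: 0)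
        then show ?thesis .
      qed
      also have "\<dots> = ?o t + (if t = f0 l then (if ic l then ?I else 0) else 0)" using o0 by auto
      finally show "nrm q q (slot q s' (H + (t * H + l) * ?D) \<tau>) x =
          ?o t + (if t = f0 l then (if ic l then ?I else 0) else 0)" .
    qed
    also have "\<dots> = (\<Sum>t<b. ?o t) + (if ic l then ?I else 0)"
      using f0b[OF l] by (simp add: sum.distrib)
    also have "(\<Sum>t<b. ?o t) = (if fl l then 0 else level_norm q H d b s l \<tau> x)"
      by (simp add: level_norm_def)
    finally show ?thesis .
  qed
  have raw: "nrm q q (\<lambda>r c. item q H d b s a 0 ((\<tau> * q + r) * q + c)) x = \<bar>dotp q (colsel A \<tau> i) x\<bar>"
    if \<tau>: "\<tau> < d ^ q" for \<tau> x
  proof -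
    have it: "item q H d b s a 0 ((\<tau> * q + r) * q + c) = (if r = 0 then colsel A \<tau> i c else 0)" if "r < q" "c < q" for r c
      using that A i d by (simp add: item_def raw_entry_def rin_def a_def colsel_def dims dig_less list_of_vec_index)
    have "nrm q q (\<lambda>r c. item q H d b s a 0 ((\<tau> * q + r) * q + c)) x =
        nrm q q (\<lambda>r c. if r = 0 then colsel A \<tau> i c else 0) x"
      by (rule nrm_cong) (simp_all add: it)
    also have "\<dots> = (\<Sum>r<q. if r = 0 then \<bar>dotp q (colsel A \<tau> i) x\<bar> else 0)"
      unfolding nrm_def by (intro sum.cong) (auto simp: dotp_def)
    also have "\<dots> = \<bar>dotp q (colsel A \<tau> i) x\<bar>" using q by simp
    finally show ?thesis .
  qed
  \<comment> \<open>The stacked slots of level \<open>l\<close> have the seminorm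
    \<open>level_norm\<close> by \<open>nrm_blocks\<close>, and \<open>sketch_bounds\<close> applies
    to the stack as a whole.\<close>
  have merged: "level_norm q H d b s l \<tau> x \<le> nrm q q (\<lambda>r c. item q H d b s a (Suc l) ((\<tau> * q + r) * q + c)) x"
    "nrm q q (\<lambda>r c. item q H d b s a (Suc l) ((\<tau> * q + r) * q + c)) x \<le> real q * level_norm q H d b s l \<tau> x"
    if "\<tau> < d ^ q" for l \<tau> x
  proof -
    have 1: "nrm q q (\<lambda>r c. item q H d b s a (Suc l) ((\<tau> * q + r) * q + c)) x =
        nrm q q (sketch q (b * q) (level_rows q H d s l \<tau>)) x"
      by (rule nrm_cong) (simp_all add: item_def entry_index)
    have "nrm q (b * q) (level_rows q H d s l \<tau>) x =
        nrm q (b * q) (\<lambda>i. (\<lambda>u. slot q s (H + l * ?D + u * (H * ?D)) \<tau>) (i div q) (i mod q)) x"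
      by (rule nrm_cong) (simp_all add: level_rows_def store_rows_def)
    also have "\<dots> = (\<Sum>u<b. nrm q q (slot q s (H + l * ?D + u * (H * ?D)) \<tau>) x)"
      by (rule nrm_blocks)
    also have "\<dots> = level_norm q H d b s l \<tau> x"
      unfolding level_norm_def by (intro sum.cong refl) (simp add: algebra_simps)
    finally have 2: "nrm q (b * q) (level_rows q H d s l \<tau>) x = level_norm q H d b s l \<tau> x" .
    show "level_norm q H d b s l \<tau> x \<le> nrm q q (\<lambda>r c. item q H d b s a (Suc l) ((\<tau> * q + r) * q + c)) x"
      "nrm q q (\<lambda>r c. item q H d b s a (Suc l) ((\<tau> * q + r) * q + c)) x \<le> real q * level_norm q H d b s l \<tau> x"
      unfolding 1 2[symmetric] by (rule sketch_bounds[OF q])+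
  qed
  have g'b: "g' l \<tau> x \<le> level_norm q H d b s' l \<tau> x \<and> level_norm q H d b s' l \<tau> x \<le> real q ^ l * g' l \<tau> x \<and> 0 \<le> g' l \<tau> x"
    if l: "l < H" and \<tau>: "\<tau> < d ^ q" for l \<tau> x
  proof -
    let ?I = "nrm q q (\<lambda>r c. item q H d b s a l ((\<tau> * q + r) * q + c)) x"
    define G where "G = (if l = 0 then \<bar>dotp q (colsel A \<tau> i) x\<bar> else if fl (l - 1) then g (l - 1) \<tau> x else 0)"
    define I where "I = (if ic l then ?I else 0)"
    have GI: "G \<le> I \<and> I \<le> real q ^ l * G \<and> 0 \<le> G"
    proof (cases l)
      case 0
      then show ?thesis using raw[OF \<tau>] by (simp add: G_def I_def ic_def)
    next
      case (Suc l')
      show ?thesis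
      proof (cases "fl l'")
        case True
        have l': "l' < H" using l Suc by simp
        have "G = g l' \<tau> x" "I = nrm q q (\<lambda>r c. item q H d b s a (Suc l') ((\<tau> * q + r) * q + c)) x"
          using True Suc by (simp_all add: G_def I_def ic_def)
        moreover have "real q * level_norm q H d b s l' \<tau> x \<le> real q * (real q ^ l' * g l' \<tau> x)"
          using g(2)[OF l' \<tau>] by (intro mult_left_mono) auto
        ultimately show ?thesis
          using merged[OF \<tau>, of l' x] g(1,3)[OF l' \<tau>, of x] Suc by (simp add: mult.assoc)
      next
        case False
        then show ?thesis using Suc by (simp add: G_def I_def ic_def)
      qed
    qed
    show ?thesis
      unfolding lev[OF l \<tau>] g'_def G_def[symmetric] I_def[symmetric]
      using GI g(1-3)[OF l \<tau>, of x] by (auto simp: distrib_left)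
  qed
  have g's: "(\<Sum>l<H. g' l \<tau> x) = (\<Sum>j<Suc i. \<bar>dotp q (colsel A \<tau> j) x\<bar>)" if \<tau>: "\<tau> < d ^ q" for \<tau> x
    using carry_sum[of fl "\<lambda>l. g l \<tau> x" H' "\<bar>dotp q (colsel A \<tau> i) x\<bar>"] top g(4)[OF \<tau>, of x]
    by (simp add: g'_def sum.distrib H')
  have "store_inv q H b A (Suc i) s'"
    unfolding store_inv_def Let_def dims
  proof (intro conjI exI[of _ f'] exI[of _ g'] allI impI)
    show "length s' = store_size q H d b" by (simp add: s'_def)
  qed (use cnt' f'b sum' zero' g'b g's in auto)
  then show ?thesis by (simp add: s'_def a_def)
qed

text \<open>The query reads all \<open>b * H\<close> slots as one stacked matrix without sketching
  it again; the distortion \<open>q ^ l\<close> of each level is at most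
  \<open>q ^ H\<close>.\<close>

lemma store_inv_final:
  assumes A: "A \<in> carrier_mat n d" and q: "q \<ge> 1" and H: "H \<ge> 1" and inv: "store_inv q H b A n s" and \<tau>: "\<tau> < d ^ q"
  shows "nrm q n (colsel A \<tau>) x \<le> nrm q (b * H * q) (store_rows q s H (summary_size q d) \<tau>) x"
    and "nrm q (b * H * q) (store_rows q s H (summary_size q d) \<tau>) x \<le> real q ^ H * nrm q n (colsel A \<tau>) x"
proof -
  have dims: "dim_col A = d" using A by auto
  obtain g where "\<forall>\<tau><d ^ q. \<forall>x.
         (\<forall>l<H. g l \<tau> x \<le> level_norm q H d b s l \<tau> x \<and> level_norm q H d b s l \<tau> x \<le> real q ^ l * g l \<tau> x \<and> 0 \<le> g l \<tau> x) \<and>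
         (\<Sum>l<H. g l \<tau> x) = (\<Sum>j<n. \<bar>dotp q (colsel A \<tau> j) x\<bar>)"
    using inv unfolding store_inv_def Let_def dims by (elim exE conjE)
  then have g: "\<And>l. l < H \<Longrightarrow> g l \<tau> x \<le> level_norm q H d b s l \<tau> x"
      "\<And>l. l < H \<Longrightarrow> level_norm q H d b s l \<tau> x \<le> real q ^ l * g l \<tau> x" "\<And>l. l < H \<Longrightarrow> 0 \<le> g l \<tau> x"
      "(\<Sum>l<H. g l \<tau> x) = (\<Sum>j<n. \<bar>dotp q (colsel A \<tau> j) x\<bar>)"
    using \<tau> by blast+
  have "nrm q (b * H * q) (store_rows q s H (summary_size q d) \<tau>) x =
      nrm q (b * H * q) (\<lambda>i. (\<lambda>u. slot q s (H + u * summary_size q d) \<tau>) (i div q) (i mod q)) x"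
    by (rule nrm_cong) (simp_all add: store_rows_def)
  also have "\<dots> = (\<Sum>u<b * H. nrm q q (slot q s (H + u * summary_size q d) \<tau>) x)"
    by (rule nrm_blocks)
  also have "\<dots> = (\<Sum>l<H. level_norm q H d b s l \<tau> x)"
    unfolding sum_blocks level_norm_def by (rule sum.swap)
  finally have eq: "nrm q (b * H * q) (store_rows q s H (summary_size q d) \<tau>) x = (\<Sum>l<H. level_norm q H d b s l \<tau> x)" .
  have n: "nrm q n (colsel A \<tau>) x = (\<Sum>l<H. g l \<tau> x)" by (simp add: nrm_def g(4))
  show "nrm q n (colsel A \<tau>) x \<le> nrm q (b * H * q) (store_rows q s H (summary_size q d) \<tau>) x"
    unfolding eq n by (intro sum_mono g) simp
  have "(\<Sum>l<H. level_norm q H d b s l \<tau> x) \<le> (\<Sum>l<H. real q ^ H * g l \<tau> x)"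
  proof (rule sum_mono)
    fix l assume l: "l \<in> {..<H}"
    then have "real q ^ l * g l \<tau> x \<le> real q ^ H * g l \<tau> x"
      using q g(3) by (intro mult_right_mono power_increasing) auto
    then show "level_norm q H d b s l \<tau> x \<le> real q ^ H * g l \<tau> x" using g(2)[of l] l by simp
  qed
  then show "nrm q (b * H * q) (store_rows q s H (summary_size q d) \<tau>) x \<le> real q ^ H * nrm q n (colsel A \<tau>) x"
    unfolding eq n by (simp add: sum_distrib_left)
qed

section \<open>Resource bounds\<close>

definition ini_prog :: "nat \<Rightarrow> nat \<Rightarrow> prog" where
  "ini_prog q H = root_prog H (store_sizeE q H) (numE 0)"

definition upd_prog :: "nat \<Rightarrow> nat \<Rightarrow> prog" where
  "upd_prog q H = root_prog H (store_sizeE q H) (updE q H)"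

lemma root_of_props:
  assumes n: "n \<ge> 1" and L: "L \<ge> 1"
  shows "n \<le> root_of L n ^ L" and "root_of L n \<ge> 1" and "(root_of L n - 1) ^ L < n"
proof -
  let ?P = "\<lambda>t. t = n \<or> n \<le> t ^ L"
  have "?P (root_of L n)" unfolding root_of_def sel_def by (rule LeastI[of ?P n]) simp
  then show 1: "n \<le> root_of L n ^ L"
  proof
    assume "root_of L n = n"
    then show ?thesis using n L self_le_power[of n L] by simp
  qed
  show 2: "root_of L n \<ge> 1"
  proof (rule ccontr)
    assume "\<not> ?thesis"
    then have "root_of L n ^ L = 0" using L by simp
    with 1 n show False by simp
  qed
  have "\<not> ?P (root_of L n - 1)"
    unfolding root_of_def sel_def by (rule not_less_Least) (use 2 in \<open>simp add: root_of_def sel_def\<close>)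
  then show "(root_of L n - 1) ^ L < n" by simp
qed

text \<open>If the number just below the root were at least \<open>n powr \<gamma>\<close>, its
  \<open>L\<close>-th power would be at least \<open>n\<close>, as
  \<open>\<gamma> * L \<ge> 1\<close>; this contradicts minimality of the root.\<close>

lemma root_of_le:
  fixes \<gamma> :: real
  assumes g: "\<gamma> > 0" and n: "n \<ge> 1" and L: "L = nat \<lceil>1 / \<gamma>\<rceil>"
  shows "L \<ge> 1" and "root_of L n \<le> nat \<lceil>real n powr \<gamma>\<rceil>"
proof -
  have "1 / \<gamma> > 0" using g by simp
  then have "\<lceil>1 / \<gamma>\<rceil> \<ge> 1" by linarith
  then show L1: "L \<ge> 1" unfolding L by linarith
  have "1 / \<gamma> \<le> real L" unfolding L by linarith
  then have gL: "1 \<le> \<gamma> * real L" using g by (simp add: field_simps)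
  have "real (root_of L n - 1) < real n powr \<gamma>"
  proof (rule ccontr)
    assume "\<not> ?thesis"
    then have "real n powr \<gamma> \<le> real (root_of L n - 1)" by simp
    then have "(real n powr \<gamma>) ^ L \<le> real (root_of L n - 1) ^ L" by (intro power_mono) auto
    moreover have "(real n powr \<gamma>) ^ L = real n powr (\<gamma> * real L)"
      using n by (simp add: powr_powr flip: powr_realpow)
    moreover have "real n powr 1 \<le> real n powr (\<gamma> * real L)" using n gL by (intro powr_mono) auto
    moreover have "real (root_of L n - 1) ^ L < real n"
      using root_of_props(3)[OF n L1] by (metis of_nat_less_iff of_nat_power)
    moreover have "real n powr 1 = real n" using n by simp
    ultimately show False by linarith
  qed
  then show "root_of L n \<le> nat \<lceil>real n powr \<gamma>\<rceil>" by linarith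
qed

text \<open>One \<open>c\<close> for all bounds at once. The base \<open>2 + n + d + ...\<close> is
  the \<open>N\<close> with respect to which the running times were bounded by powers.\<close>

lemma resources_suffice:
  fixes \<gamma> :: real
  assumes g: "\<gamma> > 0"
  shows "\<exists>c. \<forall>n\<ge>1. \<forall>d\<ge>1. K \<le> space_bound \<gamma> c n d \<and>
     a * (nat \<lceil>real n powr \<gamma>\<rceil> * d ^ e) \<le> space_bound \<gamma> c n d \<and>
     (2 + n + d + a * (nat \<lceil>real n powr \<gamma>\<rceil> * d ^ e)) ^ K \<le> poly_bound c n d"
proof -
  \<comment> \<open>\<open>m\<close> dominates the exponents of \<open>n\<close> and
    \<open>d\<close> in the base. \<open>C\<close> adds up its coefficients 2, 1, 1 and
    \<open>2 * a\<close>, with the 2 in \<open>2 * a\<close> because rounding up at most doubles a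
    real that is at least 1. Finally \<open>c\<close> exceeds each requirement separately.\<close>
  define m where "m = nat \<lceil>\<gamma>\<rceil> + e + 1"
  define C where "C = 4 + 2 * a"
  define c where "c = 2 * a + e + K + C ^ K + m * K"
  show ?thesis
  proof (intro exI[of _ c] allI impI)
    fix n d :: nat assume n: "n \<ge> 1" and d: "d \<ge> 1"
    let ?G = "nat \<lceil>real n powr \<gamma>\<rceil>"
    have n1: "real n powr \<gamma> \<ge> 1" using n g by (intro ge_one_powr_ge_zero) auto
    have G: "real ?G \<le> 2 * real n powr \<gamma>" using n1 by linarith
    have dc: "real d ^ e \<le> real d ^ c" "1 \<le> real d ^ c"
      using d by (auto intro!: power_increasing simp: c_def)
    have aux: "real x \<le> real c * real n powr \<gamma> * real d ^ c \<Longrightarrow> x \<le> space_bound \<gamma> c n d" for x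
      unfolding space_bound_def by (simp add: le_nat_floor)
    have "real K * 1 * 1 \<le> real c * real n powr \<gamma> * real d ^ c"
      using n1 dc by (intro mult_mono) (auto simp: c_def)
    then have 1: "K \<le> space_bound \<gamma> c n d" by (intro aux) simp
    have aG: "real (a * (?G * d ^ e)) \<le> real (2 * a) * real n powr \<gamma> * real d ^ e"
    proof -
      have "real a * (real ?G * real d ^ e) \<le> real a * ((2 * real n powr \<gamma>) * real d ^ e)"
        using G by (intro mult_left_mono mult_right_mono) auto
      then show ?thesis by (simp add: mult_ac)
    qed
    also have "\<dots> \<le> real c * real n powr \<gamma> * real d ^ c"
      using dc n1 by (intro mult_mono) (auto simp: c_def)
    finally have 2: "a * (?G * d ^ e) \<le> space_bound \<gamma> c n d" by (rule aux)
    have nm: "real n powr \<gamma> \<le> real n ^ nat \<lceil>\<gamma>\<rceil>"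
    proof -
      have "real n powr \<gamma> \<le> real n powr real (nat \<lceil>\<gamma>\<rceil>)" using n by (intro powr_mono) linarith+
      then show ?thesis using n by (simp add: powr_realpow)
    qed
    have nd: "real n ^ i * real d ^ j \<le> real (n * d) ^ m" if "i \<le> m" "j \<le> m" for i j
    proof -
      have "real n ^ i * real d ^ j \<le> real n ^ m * real d ^ m"
        using n d that by (intro mult_mono power_increasing) auto
      then show ?thesis by (simp add: power_mult_distrib)
    qed
    have "real (2 + n + d + a * (?G * d ^ e)) \<le> 2 + real n + real d + real (2 * a) * real n powr \<gamma> * real d ^ e"
      using aG by simp
    also have "\<dots> \<le> 2 * real (n * d) ^ m + real (n * d) ^ m + real (n * d) ^ m + real (2 * a) * real (n * d) ^ m"
    proof (intro add_mono)
      show "2 \<le> 2 * real (n * d) ^ m" using nd[of 0 0] by simp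
      show "real n \<le> real (n * d) ^ m" using nd[of 1 0] by (simp add: m_def)
      show "real d \<le> real (n * d) ^ m" using nd[of 0 1] by (simp add: m_def)
      have "real n powr \<gamma> * real d ^ e \<le> real n ^ nat \<lceil>\<gamma>\<rceil> * real d ^ e"
        using nm by (rule mult_right_mono) simp
      also have "\<dots> \<le> real (n * d) ^ m"
      proof (rule nd)
        show "nat \<lceil>\<gamma>\<rceil> \<le> m" "e \<le> m" unfolding m_def by linarith+
      qed
      finally have "real (2 * a) * (real n powr \<gamma> * real d ^ e) \<le> real (2 * a) * real (n * d) ^ m"
        by (rule mult_left_mono) simp
      then show "real (2 * a) * real n powr \<gamma> * real d ^ e \<le> real (2 * a) * real (n * d) ^ m"
        by (simp only: mult.assoc)
    qed
    also have "\<dots> = real (C * (n * d) ^ m)" by (simp add: C_def algebra_simps)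
    finally have "2 + n + d + a * (?G * d ^ e) \<le> C * (n * d) ^ m" by (simp only: of_nat_le_iff)
    then have "(2 + n + d + a * (?G * d ^ e)) ^ K \<le> (C * (n * d) ^ m) ^ K" by (rule power_mono) simp
    also have "\<dots> = C ^ K * (n * d) ^ (m * K)" by (simp add: power_mult_distrib power_mult)
    also have "\<dots> \<le> c * (n * d) ^ c"
      using n d by (intro mult_mono power_increasing) (auto simp: c_def)
    finally have 3: "(2 + n + d + a * (?G * d ^ e)) ^ K \<le> poly_bound c n d" by (simp add: poly_bound_def)
    show "K \<le> space_bound \<gamma> c n d \<and> a * (?G * d ^ e) \<le> space_bound \<gamma> c n d \<and>
      (2 + n + d + a * (?G * d ^ e)) ^ K \<le> poly_bound c n d" using 1 2 3 by blast
  qed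
qed

section \<open>The guarantees in the two models\<close>

lemma streaming_store:
  assumes q: "q \<ge> 1" and H: "H \<ge> 1"
  shows "\<exists>K. \<forall>n d A S T N. A \<in> carrier_mat n d \<longrightarrow> n \<ge> 1 \<longrightarrow> d \<ge> 1 \<longrightarrow>
     2 \<le> N \<longrightarrow> n \<le> N \<longrightarrow> d \<le> N \<longrightarrow> store_size q H d (root_of H n) \<le> N \<longrightarrow>
     K \<le> S \<longrightarrow> N ^ K \<le> T \<longrightarrow> store_size q H d (root_of H n) + d \<le> S \<longrightarrow>
     (\<exists>s. streamed S T (ini_prog q H) (upd_prog q H) A n s \<and> store_inv q H (root_of H n) A n s)"
proof -
  obtain Ki where "computed_within Ki H (store_sizeE q H) (numE 0)"
    using root_prog_computes by blast
  note Ki = this[unfolded computed_within_def, folded ini_prog_def]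
  obtain Ku where "computed_within Ku H (store_sizeE q H) (updE q H)"
    using root_prog_computes by blast
  note Ku = this[unfolded computed_within_def, folded upd_prog_def]
  show ?thesis
  proof (rule exI[of _ "Ki + Ku"], (rule allI | rule impI)+)
    fix n d :: nat and A :: "real mat" and S T N :: nat
    assume A: "A \<in> carrier_mat n d" and n: "n \<ge> 1" and d: "d \<ge> 1"
      and N: "2 \<le> N" "n \<le> N" "d \<le> N" "store_size q H d (root_of H n) \<le> N"
      and S: "Ki + Ku \<le> S" "store_size q H d (root_of H n) + d \<le> S" and T: "N ^ (Ki + Ku) \<le> T"
    let ?b = "root_of H n"
    have dims: "dim_row A = n" "dim_col A = d" using A by auto
    have T': "N ^ Ki \<le> T" "N ^ Ku \<le> T"
      using N(1) T power_increasing[of Ki "Ki + Ku" N] power_increasing[of Ku "Ki + Ku" N] by linarith+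
    have size: "nden inp (ctx2 H n d) (store_sizeE q H) (store_size q H d ?b)" for inp
      unfolding store_sizeE_def store_size_def
      by (intro nden_NPlus nden_NTimes nden_Num nden_summary_sizeE ctx_nden)
    have "\<exists>s. streamed S T (ini_prog q H) (upd_prog q H) A i s \<and> store_inv q H ?b A i s" if "i \<le> n" for i
      using that
    proof (induction i)
      case 0
      have "\<forall>e. den [] (ctx3 H n d e) (numE 0) ((\<lambda>_. 0) e)" by (auto intro: den_numE)
      then have "computes S T (ini_prog q H) n d [] (map (\<lambda>_. 0) [0..<store_size q H d ?b])"
        using Ki[rule_format, OF size, of "[]" "\<lambda>_. 0" N] N S T' by (simp add: inp_le_def)
      then show ?case using store_inv_init[OF A] by (auto simp: dims intro!: streamed.intros(1))
    next
      case (Suc i)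
      then obtain s where s: "streamed S T (ini_prog q H) (upd_prog q H) A i s" "store_inv q H ?b A i s" by auto
      let ?a = "mat_row A i"
      have len: "length s = store_size q H d ?b" "length ?a = d"
        using s(2) Suc.prems A by (auto simp: store_inv_def Let_def dims)
      have "\<forall>e. den [s, ?a] (ctx3 H n d e) (updE q H) (new_entry q H d ?b s ?a e)"
        using den_updE[OF d q H] by blast
      then have "computes S T (upd_prog q H) n d [s, ?a] (map (new_entry q H d ?b s ?a) [0..<store_size q H d ?b])"
        using Ku[rule_format, OF size, of "[s, ?a]" "new_entry q H d ?b s ?a" N] N S T' len by (simp add: inp_le_def)
      moreover have "store_inv q H ?b A (Suc i) (map (new_entry q H d ?b s ?a) [0..<store_size q H d ?b])"
        using Suc.prems by (intro store_inv_step[OF A d q H root_of_props(2)[OF n H] _ root_of_props(1)[OF n H] s(2)]) simp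
      ultimately show ?case
        using s(1) Suc.prems by (auto simp: dims intro!: streamed.intros(2))
    qed
    then show "\<exists>s. streamed S T (ini_prog q H) (upd_prog q H) A n s \<and> store_inv q H ?b A n s" by blast
  qed
qed

lemma streaming_guarantee:
  fixes \<gamma> :: real
  assumes g: "\<gamma> > 0" and L: "L = nat \<lceil>1 / \<gamma>\<rceil>"
  shows "\<exists>ini upd qry fit c. \<forall>n d. \<forall>A \<in> carrier_mat n d. n \<ge> 1 \<longrightarrow> d \<ge> 1 \<longrightarrow>
       (\<exists>B. streaming_outputs (space_bound \<gamma> c n d) (poly_bound c n d) ini upd qry fit k A B \<and>
            l1_lowrank_approx k (real (k + 1) ^ L * real (k + 1)) A B)"
proof -
  define q where "q = k + 1"
  have q: "q \<ge> 1" by (simp add: q_def)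
  have L1: "L \<ge> 1" using root_of_le(1)[OF g _ L, of 1] by simp
  let ?M = "NTimes (NTimes (Reg 2) (Num L)) (Num q)"
  let ?acc = "store_accE q (Num L) (summary_sizeE q)"
  obtain K1 where K1: "\<forall>n d A S T N. A \<in> carrier_mat n d \<longrightarrow> n \<ge> 1 \<longrightarrow> d \<ge> 1 \<longrightarrow>
     2 \<le> N \<longrightarrow> n \<le> N \<longrightarrow> d \<le> N \<longrightarrow> store_size q L d (root_of L n) \<le> N \<longrightarrow>
     K1 \<le> S \<longrightarrow> N ^ K1 \<le> T \<longrightarrow> store_size q L d (root_of L n) + d \<le> S \<longrightarrow>
     (\<exists>s. streamed S T (ini_prog q L) (upd_prog q L) A n s \<and> store_inv q L (root_of L n) A n s)"
    using streaming_store[OF q L1] by blast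
  obtain K2 where "answered_within K2 k L ?M ?acc"
    using answers_exist by blast
  note K2 = this[unfolded answered_within_def]
  \<comment> \<open>\<open>L\<close> for the counters, \<open>L * q * q\<close> for the slots,
    \<open>q\<close> for the input of \<open>fit\<close> (right factor and one row), and 1 for the
    row that an update reads.\<close>
  define a where "a = L + L * q * q + q + 1"
  obtain c where c: "\<forall>n\<ge>1. \<forall>d\<ge>1. K1 + K2 \<le> space_bound \<gamma> c n d \<and>
     a * (nat \<lceil>real n powr \<gamma>\<rceil> * d ^ q) \<le> space_bound \<gamma> c n d \<and>
     (2 + n + d + a * (nat \<lceil>real n powr \<gamma>\<rceil> * d ^ q)) ^ (K1 + K2) \<le> poly_bound c n d"
    using resources_suffice[OF g] by blast
  show ?thesis
  proof (rule exI[of _ "ini_prog q L"], rule exI[of _ "upd_prog q L"], rule exI[of _ "query_prog k L ?M ?acc"],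
      rule exI[of _ "fit_prog k L"], rule exI[of _ c], intro allI ballI impI)
    fix n d and A :: "real mat" assume A: "A \<in> carrier_mat n d" and n: "n \<ge> 1" and d: "d \<ge> 1"
    let ?S = "space_bound \<gamma> c n d" and ?T = "poly_bound c n d"
    define G where "G = nat \<lceil>real n powr \<gamma>\<rceil>"
    define b where "b = root_of L n"
    define N where "N = 2 + n + d + a * (G * d ^ q)"
    have dims: "dim_row A = n" "dim_col A = d" using A by auto
    have b: "b \<le> G" "b \<ge> 1" unfolding b_def G_def using root_of_le(2)[OF g n L] root_of_props(2)[OF n L1] by auto
    have S: "K1 + K2 \<le> ?S" "a * (G * d ^ q) \<le> ?S" and T: "N ^ (K1 + K2) \<le> ?T"
      using c n d by (auto simp: G_def N_def)
    have N: "2 \<le> N" "n \<le> N" "d \<le> N" "a * (G * d ^ q) \<le> N" by (simp_all add: N_def)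
    have T': "N ^ K1 \<le> ?T" "N ^ K2 \<le> ?T"
      using N(1) T power_increasing[of K1 "K1 + K2" N] power_increasing[of K2 "K1 + K2" N] by linarith+
    have dq: "d \<le> d ^ q" "1 \<le> d ^ q" using d q self_le_power[of d q] by auto
    have dG: "d \<le> G * d ^ q" "1 \<le> G * d ^ q"
      using dq b mult_le_mono[of 1 G d "d ^ q"] mult_le_mono[of 1 G 1 "d ^ q"] by auto
    have st: "store_size q L d b \<le> (L + L * q * q) * (G * d ^ q)"
    proof -
      have "store_size q L d b = L * 1 + (L * q * q) * (b * d ^ q)"
        by (simp add: store_size_def summary_size_def mult_ac)
      also have "\<dots> \<le> L * (G * d ^ q) + (L * q * q) * (G * d ^ q)"
        using dG(2) b(1) by (intro add_mono mult_le_mono) auto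
      finally show ?thesis by (simp add: algebra_simps)
    qed
    have qd: "q * d + d \<le> (q + 1) * (G * d ^ q)"
      using mult_le_mono2[OF dG(1), of "q + 1"] by simp
    have tot: "store_size q L d b + (q * d + d) \<le> a * (G * d ^ q)"
      using add_mono[OF st qd] by (simp add: a_def algebra_simps)
    have kd: "k * d + d = q * d" by (simp add: q_def)
    obtain s where s: "streamed ?S ?T (ini_prog q L) (upd_prog q L) A n s" "store_inv q L b A n s"
    proof -
      have "store_size q L d b \<le> N" "K1 \<le> ?S" "store_size q L d b + d \<le> ?S"
        using S N(4) tot by linarith+
      from K1[rule_format, OF A n d N(1-3) this(1)[unfolded b_def] this(2) T'(1) this(3)[unfolded b_def]]
      show ?thesis using that unfolding b_def by blast
    qed
    have len: "length s = store_size q L d b" using s(2) by (simp add: store_inv_def Let_def dims)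
    have sk: "sketches k A (real q ^ L) (b * L * q) (store_rows q s L (summary_size q d))"
      unfolding sketches_def dims q_def[symmetric]
      using store_inv_final[OF A q L1 s(2)] by blast
    have M: "\<forall>e. nden [s] (ctx3 L n d e) ?M (b * L * q)"
      unfolding b_def by (intro allI nden_NTimes nden_Num ctx_nden)
    have acc: "\<forall>e. accTden [s] (ctx3 L n d e) ?acc (store_rows q s L (summary_size q d))"
      by (intro allI accTden_store[OF q] nden_summary_sizeE ctx_nden nden_Num)
    have "\<exists>B. answers ?S ?T (query_prog k L ?M ?acc) (fit_prog k L) k A s B \<and>
        l1_lowrank_approx k (real q ^ L * real (k + 1)) A B"
    proof -
      have "real q ^ L > 0" using q by simp
      moreover have "length s \<le> N" "k * d \<le> N" "K2 \<le> ?S" "length s \<le> ?S" "k * d + d \<le> ?S"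
        using S N(4) tot len kd by linarith+
      ultimately show ?thesis
        using K2[rule_format, OF A d M[rule_format] acc[rule_format] sk _ N(1-3) _ _ _ T'(2)] by blast
    qed
    then show "\<exists>B. streaming_outputs ?S ?T (ini_prog q L) (upd_prog q L) (query_prog k L ?M ?acc) (fit_prog k L) k A B \<and>
            l1_lowrank_approx k (real (k + 1) ^ L * real (k + 1)) A B"
      using s(1) unfolding streaming_outputs_def dims q_def by blast
  qed
qed

lemma distributed_guarantee:
  fixes \<gamma> :: real
  assumes g: "\<gamma> > 0" and L: "L = nat \<lceil>1 / \<gamma>\<rceil>"
  shows "\<exists>leaf mrg qry fit c. \<forall>n d. \<forall>A \<in> carrier_mat n d. n \<ge> 1 \<longrightarrow> d \<ge> 1 \<longrightarrow>
       (\<forall>t. valid_tree \<gamma> n t \<longrightarrow>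
         (\<exists>B. distributed_outputs (space_bound \<gamma> c n d) (poly_bound c n d) leaf mrg qry fit k A t B \<and>
              l1_lowrank_approx k (real (k + 1) ^ Suc L * real (k + 1)) A B))"
proof -
  define q where "q = k + 1"
  have q: "q \<ge> 1" by (simp add: q_def)
  let ?M = "Num q"
  let ?acc = "store_accE q (Num 0) (summary_sizeE q)"
  obtain K1 where K1: "\<forall>n d A S T N G. A \<in> carrier_mat n d \<longrightarrow> d \<ge> 1 \<longrightarrow>
     2 \<le> N \<longrightarrow> n \<le> N \<longrightarrow> d \<le> N \<longrightarrow> G \<le> N \<longrightarrow> summary_size q d \<le> N \<longrightarrow>
     K1 \<le> S \<longrightarrow> N ^ K1 \<le> T \<longrightarrow> G * summary_size q d \<le> S \<longrightarrow> G \<ge> 1 \<longrightarrow>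
     (\<forall>t. (\<forall>I\<in>set (blocks t). length I \<le> G \<and> set I \<subseteq> {..<n}) \<longrightarrow> fan_in_le G t \<longrightarrow>
       (\<exists>s. summarized S T (leaf_prog q L) (merge_prog q L) A t s \<and>
          summarizes q A (concat (blocks t)) (Suc (height t)) s))"
    using distributed_summary[OF q, of L] by blast
  obtain K2 where "answered_within K2 k L ?M ?acc"
    using answers_exist by blast
  note K2 = this[unfolded answered_within_def]
  define a where "a = q * q + 1"
  obtain c where c: "\<forall>n\<ge>1. \<forall>d\<ge>1. K1 + K2 \<le> space_bound \<gamma> c n d \<and>
     a * (nat \<lceil>real n powr \<gamma>\<rceil> * d ^ q) \<le> space_bound \<gamma> c n d \<and>
     (2 + n + d + a * (nat \<lceil>real n powr \<gamma>\<rceil> * d ^ q)) ^ (K1 + K2) \<le> poly_bound c n d"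
    using resources_suffice[OF g] by blast
  show ?thesis
  proof (rule exI[of _ "leaf_prog q L"], rule exI[of _ "merge_prog q L"], rule exI[of _ "query_prog k L ?M ?acc"],
      rule exI[of _ "fit_prog k L"], rule exI[of _ c], intro allI ballI impI)
    fix n d t and A :: "real mat" assume A: "A \<in> carrier_mat n d" and n: "n \<ge> 1" and d: "d \<ge> 1" and t: "valid_tree \<gamma> n t"
    let ?S = "space_bound \<gamma> c n d" and ?T = "poly_bound c n d"
    define G where "G = nat \<lceil>real n powr \<gamma>\<rceil>"
    define N where "N = 2 + n + d + a * (G * d ^ q)"
    have dims: "dim_row A = n" "dim_col A = d" using A by auto
    have "real n powr \<gamma> > 0" using n by simp
    then have G: "G \<ge> 1" unfolding G_def by linarith
    have S: "K1 + K2 \<le> ?S" "a * (G * d ^ q) \<le> ?S" and T: "N ^ (K1 + K2) \<le> ?T"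
      using c n d by (auto simp: G_def N_def)
    have N: "2 \<le> N" "n \<le> N" "d \<le> N" "a * (G * d ^ q) \<le> N" by (simp_all add: N_def)
    have T': "N ^ K1 \<le> ?T" "N ^ K2 \<le> ?T"
      using N(1) T power_increasing[of K1 "K1 + K2" N] power_increasing[of K2 "K1 + K2" N] by linarith+
    have dq: "d \<le> d ^ q" "1 \<le> d ^ q" using d q self_le_power[of d q] by auto
    have GD: "G * summary_size q d \<le> a * (G * d ^ q)"
    proof -
      have "G * summary_size q d = (q * q) * (G * d ^ q)" by (simp add: summary_size_def mult_ac)
      also have "\<dots> \<le> a * (G * d ^ q)" by (rule mult_right_mono) (simp_all add: a_def)
      finally show ?thesis .
    qed
    have D1: "summary_size q d \<le> G * summary_size q d" using G mult_le_mono1[OF G, of "summary_size q d"] by simp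
    \<comment> \<open>The right factor and one row, which form the input of \<open>fit\<close>,
      together take no more space than one summary.\<close>
    have qd: "q * d \<le> summary_size q d"
    proof -
      have "q * d * 1 \<le> q * d ^ q * q" using dq q by (intro mult_le_mono) auto
      then show ?thesis by (simp add: summary_size_def mult_ac)
    qed
    have GN: "G \<le> N"
    proof -
      have "G * 1 \<le> G * d ^ q" by (rule mult_le_mono2[OF dq(2)])
      moreover have "1 * (G * d ^ q) \<le> a * (G * d ^ q)" by (rule mult_le_mono1) (simp add: a_def)
      ultimately show ?thesis using N(4) by linarith
    qed
    have blk: "\<forall>I\<in>set (blocks t). length I \<le> G \<and> set I \<subseteq> {..<n}"
    proof
      fix I assume I: "I \<in> set (blocks t)"
      then have "real (length I) \<le> real n powr \<gamma>" using t by (simp add: valid_tree_def)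
      then have "length I \<le> G" unfolding G_def by linarith
      moreover have "set I \<subseteq> {..<n}" using t I by (auto simp: valid_tree_def)
      ultimately show "length I \<le> G \<and> set I \<subseteq> {..<n}" ..
    qed
    have fan: "fan_in_le G t" and ht: "height t \<le> L" using t by (simp_all add: valid_tree_def G_def L)
    obtain s where s: "summarized ?S ?T (leaf_prog q L) (merge_prog q L) A t s"
      "summarizes q A (concat (blocks t)) (Suc (height t)) s"
    proof -
      have "summary_size q d \<le> N" "K1 \<le> ?S" "G * summary_size q d \<le> ?S"
        using S GD D1 N(4) by linarith+
      from K1[rule_format, OF A d N(1-3) GN this(1,2) T'(1) this(3) G blk[rule_format] fan]
      show ?thesis using that by blast
    qed
    have s': "summarizes q A (concat (blocks t)) (Suc L) s"
      by (rule summarizes_mono[OF s(2) _ q]) (use ht in simp)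
    have len: "length s = summary_size q d" using s' by (simp add: summarizes_def dims)
    \<comment> \<open>The blocks partition the row indices, so the sum over the leaves is the
      seminorm of the whole matrix, whatever the order of the rows.\<close>
    have tn: "true_norm q A \<tau> (concat (blocks t)) x = nrm q n (colsel A \<tau>) x" for \<tau> x
      using t by (simp add: true_norm_def nrm_def valid_tree_def sum_list_distinct_conv_sum_set del: set_concat)
    have st: "nrm q q (store_rows q s 0 (summary_size q d) \<tau>) x = nrm q q (slot q s 0 \<tau>) x" for \<tau> x
      by (rule nrm_cong) (simp_all add: store_rows_def)
    have sk: "sketches k A (real q ^ Suc L) q (store_rows q s 0 (summary_size q d))"
      unfolding sketches_def dims q_def[symmetric] st tn[symmetric]
      using s' by (simp add: summarizes_def dims)
    have M: "\<forall>e. nden [s] (ctx3 L n d e) ?M q" by (intro allI nden_Num)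
    have acc: "\<forall>e. accTden [s] (ctx3 L n d e) ?acc (store_rows q s 0 (summary_size q d))"
      by (intro allI accTden_store[OF q] nden_summary_sizeE ctx_nden nden_Num)
    have kd: "k * d + d = q * d" by (simp add: q_def)
    have "\<exists>B. answers ?S ?T (query_prog k L ?M ?acc) (fit_prog k L) k A s B \<and>
        l1_lowrank_approx k (real q ^ Suc L * real (k + 1)) A B"
    proof -
      have "real q ^ Suc L > 0" using q by simp
      moreover have "length s \<le> N" "k * d \<le> N" "K2 \<le> ?S" "length s \<le> ?S" "k * d + d \<le> ?S"
        using S GD D1 N(4) qd len kd by linarith+
      ultimately show ?thesis
        using K2[rule_format, OF A d M[rule_format] acc[rule_format] sk _ N(1-3) _ _ _ T'(2)] by blast
    qed
    then show "\<exists>B. distributed_outputs ?S ?T (leaf_prog q L) (merge_prog q L) (query_prog k L ?M ?acc) (fit_prog k L) k A t B \<and>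
            l1_lowrank_approx k (real (k + 1) ^ Suc L * real (k + 1)) A B"
      using s(1) unfolding distributed_outputs_def dims q_def by blast
  qed
qed

lemma l1_opt_nonneg: "l1_opt k A \<ge> 0"
proof -
  let ?X = "{A' \<in> carrier_mat (dim_row A) (dim_col A). vec_space.rank (dim_row A) A' \<le> k}"
  have "0\<^sub>m (dim_row A) (dim_col A) \<in> ?X" by (simp add: vec_space.rank_0I)
  then have "?X \<noteq> {}" by blast
  then show ?thesis
    unfolding l1_opt_def by (intro cINF_greatest) (auto simp: l1_norm_def intro!: sum_nonneg)
qed

lemma l1_lowrank_approx_mono: "l1_lowrank_approx k C A B \<Longrightarrow> C \<le> C' \<Longrightarrow> l1_lowrank_approx k C' A B"
  unfolding l1_lowrank_approx_def using mult_right_mono[OF _ l1_opt_nonneg] by (meson order_trans)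

theorem theorem5:
  fixes \<gamma> :: real
  assumes "\<gamma> > 0"
  shows "\<exists>p :: real poly. \<forall>k :: nat.
    (\<exists>ini upd qry fit c. \<forall>n d. \<forall>A \<in> carrier_mat n d. n \<ge> 1 \<longrightarrow> d \<ge> 1 \<longrightarrow>
       (\<exists>B. streaming_outputs (space_bound \<gamma> c n d) (poly_bound c n d) ini upd qry fit k A B \<and>
            l1_lowrank_approx k (poly p (real k)) A B)) \<and>
    (\<exists>leaf mrg qry fit c. \<forall>n d. \<forall>A \<in> carrier_mat n d. n \<ge> 1 \<longrightarrow> d \<ge> 1 \<longrightarrow>
       (\<forall>t. valid_tree \<gamma> n t \<longrightarrow>
         (\<exists>B. distributed_outputs (space_bound \<gamma> c n d) (poly_bound c n d) leaf mrg qry fit k A t B \<and>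
              l1_lowrank_approx k (poly p (real k)) A B)))"
proof -
  define L where "L = nat \<lceil>1 / \<gamma>\<rceil>"
  \<comment> \<open>The polynomial is a power of \<open>x + 1\<close> whose degree depends on
    \<open>\<gamma>\<close> only, so it can be fixed before \<open>k\<close>. The streaming bound
    has one factor less, because rows enter the store unsketched.\<close>
  have poly: "poly ([:1, 1:] ^ (L + 2)) (real k) = real (k + 1) ^ Suc L * real (k + 1)" for k
    by (simp add: poly_power algebra_simps)
  have le: "real (k + 1) ^ L * real (k + 1) \<le> poly ([:1, 1:] ^ (L + 2)) (real k)" for k
    unfolding poly by (intro mult_right_mono power_increasing) auto
  show ?thesis
  proof (intro exI[of _ "[:1, 1:] ^ (L + 2)"] allI conjI)
    fix k
    show "\<exists>ini upd qry fit c. \<forall>n d. \<forall>A \<in> carrier_mat n d. n \<ge> 1 \<longrightarrow> d \<ge> 1 \<longrightarrow>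
       (\<exists>B. streaming_outputs (space_bound \<gamma> c n d) (poly_bound c n d) ini upd qry fit k A B \<and>
            l1_lowrank_approx k (poly ([:1, 1:] ^ (L + 2)) (real k)) A B)"
      using streaming_guarantee[OF assms L_def, of k] l1_lowrank_approx_mono[OF _ le[of k]] by meson
    show "\<exists>leaf mrg qry fit c. \<forall>n d. \<forall>A \<in> carrier_mat n d. n \<ge> 1 \<longrightarrow> d \<ge> 1 \<longrightarrow>
       (\<forall>t. valid_tree \<gamma> n t \<longrightarrow>
         (\<exists>B. distributed_outputs (space_bound \<gamma> c n d) (poly_bound c n d) leaf mrg qry fit k A t B \<and>
              l1_lowrank_approx k (poly ([:1, 1:] ^ (L + 2)) (real k)) A B))"
      unfolding poly by (rule distributed_guarantee[OF assms L_def])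
  qed
qed

end
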